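(* For all stationary weakly sub-Poisson point processes $\Phi$ on $\mathbb{R}^d$ of intensity $\lambda$, $$0<\frac12\,\frac{1}{(\lambda(3^d-1))^{1/d}}\le r_c(\Phi)\le\sqrt d\left(\frac{\log(3^d-2)}{\lambda}\right)^{1/d}<\infty.$$ Examples of weakly sub-Poisson point processes are determinantal point processes with trace-class integral kernels.
   Context: A point process on $\mathbb{R}^d$ is a random locally finite counting measure, assumed to have Radon mean measure. $\Phi$ is weakly sub-Poisson if both (i) $\mathsf{P}(\Phi(B)=0)\le e^{-\mathsf{E}(\Phi(B))}$ for all Borel sets $B\subset\mathbb{R}^d$, and (ii) $\mathsf{E}\bigl(\prod_{i=1}^k\Phi(B_i)\bigr)\le\prod_{i=1}^k\mathsf{E}(\Phi(B_i))$ for all $k\ge1$ and all mutually disjoint bounded Borel sets $B_1,\dots,B_k\subset\mathbb{R}^d$. For $r\ge0$, $C(\Phi,r)=\bigcup_{X\in\Phi}B_X(r)$, where $B_X(r)$ is the (closed) ball of radius $r$ centered at $X$; it percolates if it has an unbounded connected subset, and $r_c(\Phi)=\inf\{r>0:\mathsf{P}(C(\Phi,r)\text{ percolates})>0\}$. Determinantal point process with trace-class integral kernel: let $\mu$ be a Radon measure on $\mathbb{R}^d$ and $K:\mathbb{R}^d\times\mathbb{R}^d\to\mathbb{C}$ be locally square-integrable with respect to $\mu^{\otimes2}$, such that for each compact $D$ the operator $\mathcal K_Df(x)=\int_DK(x,y)f(y)\,\mu(dy)$ on $L^2(D,\mu)$ is Hermitian, positive semi-definite and trace-class, with eigenvalues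 $\lambda_j^D\in[0,1]$ and normalized eigenfunctions $\phi_j^D$. Put $K_D(x,y)=\sum_j\lambda_j^D\phi_j^D(x)\overline{\phi_j^D(y)}$. The process is the unique point process whose restriction to each compact $D$ is a simple point process with joint intensities (densities of the factorial moment measures) with respect to $\mu^{\otimes k}$ given by $\rho^{(k)}(x_1,\dots,x_k)=\det\bigl(K_D(x_i,x_j)\bigr)_{1\le i,j\le k}$ for all $k$.
   Formalization: The upper bound on r_c is asserted only for d ≥ 2: for d = 1 the printed bound is log(3−2)/λ = 0, contradicting the positive lower bound, which is kept for all d ≥ 1; the intensity λ is taken positive. *)

theory Defs
  imports
    "HOL-Probability.Probability"
    "Jordan_Normal_Form.Determinant"
begin

section \<open>Point processes\<close>

definition locally_finite_counting_measures :: "'a::euclidean_space measure set" where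
  "locally_finite_counting_measures =
     {\<phi>. sets \<phi> = sets borel \<and> (\<forall>B\<in>sets borel. bounded B \<longrightarrow> emeasure \<phi> B \<in> \<nat>)}"

text \<open>The space of locally finite counting measures carries the smallest sigma-algebra that makes
  all evaluations at Borel sets measurable (compare \<^const>\<open>subprob_algebra\<close>).\<close>

definition configuration_space :: "'a::euclidean_space measure measure" where
  "configuration_space =
     (SUP B\<in>sets borel. vimage_algebra locally_finite_counting_measures (\<lambda>\<phi>. emeasure \<phi> B) borel)"

definition mean_measure :: "'w measure \<Rightarrow> ('w \<Rightarrow> 'a::euclidean_space measure) \<Rightarrow> 'a set \<Rightarrow> ennreal" where
  "mean_measure M \<Phi> B = (\<integral>\<^sup>+\<omega>. emeasure (\<Phi> \<omega>) B \<partial>M)"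

definition point_process :: "'w measure \<Rightarrow> ('w \<Rightarrow> 'a::euclidean_space measure) \<Rightarrow> bool" where
  "point_process M \<Phi> \<longleftrightarrow>
     prob_space M \<and>
     \<Phi> \<in> M \<rightarrow>\<^sub>M configuration_space \<and>
     (\<forall>B\<in>sets borel. bounded B \<longrightarrow> mean_measure M \<Phi> B < \<infinity>)"

definition stationary :: "'w measure \<Rightarrow> ('w \<Rightarrow> 'a::euclidean_space measure) \<Rightarrow> bool" where
  "stationary M \<Phi> \<longleftrightarrow>
     (\<forall>a. distr M configuration_space (\<lambda>\<omega>. distr (\<Phi> \<omega>) borel (\<lambda>x. x + a))
          = distr M configuration_space \<Phi>)"

definition has_intensity :: "'w measure \<Rightarrow> ('w \<Rightarrow> 'a::euclidean_space measure) \<Rightarrow> real \<Rightarrow> bool" where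
  "has_intensity M \<Phi> l \<longleftrightarrow>
     (\<forall>B\<in>sets borel. mean_measure M \<Phi> B = ennreal l * emeasure lborel B)"

text \<open>The function $e^{-m}$ for $m \in [0, \infty]$; condition (i) of weak sub-Poissonianity
  ranges over all Borel sets, so the mean measure may be infinite there.\<close>

definition exp_neg :: "ennreal \<Rightarrow> real" where
  "exp_neg m = (if m = \<infinity> then 0 else exp (- enn2real m))"

definition weakly_sub_Poisson :: "'w measure \<Rightarrow> ('w \<Rightarrow> 'a::euclidean_space measure) \<Rightarrow> bool" where
  "weakly_sub_Poisson M \<Phi> \<longleftrightarrow>
     point_process M \<Phi> \<and>
     (\<forall>B\<in>sets borel. \<P>(\<omega> in M. emeasure (\<Phi> \<omega>) B = 0) \<le> exp_neg (mean_measure M \<Phi> B)) \<and>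
     (\<forall>(k::nat) B. 1 \<le> k \<and> (\<forall>i<k. B i \<in> sets borel \<and> bounded (B i)) \<and> disjoint_family_on B {..<k} \<longrightarrow>
        (\<integral>\<^sup>+\<omega>. (\<Prod>i<k. emeasure (\<Phi> \<omega>) (B i)) \<partial>M) \<le> (\<Prod>i<k. mean_measure M \<Phi> (B i)))"

section \<open>Continuum percolation\<close>

definition covered_region :: "'a::euclidean_space measure \<Rightarrow> real \<Rightarrow> 'a set" where
  "covered_region \<phi> r = (\<Union>x\<in>{x. emeasure \<phi> {x} \<noteq> 0}. cball x r)"

definition percolates :: "'a::euclidean_space set \<Rightarrow> bool" where
  "percolates C \<longleftrightarrow> (\<exists>S\<subseteq>C. connected S \<and> \<not> bounded S)"

text \<open>Valued in the extended reals, where the infimum of the empty set is infinite.\<close>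

definition critical_radius :: "'w measure \<Rightarrow> ('w \<Rightarrow> 'a::euclidean_space measure) \<Rightarrow> ereal" where
  "critical_radius M \<Phi> =
     Inf (ereal ` {r. 0 < r \<and> 0 < \<P>(\<omega> in M. percolates (covered_region (\<Phi> \<omega>) r))})"

section \<open>Operators on the Hilbert space of square-integrable functions\<close>

text \<open>Elements of the Hilbert space are represented by functions; equality of elements is equality
  almost everywhere.\<close>

definition L2 :: "'a measure \<Rightarrow> ('a \<Rightarrow> complex) set" where
  "L2 \<nu> = {f \<in> borel_measurable \<nu>. integrable \<nu> (\<lambda>x. (cmod (f x))\<^sup>2)}"

definition L2_inner :: "'a measure \<Rightarrow> ('a \<Rightarrow> complex) \<Rightarrow> ('a \<Rightarrow> complex) \<Rightarrow> complex" where
  "L2_inner \<nu> f g = (\<integral>x. f x * cnj (g x) \<partial>\<nu>)"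

definition integral_operator ::
    "'a measure \<Rightarrow> ('a \<Rightarrow> 'a \<Rightarrow> complex) \<Rightarrow> ('a \<Rightarrow> complex) \<Rightarrow> 'a \<Rightarrow> complex" where
  "integral_operator \<nu> K f = (\<lambda>x. \<integral>y. K x y * f y \<partial>\<nu>)"

text \<open>Bases are indexed by a subset \<open>J\<close> of the naturals, since the space may be
  finite-dimensional.\<close>

definition orthonormal_basis :: "'a measure \<Rightarrow> nat set \<Rightarrow> (nat \<Rightarrow> 'a \<Rightarrow> complex) \<Rightarrow> bool" where
  "orthonormal_basis \<nu> J e \<longleftrightarrow>
     (\<forall>j\<in>J. e j \<in> L2 \<nu>) \<and>
     (\<forall>i\<in>J. \<forall>j\<in>J. L2_inner \<nu> (e i) (e j) = (if i = j then 1 else 0)) \<and>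
     (\<forall>f\<in>L2 \<nu>. (\<forall>j\<in>J. L2_inner \<nu> f (e j) = 0) \<longrightarrow> (AE x in \<nu>. f x = 0))"

definition hermitian_operator :: "'a measure \<Rightarrow> (('a \<Rightarrow> complex) \<Rightarrow> 'a \<Rightarrow> complex) \<Rightarrow> bool" where
  "hermitian_operator \<nu> T \<longleftrightarrow>
     (\<forall>f\<in>L2 \<nu>. \<forall>g\<in>L2 \<nu>. L2_inner \<nu> (T f) g = L2_inner \<nu> f (T g))"

definition positive_semidefinite_operator ::
    "'a measure \<Rightarrow> (('a \<Rightarrow> complex) \<Rightarrow> 'a \<Rightarrow> complex) \<Rightarrow> bool" where
  "positive_semidefinite_operator \<nu> T \<longleftrightarrow> (\<forall>f\<in>L2 \<nu>. L2_inner \<nu> (T f) f \<in> \<real>\<^sub>\<ge>\<^sub>0)"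

text \<open>Only meaningful for positive semi-definite \<open>T\<close>, where $|T| = T$, so that being trace-class
  means that $\sum_j \langle T e_j, e_j \rangle$ is finite for every orthonormal basis $(e_j)$.\<close>

definition positive_trace_class_operator ::
    "'a measure \<Rightarrow> (('a \<Rightarrow> complex) \<Rightarrow> 'a \<Rightarrow> complex) \<Rightarrow> bool" where
  "positive_trace_class_operator \<nu> T \<longleftrightarrow>
     (\<forall>J e. orthonormal_basis \<nu> J e \<longrightarrow> (\<lambda>j. Re (L2_inner \<nu> (T (e j)) (e j))) summable_on J)"

text \<open>A complete system of eigenpairs: the \<open>lam j\<close> are the eigenvalues counted with multiplicity
  (zero included), the \<open>f j\<close> the corresponding normalized eigenfunctions.\<close>

definition eigensystem ::
    "'a measure \<Rightarrow> (('a \<Rightarrow> complex) \<Rightarrow> 'a \<Rightarrow> complex) \<Rightarrow>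
     nat set \<Rightarrow> (nat \<Rightarrow> real) \<Rightarrow> (nat \<Rightarrow> 'a \<Rightarrow> complex) \<Rightarrow> bool" where
  "eigensystem \<nu> T J lam f \<longleftrightarrow>
     orthonormal_basis \<nu> J f \<and>
     (\<forall>j\<in>J. AE x in \<nu>. T (f j) x = complex_of_real (lam j) * f j x)"

definition spectral_kernel ::
    "nat set \<Rightarrow> (nat \<Rightarrow> real) \<Rightarrow> (nat \<Rightarrow> 'a \<Rightarrow> complex) \<Rightarrow> 'a \<Rightarrow> 'a \<Rightarrow> complex" where
  "spectral_kernel J lam f x y = (\<Sum>\<^sub>\<infinity>j\<in>J. complex_of_real (lam j) * f j x * cnj (f j y))"

section \<open>Determinantal point processes\<close>

text \<open>Sets of \<open>k\<close>-tuples are sets of functions in \<open>{..<k} \<rightarrow>\<^sub>E UNIV\<close>. The factorial power of a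
  counting measure gives the tuple \<open>x\<close> the mass
  $\prod_{i<k} (\phi\{x_i\} - \#\{l < i : x_l = x_i\})$; for simple $\phi$ this is the indicator of
  the tuples of pairwise distinct points of $\phi$. The truncated subtraction is harmless, as a
  factor 0 occurs before any difference could become negative.\<close>

definition factorial_power :: "'a measure \<Rightarrow> nat \<Rightarrow> (nat \<Rightarrow> 'a) set \<Rightarrow> ennreal" where
  "factorial_power \<phi> k A =
     (\<integral>\<^sup>+x. (\<Prod>i<k. emeasure \<phi> {x i} - of_nat (card {l. l < i \<and> x l = x i})) \<partial>count_space A)"

definition factorial_moment_measure ::
    "'w measure \<Rightarrow> ('w \<Rightarrow> 'a measure) \<Rightarrow> nat \<Rightarrow> (nat \<Rightarrow> 'a) set \<Rightarrow> ennreal" where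
  "factorial_moment_measure M \<Phi> k A = (\<integral>\<^sup>+\<omega>. factorial_power (\<Phi> \<omega>) k A \<partial>M)"

text \<open>The restriction of \<open>\<Phi>\<close> to \<open>D\<close> has joint intensities \<open>\<rho> k\<close> with respect to the \<open>k\<close>-th power
  of \<open>\<mu>\<close>.\<close>

definition joint_intensities_on ::
    "'w measure \<Rightarrow> ('w \<Rightarrow> 'a::euclidean_space measure) \<Rightarrow> 'a measure \<Rightarrow> 'a set \<Rightarrow>
     (nat \<Rightarrow> (nat \<Rightarrow> 'a) \<Rightarrow> ennreal) \<Rightarrow> bool" where
  "joint_intensities_on M \<Phi> \<mu> D \<rho> \<longleftrightarrow>
     (\<forall>k\<ge>1. \<forall>A\<in>sets (PiM {..<k} (\<lambda>_. borel)). A \<subseteq> ({..<k} \<rightarrow>\<^sub>E D) \<longrightarrow>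
        factorial_moment_measure M \<Phi> k A = (\<integral>\<^sup>+x\<in>A. \<rho> k x \<partial>PiM {..<k} (\<lambda>_. \<mu>)))"

definition radon_measure :: "'a::euclidean_space measure \<Rightarrow> bool" where
  "radon_measure \<mu> \<longleftrightarrow> sets \<mu> = sets borel \<and> (\<forall>D. compact D \<longrightarrow> emeasure \<mu> D < \<infinity>)"

definition locally_square_integrable ::
    "'a::euclidean_space measure \<Rightarrow> ('a \<Rightarrow> 'a \<Rightarrow> complex) \<Rightarrow> bool" where
  "locally_square_integrable \<mu> K \<longleftrightarrow>
     (\<lambda>(x, y). K x y) \<in> borel_measurable (\<mu> \<Otimes>\<^sub>M \<mu>) \<and>
     (\<forall>C. compact C \<longrightarrow> set_integrable (\<mu> \<Otimes>\<^sub>M \<mu>) C (\<lambda>(x, y). (cmod (K x y))\<^sup>2))"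

text \<open>Spectral kernels are determined only up to null sets, and the determinants below are real and
  nonnegative almost everywhere; \<^const>\<open>Re\<close> merely converts the type.\<close>

definition determinantal_process ::
    "'w measure \<Rightarrow> ('w \<Rightarrow> 'a::euclidean_space measure) \<Rightarrow> 'a measure \<Rightarrow>
     ('a \<Rightarrow> 'a \<Rightarrow> complex) \<Rightarrow> bool" where
  "determinantal_process M \<Phi> \<mu> K \<longleftrightarrow>
     point_process M \<Phi> \<and> radon_measure \<mu> \<and> locally_square_integrable \<mu> K \<and>
     (\<forall>D. compact D \<longrightarrow>
        (let \<nu> = restrict_space \<mu> D; T = integral_operator \<nu> K in
         hermitian_operator \<nu> T \<and>
         positive_semidefinite_operator \<nu> T \<and>
         positive_trace_class_operator \<nu> T \<and>
         (AE \<omega> in M. \<forall>x\<in>D. emeasure (\<Phi> \<omega>) {x} \<le> 1) \<and>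
         (\<exists>J lam f. eigensystem \<nu> T J lam f \<and> (\<forall>j\<in>J. 0 \<le> lam j \<and> lam j \<le> 1) \<and>
            joint_intensities_on M \<Phi> \<mu> D
              (\<lambda>k x. ennreal (Re (Determinant.det
                 (Matrix.mat k k (\<lambda>(i, j). spectral_kernel J lam f (x i) (x j)))))))))"

end

(* A locally finite counting measure is integer valued, so its mass can be localised at atoms, and
   percolation of the balls means that the graph joining atoms at distance at most 2 r has an infinite
   cluster.

   Lower bound: cut the space into cubes of side 2 r. An infinite cluster produces self-avoiding walks
   of every length through occupied, neighbouring cubes. By the moment inequality such a walk
   of n + 1 given cubes has probability at most (l (2 r)^d)^(n + 1), and there are at most (3^d - 1)^n
   walks from a given cube, so their expected number tends to 0.

   Upper bound: take cubes of side r / sqrt d, so that atoms in neighbouring cubes are within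
   distance 2 r, and look at a quadrant of a two-dimensional layer of cubes with triangular-lattice
   neighbourhoods. If the occupied cluster of the corner is finite, then a vacant walk separates it,
   and for some k this walk starts at (k, 0) and visits at least k + 1 cubes. By the void
   inequality the probability is at most the sum of 6^k q^(k + 1) = q / (1 - 6 q), which is less
   than 1 because q = exp (- l (r / sqrt d)^d) < 1 / (3^d - 2) <= 1 / 7.

   Determinantal processes: truncated kernels are Gram kernels, so the moment inequality is
   Hadamard's inequality in the limit. On a compact set, orthonormality turns the factorial moments
   into k! e_k(lam_1, lam_2, ...), and inclusion-exclusion gives the void probability
   prod (1 - lam_j) <= exp (- sum lam_j). Inner regularity of the mean measure extends this bound to
   all Borel sets. *)

theory Submission
  imports Defs
begin

section \<open>Counting measures\<close>

text \<open>\<open>critical_radius\<close> only asks for a positive percolation probability, so no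
  zero-one law enters. But \<open>measure\<close> is 0 on non-measurable sets, so the upper bound
  needs the percolation event to be measurable although it quantifies over uncountably many points;
  it is rewritten through finite chains of atoms and then through countably many balls.

  In dimension d a finite cluster is blocked by a surface of vacant cubes, and surfaces are hard to
  count. In a planar layer the blocking sets contain walks, and on the triangular lattice clusters
  and blocking walks share one adjacency. The resulting threshold 1/7 equals 1 / (3^d - 2) for d = 2
  and is weaker for larger d. For d = 1 the claimed upper bound would be 0, hence the restriction to
  d at least 2.

  A determinantal kernel is given only almost everywhere and separately for each compact set, and
  its series may diverge on null sets. Determinants are therefore handled for finite truncations and
  passed to the limit under a majorant built from the diagonal, which does not depend on the
  truncation.\<close>

lemma space_configuration_space: "space configuration_space = locally_finite_counting_measures"
  unfolding configuration_space_def by (subst space_Sup_eq_UN) (auto intro: exI[of _ "{}"])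

lemma measurable_emeasure_configuration_space [measurable]:
  assumes "B \<in> sets borel"
  shows "(\<lambda>\<phi>. emeasure \<phi> B) \<in> borel_measurable configuration_space"
  unfolding configuration_space_def using assms
  by (auto intro!: measurable_Sup1 measurable_vimage_algebra1)

lemma ennreal_Nats_cases:
  assumes "(x::ennreal) \<in> \<nat>"
  obtains n :: nat where "x = of_nat n"
  using assms by (auto elim: Nats_cases)

lemma ennreal_Nats_less_one: "(x::ennreal) \<in> \<nat> \<Longrightarrow> x < 1 \<Longrightarrow> x = 0"
  by (elim ennreal_Nats_cases) (metis of_nat_0 of_nat_1 of_nat_less_iff less_one)

lemma lfcm_sets: "\<phi> \<in> locally_finite_counting_measures \<Longrightarrow> sets \<phi> = sets borel"
  by (simp add: locally_finite_counting_measures_def)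

lemma lfcm_Nats:
  "\<phi> \<in> locally_finite_counting_measures \<Longrightarrow> B \<in> sets borel \<Longrightarrow> bounded B \<Longrightarrow> emeasure \<phi> B \<in> \<nat>"
  by (simp add: locally_finite_counting_measures_def)

lemma lfcm_finite:
  "\<phi> \<in> locally_finite_counting_measures \<Longrightarrow> B \<in> sets borel \<Longrightarrow> bounded B \<Longrightarrow> emeasure \<phi> B < \<infinity>"
  by (metis lfcm_Nats ennreal_Nats_cases of_nat_less_top infinity_ennreal_def)

definition atoms :: "'a measure \<Rightarrow> 'a set" where
  "atoms \<phi> = {x. emeasure \<phi> {x} \<noteq> 0}"

text \<open>Continuity from above applies since bounded sets have finite mass, and a natural number
  below 1 is 0, so the limit 0 is reached at a finite stage.\<close>

lemma emeasure_cball_eq_0: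
  fixes \<phi> :: "'a::euclidean_space measure"
  assumes \<phi>: "\<phi> \<in> locally_finite_counting_measures" and B: "B \<in> sets borel" "bounded B"
    and x: "emeasure \<phi> ({x} \<inter> B) = 0"
  shows "\<exists>n. emeasure \<phi> (cball x (1 / Suc n) \<inter> B) = 0"
proof -
  let ?A = "\<lambda>n. cball x (1 / real (Suc n)) \<inter> B"
  have sets[simp]: "sets \<phi> = sets borel" using \<phi> by (rule lfcm_sets)
  have "(\<lambda>n. emeasure \<phi> (?A n)) \<longlonglongrightarrow> emeasure \<phi> (\<Inter>n. ?A n)"
  proof (rule Lim_emeasure_decseq)
    show "range ?A \<subseteq> sets \<phi>" using B by auto
    show "decseq ?A"
      by (intro decseq_SucI Int_mono subset_cball) (auto simp: divide_simps)
    show "emeasure \<phi> (?A i) \<noteq> \<infinity>" for i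
      using lfcm_finite[OF \<phi>, of "?A i"] B by (auto simp: bounded_Int)
  qed
  moreover have "(\<Inter>n. ?A n) = {x} \<inter> B"
  proof (intro equalityI subsetI)
    fix y assume y: "y \<in> (\<Inter>n. ?A n)"
    have "dist x y \<le> 0"
    proof (rule ccontr)
      assume "\<not> dist x y \<le> 0"
      then obtain n where "inverse (real (Suc n)) < dist x y" 
        using reals_Archimedean[of "dist x y"] by (auto simp: not_le)
      moreover have "dist x y \<le> 1 / Suc n" using y by auto
      ultimately show False by (simp add: inverse_eq_divide)
    qed
    then show "y \<in> {x} \<inter> B" using y by auto
  qed auto
  ultimately have "(\<lambda>n. emeasure \<phi> (?A n)) \<longlonglongrightarrow> 0" using x by simp
  then have "eventually (\<lambda>n. emeasure \<phi> (?A n) < 1) sequentially"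
    by (rule order_tendstoD) simp
  then obtain n where "emeasure \<phi> (?A n) < 1" by (auto simp: eventually_sequentially)
  then have "emeasure \<phi> (?A n) = 0"
    using lfcm_Nats[OF \<phi>, of "?A n"] B by (intro ennreal_Nats_less_one) (auto simp: bounded_Int)
  then show ?thesis ..
qed

text \<open>Integrality makes every point without an atom have a null neighbourhood, so a bounded set
  without atoms is null by compactness.\<close>

lemma bounded_atomless_null:
  fixes \<phi> :: "'a::euclidean_space measure"
  assumes \<phi>: "\<phi> \<in> locally_finite_counting_measures" and B: "B \<in> sets borel" "bounded B"
    and x: "\<And>x. x \<in> B \<Longrightarrow> emeasure \<phi> {x} = 0"
  shows "emeasure \<phi> B = 0"
proof -
  have sets[simp]: "sets \<phi> = sets borel" using \<phi> by (rule lfcm_sets)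
  \<comment> \<open>Every \<open>y\<close> is needed, not only those in \<open>B\<close>: the
    compact set to be covered is the closure, and at its points outside \<open>B\<close> the
    intersection is empty.\<close>
  have "emeasure \<phi> ({y} \<inter> B) = 0" for y using x[of y] by (cases "y \<in> B") auto
  then have "\<forall>y. \<exists>n. emeasure \<phi> (cball y (1 / Suc n) \<inter> B) = 0"
    using emeasure_cball_eq_0[OF \<phi> B] by blast
  then obtain n where n: "\<And>y. emeasure \<phi> (cball y (1 / Suc (n y)) \<inter> B) = 0" by metis
  have "compact (closure B)" using B by simp
  moreover have "closure B \<subseteq> (\<Union>y\<in>closure B. ball y (1 / Suc (n y)))" by auto
  ultimately obtain C where C: "C \<subseteq> closure B" "finite C" "closure B \<subseteq> (\<Union>y\<in>C. ball y (1 / Suc (n y)))"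
    using compactE_image[of "closure B" "closure B" "\<lambda>y. ball y (1 / Suc (n y))"] by (metis open_ball)
  have "B \<subseteq> (\<Union>y\<in>C. cball y (1 / Suc (n y)) \<inter> B)"
  proof
    fix x assume x: "x \<in> B"
    then have "x \<in> (\<Union>y\<in>C. ball y (1 / Suc (n y)))" by (intro subsetD[OF C(3)] subsetD[OF closure_subset])
    then obtain y where "y \<in> C" "x \<in> ball y (1 / Suc (n y))" by (elim UN_E)
    then show "x \<in> (\<Union>y\<in>C. cball y (1 / Suc (n y)) \<inter> B)" using x by (auto intro!: bexI[of _ y])
  qed
  then have "emeasure \<phi> B \<le> emeasure \<phi> (\<Union>y\<in>C. cball y (1 / Suc (n y)) \<inter> B)"
    using B C(2) by (intro emeasure_mono sets.finite_UN sets.Int) auto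
  also have "\<dots> \<le> (\<Sum>y\<in>C. emeasure \<phi> (cball y (1 / Suc (n y)) \<inter> B))"
    using B C(2) by (intro emeasure_subadditive_finite) auto
  also have "\<dots> = 0" using n by simp
  finally show ?thesis by simp
qed

lemma emeasure_neq_0_atom:
  fixes \<phi> :: "'a::euclidean_space measure"
  assumes \<phi>: "\<phi> \<in> locally_finite_counting_measures" and B: "B \<in> sets borel" "emeasure \<phi> B \<noteq> 0"
  shows "atoms \<phi> \<inter> B \<noteq> {}"
proof
  assume *: "atoms \<phi> \<inter> B = {}"
  have sets[simp]: "sets \<phi> = sets borel" using \<phi> by (rule lfcm_sets)
  have "emeasure \<phi> (B \<inter> ball 0 (real n)) = 0" for n
  proof (rule bounded_atomless_null[OF \<phi>])
    show "emeasure \<phi> {x} = 0" if "x \<in> B \<inter> ball 0 (real n)" for x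
      using * that by (auto simp: atoms_def)
  qed (use B in \<open>auto simp: bounded_Int\<close>)
  then have "emeasure \<phi> (\<Union>n::nat. B \<inter> ball 0 (real n)) = 0"
    using B by (intro emeasure_UN_eq_0) auto
  moreover have "(\<Union>n::nat. B \<inter> ball 0 (real n)) = B"
    by (auto simp: reals_Archimedean2)
  ultimately show False using B by simp
qed

lemma emeasure_eq_0_iff_atoms:
  fixes \<phi> :: "'a::euclidean_space measure"
  assumes \<phi>: "\<phi> \<in> locally_finite_counting_measures" and B: "B \<in> sets borel"
  shows "emeasure \<phi> B = 0 \<longleftrightarrow> atoms \<phi> \<inter> B = {}"
proof
  assume B0: "emeasure \<phi> B = 0"
  show "atoms \<phi> \<inter> B = {}"
  proof (intro equalityI subsetI)
    fix x assume x: "x \<in> atoms \<phi> \<inter> B"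
    then have "emeasure \<phi> {x} \<le> emeasure \<phi> B"
      using B lfcm_sets[OF \<phi>] by (intro emeasure_mono) auto
    then show "x \<in> {}" using B0 x by (auto simp: atoms_def)
  qed auto
qed (use emeasure_neq_0_atom[OF assms] in blast)

lemma atom_ge_1:
  fixes \<phi> :: "'a::euclidean_space measure"
  assumes \<phi>: "\<phi> \<in> locally_finite_counting_measures" and x: "x \<in> atoms \<phi>"
  shows "1 \<le> emeasure \<phi> {x}"
  using ennreal_Nats_less_one[OF lfcm_Nats[OF \<phi>, of "{x}"]] x by (force simp: atoms_def not_less)

text \<open>Each atom weighs at least 1, so the mass of an enclosing ball bounds the size of every
  finite set of atoms in it.\<close>

lemma finite_atoms:
  fixes \<phi> :: "'a::euclidean_space measure"
  assumes \<phi>: "\<phi> \<in> locally_finite_counting_measures" and B: "bounded B"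
  shows "finite (atoms \<phi> \<inter> B)"
proof -
  have sets[simp]: "sets \<phi> = sets borel" using \<phi> by (rule lfcm_sets)
  obtain R where R: "B \<subseteq> cball 0 R" using B by (auto simp: bounded_iff subset_iff)
  obtain n where n: "emeasure \<phi> (cball 0 R) = of_nat n"
    using lfcm_Nats[OF \<phi>, of "cball 0 R"] by (auto elim: ennreal_Nats_cases)
  have "card F \<le> n" if F: "finite F" "F \<subseteq> atoms \<phi> \<inter> B" for F
  proof -
    have "of_nat (card F) = (\<Sum>x\<in>F. 1::ennreal)" by simp
    also have "\<dots> \<le> (\<Sum>x\<in>F. emeasure \<phi> {x})"
      using F by (intro sum_mono atom_ge_1[OF \<phi>]) auto
    also have "\<dots> = emeasure \<phi> F" using F by (intro emeasure_eq_sum_singleton[symmetric]) auto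
    also have "\<dots> \<le> emeasure \<phi> (cball 0 R)" using F R by (intro emeasure_mono) auto
    finally show ?thesis using n by simp
  qed
  then show ?thesis by (meson finite_if_finite_subsets_card_bdd)
qed

lemma emeasure_eq_sum_atoms:
  fixes \<phi> :: "'a::euclidean_space measure"
  assumes \<phi>: "\<phi> \<in> locally_finite_counting_measures" and B: "B \<in> sets borel" "bounded B"
  shows "emeasure \<phi> B = (\<Sum>x\<in>atoms \<phi> \<inter> B. emeasure \<phi> {x})"
proof -
  have sets[simp]: "sets \<phi> = sets borel" using \<phi> by (rule lfcm_sets)
  have fin: "finite (atoms \<phi> \<inter> B)" using \<phi> B by (intro finite_atoms)
  then have bor: "atoms \<phi> \<inter> B \<in> sets borel" by (simp add: borel_closed finite_imp_closed)
  have "emeasure \<phi> (B - atoms \<phi> \<inter> B) = 0"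
    using B bor by (subst emeasure_eq_0_iff_atoms[OF \<phi>]) auto
  then have "emeasure \<phi> B = emeasure \<phi> (atoms \<phi> \<inter> B)"
    using plus_emeasure[of "atoms \<phi> \<inter> B" \<phi> "B - atoms \<phi> \<inter> B"] B bor by (simp add: Un_absorb1)
  also have "\<dots> = (\<Sum>x\<in>atoms \<phi> \<inter> B. emeasure \<phi> {x})"
    using fin by (intro emeasure_eq_sum_singleton) auto
  finally show ?thesis .
qed

lemma point_process_prob_space: "point_process M \<Phi> \<Longrightarrow> prob_space M"
  by (simp add: point_process_def)

lemma point_process_lfcm:
  "point_process M \<Phi> \<Longrightarrow> \<omega> \<in> space M \<Longrightarrow> \<Phi> \<omega> \<in> locally_finite_counting_measures"
  using measurable_space[of \<Phi> M configuration_space \<omega>]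
  by (auto simp: point_process_def space_configuration_space)

lemma point_process_measurable:
  assumes "point_process M \<Phi>" "B \<in> sets borel"
  shows "(\<lambda>\<omega>. emeasure (\<Phi> \<omega>) B) \<in> borel_measurable M"
  using assms measurable_compose[of \<Phi> M configuration_space, OF _ measurable_emeasure_configuration_space]
  by (auto simp: point_process_def)

section \<open>Cubes\<close>

text \<open>Restricting to \<open>Basis\<close> makes indices canonical, so that
  \<open>cube_indices\<close> is countable and neighbours can be counted by \<open>card_PiE\<close>.
  Rounding down yields half-open cubes, which are disjoint as the moment inequality demands.\<close>

definition cube_index :: "real \<Rightarrow> 'a::euclidean_space \<Rightarrow> 'a \<Rightarrow> int" where
  "cube_index s x = (\<lambda>b\<in>Basis. \<lfloor>(x \<bullet> b) / s\<rfloor>)"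

abbreviation cube_indices :: "('a::euclidean_space \<Rightarrow> int) set" where
  "cube_indices \<equiv> Basis \<rightarrow>\<^sub>E UNIV"

definition cube :: "real \<Rightarrow> ('a::euclidean_space \<Rightarrow> int) \<Rightarrow> 'a set" where
  "cube s z = {x. cube_index s x = z}"

lemma cube_index_in [simp]: "cube_index s x \<in> cube_indices"
  by (simp add: cube_index_def)

lemma countable_cube_indices [simp]: "countable (cube_indices :: ('a::euclidean_space \<Rightarrow> int) set)"
  by (intro countable_PiE) auto

lemma cube_eq:
  assumes "0 < s" "z \<in> cube_indices"
  shows "cube s z = {x. \<forall>b\<in>Basis. s * z b \<le> x \<bullet> b \<and> x \<bullet> b < s * (z b + 1)}"
proof -
  have "cube_index s x = z \<longleftrightarrow> (\<forall>b\<in>Basis. \<lfloor>(x \<bullet> b) / s\<rfloor> = z b)" for x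
    using assms(2) unfolding cube_index_def by (auto simp: fun_eq_iff PiE_def extensional_def restrict_def)
  then show ?thesis
    using assms(1) by (auto simp: cube_def floor_eq_iff field_simps)
qed

lemma disjoint_cubes: "disjoint_family_on (cube s) A"
  by (auto simp: disjoint_family_on_def cube_def)

text \<open>The half-open cube lies between an open and a closed box of equal volume.\<close>

lemma
  fixes z :: "'a::euclidean_space \<Rightarrow> int"
  assumes s: "0 < s" and z: "z \<in> cube_indices"
  shows cube_borel: "cube s z \<in> sets borel"
    and bounded_cube: "bounded (cube s z)"
    and emeasure_cube: "emeasure lborel (cube s z) = ennreal (s ^ DIM('a))"
proof -
  define l where "l = (\<Sum>b\<in>Basis. (s * z b) *\<^sub>R b)"
  define u where "u = (\<Sum>b\<in>Basis. (s * (z b + 1)) *\<^sub>R b)"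
  have l: "l \<bullet> b = s * z b" and u: "u \<bullet> b = s * (z b + 1)" if "b \<in> Basis" for b
    using that by (auto simp: l_def u_def)
  have le: "l \<bullet> b \<le> u \<bullet> b" if "b \<in> Basis" for b
    using that s by (simp add: l u)
  have sub: "box l u \<subseteq> cube s z" "cube s z \<subseteq> cbox l u"
    unfolding cube_eq[OF s z] by (auto simp: mem_box l u less_imp_le)
  show 1: "cube s z \<in> sets borel" unfolding cube_eq[OF s z] by measurable
  show "bounded (cube s z)" using bounded_subset[OF bounded_cbox sub(2)] .
  have prod: "(\<Prod>b\<in>Basis. (u - l) \<bullet> b) = s ^ DIM('a)"
    by (simp add: inner_diff_left l u algebra_simps cong: prod.cong)
  have "emeasure lborel (box l u) \<le> emeasure lborel (cube s z)"
    using 1 sub by (intro emeasure_mono) auto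
  moreover have "emeasure lborel (cube s z) \<le> emeasure lborel (cbox l u)"
    using 1 sub by (intro emeasure_mono) auto
  ultimately show "emeasure lborel (cube s z) = ennreal (s ^ DIM('a))"
    using le by (simp add: emeasure_lborel_box emeasure_lborel_cbox prod)
qed

definition cube_neighbours :: "('a::euclidean_space \<Rightarrow> int) \<Rightarrow> ('a \<Rightarrow> int) set" where
  "cube_neighbours z = (\<Pi>\<^sub>E b\<in>Basis. {z b - 1..z b + 1}) - {z}"

lemma finite_cube_neighbours [simp]: "finite (cube_neighbours z)"
  by (auto simp: cube_neighbours_def intro!: finite_Diff finite_PiE)

lemma cube_neighbours_subset: "cube_neighbours z \<subseteq> cube_indices"
  by (auto simp: cube_neighbours_def)

lemma card_cube_neighbours:
  fixes z :: "'a::euclidean_space \<Rightarrow> int"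
  assumes "z \<in> cube_indices"
  shows "card (cube_neighbours z) = 3 ^ DIM('a) - 1"
proof -
  have "z \<in> (\<Pi>\<^sub>E b\<in>Basis. {z b - 1..z b + 1})" using assms by (auto simp: PiE_def)
  then show ?thesis
    by (simp add: cube_neighbours_def card_PiE)
qed

lemma cube_index_dist_le:
  assumes s: "0 < s" and "dist x y \<le> s" "cube_index s x \<noteq> cube_index s y"
  shows "cube_index s y \<in> cube_neighbours (cube_index s x)"
proof -
  have "\<lfloor>(y \<bullet> b) / s\<rfloor> \<in> {\<lfloor>(x \<bullet> b) / s\<rfloor> - 1..\<lfloor>(x \<bullet> b) / s\<rfloor> + 1}" if b: "b \<in> Basis" for b
  proof -
    have "\<bar>(x - y) \<bullet> b\<bar> \<le> s"
      using Basis_le_norm[OF b, of "x - y"] assms(2) by (simp add: dist_norm)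
    then have "\<bar>(x \<bullet> b) / s - (y \<bullet> b) / s\<bar> \<le> 1"
      using s by (simp add: inner_diff_left diff_divide_distrib[symmetric])
    then show ?thesis by simp linarith
  qed
  then show ?thesis
    using assms(3) by (auto simp: cube_neighbours_def cube_index_def)
qed

section \<open>Walks in locally finite graphs\<close>

text \<open>\<open>n\<close> counts steps, so a walk visits \<open>Suc n\<close> vertices; this is
  the exponent in the probability of a walk.\<close>

definition walks :: "('v \<Rightarrow> 'v set) \<Rightarrow> 'v \<Rightarrow> nat \<Rightarrow> 'v list set" where
  "walks N z n = {p. length p = Suc n \<and> hd p = z \<and> successively (\<lambda>u v. v \<in> N u) p}"

lemma walks_0: "walks N z 0 = {[z]}"
  by (auto simp: walks_def length_Suc_conv)

lemma walks_Suc: "walks N z (Suc n) = (\<Union>w\<in>N z. (#) z ` walks N w n)"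
  by (auto simp: walks_def length_Suc_conv image_iff successively_Cons Bex_def)

lemma walks_subset:
  assumes "\<And>v. v \<in> V \<Longrightarrow> N v \<subseteq> V" "z \<in> V" "p \<in> walks N z n"
  shows "set p \<subseteq> V"
  using assms(2,3)
proof (induction n arbitrary: z p)
  case (Suc n)
  then show ?case using assms(1)[of z] by (force simp: walks_Suc)
qed (auto simp: walks_0)

lemma finite_walks:
  assumes "\<And>v. finite (N v)"
  shows "finite (walks N z n)"
  using assms by (induction n arbitrary: z) (auto simp: walks_0 walks_Suc)

lemma card_walks_le:
  assumes "\<And>v. v \<in> V \<Longrightarrow> N v \<subseteq> V" "\<And>v. finite (N v)" "\<And>v. v \<in> V \<Longrightarrow> card (N v) \<le> D" "z \<in> V"
  shows "card (walks N z n) \<le> D ^ n"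
  using assms(4)
proof (induction n arbitrary: z)
  case (Suc n)
  have "card (walks N z (Suc n)) \<le> (\<Sum>w\<in>N z. card ((#) z ` walks N w n))"
    unfolding walks_Suc by (rule card_UN_le) (rule assms)
  also have "\<dots> \<le> (\<Sum>w\<in>N z. D ^ n)"
    using Suc assms(1)[of z]
    by (intro sum_mono) (auto intro!: order.trans[OF card_image_le] finite_walks assms)
  also have "\<dots> \<le> D * D ^ n" using assms(3)[OF Suc.prems] by simp
  finally show ?case by simp
qed (simp add: walks_0)

definition step_rel :: "('v \<Rightarrow> 'v set) \<Rightarrow> 'v set \<Rightarrow> ('v \<times> 'v) set" where
  "step_rel N S = {(u, v). u \<in> S \<and> v \<in> S \<and> v \<in> N u}"

lemma walks_take:
  assumes "p \<in> walks N z n" "m \<le> n"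
  shows "take (Suc m) p \<in> walks N z m"
proof -
  have "successively (\<lambda>u v. v \<in> N u) (take (Suc m) p @ drop (Suc m) p)"
    using assms by (simp add: walks_def)
  then have "successively (\<lambda>u v. v \<in> N u) (take (Suc m) p)"
    by (simp only: successively_append_iff)
  then show ?thesis using assms by (auto simp: walks_def)
qed

text \<open>Loop erasure: if the next vertex was visited before, the walk is cut at that visit,
  otherwise it is extended.\<close>

lemma reachable_distinct_walk:
  assumes "(z, v) \<in> (step_rel N S)\<^sup>*" "z \<in> S"
  shows "\<exists>n. \<exists>p\<in>walks N z n. distinct p \<and> set p \<subseteq> S \<and> last p = v"
  using assms(1)
proof (induction rule: rtrancl_induct)
  case base
  show ?case using assms(2) by (intro exI[of _ 0]) (simp add: walks_0)
next
  case (step u v)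
  then obtain n p where p: "p \<in> walks N z n" "distinct p" "set p \<subseteq> S" "last p = u" by blast
  have uv: "v \<in> S" "v \<in> N u" using step by (auto simp: step_rel_def)
  show ?case
  proof (cases "v \<in> set p")
    case True
    then obtain i where i: "i < length p" "p ! i = v" by (auto simp: in_set_conv_nth)
    then have "i \<le> n" using p(1) by (simp add: walks_def)
    moreover have "last (take (Suc i) p) = v" using i by (simp add: take_Suc_conv_app_nth)
    ultimately show ?thesis
      using walks_take[OF p(1), of i] p
      by (intro exI[of _ i] bexI[of _ "take (Suc i) p"]) (auto dest: in_set_takeD)
  next
    case False
    have "p \<noteq> []" using p(1) by (auto simp: walks_def)
    then have "p @ [v] \<in> walks N z (Suc n)"
      using p uv by (auto simp: walks_def successively_append_iff)
    then show ?thesis using False p uv by (intro exI[of _ "Suc n"] bexI[of _ "p @ [v]"]) auto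
  qed
qed

text \<open>Prefixes of self-avoiding walks are self-avoiding. Without one of \<open>n\<close> steps
  there would be no longer one either, and the whole cluster would consist of ends of finitely many
  shorter walks.\<close>

lemma infinite_cluster_walks:
  assumes "infinite ((step_rel N S)\<^sup>* `` {z})" "z \<in> S" "\<And>v. finite (N v)"
  shows "\<exists>p\<in>walks N z n. distinct p \<and> set p \<subseteq> S"
proof (rule ccontr)
  assume no: "\<not> ?thesis"
  have "(step_rel N S)\<^sup>* `` {z} \<subseteq> (\<Union>m\<in>{..<n}. last ` walks N z m)"
  proof
    fix v assume "v \<in> (step_rel N S)\<^sup>* `` {z}"
    then obtain m p where p: "p \<in> walks N z m" "distinct p" "set p \<subseteq> S" "last p = v"
      using reachable_distinct_walk[of z v N S] assms(2) by blast
    have "m < n"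
    proof (rule ccontr)
      assume "\<not> m < n"
      then have "take (Suc n) p \<in> walks N z n" using walks_take[OF p(1)] by simp
      moreover have "distinct (take (Suc n) p)" "set (take (Suc n) p) \<subseteq> S"
        using p by (auto dest: in_set_takeD)
      ultimately show False using no by blast
    qed
    then show "v \<in> (\<Union>m\<in>{..<n}. last ` walks N z m)" using p by auto
  qed
  moreover have "finite (\<Union>m\<in>{..<n}. last ` walks N z m)"
    by (auto intro!: finite_walks assms(3))
  ultimately show False using assms(1) finite_subset by blast
qed

text \<open>Union bound over walks. The property \<open>P\<close> is abstract because it stands for
  occupied cubes in the lower bound and for vacant cubes in the upper bound. Distinctness turns the
  walk into a set of exactly \<open>Suc n\<close> vertices.\<close>

lemma (in prob_space) prob_distinct_walk_le:
  assumes N: "\<And>v. v \<in> V \<Longrightarrow> N v \<subseteq> V" "\<And>v. finite (N v)" "\<And>v. v \<in> V \<Longrightarrow> card (N v) \<le> D" and z: "z \<in> V"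
    and meas: "\<And>v. v \<in> V \<Longrightarrow> {\<omega>\<in>space M. P v \<omega>} \<in> events"
    and prob: "\<And>S. finite S \<Longrightarrow> S \<noteq> {} \<Longrightarrow> S \<subseteq> V \<Longrightarrow> prob {\<omega>\<in>space M. \<forall>v\<in>S. P v \<omega>} \<le> q ^ card S"
    and q: "0 \<le> q"
  shows "{\<omega>\<in>space M. \<exists>p\<in>walks N z n. distinct p \<and> (\<forall>v\<in>set p. P v \<omega>)} \<in> events"
    and "prob {\<omega>\<in>space M. \<exists>p\<in>walks N z n. distinct p \<and> (\<forall>v\<in>set p. P v \<omega>)} \<le> real D ^ n * q ^ Suc n"
proof -
  let ?W = "{p\<in>walks N z n. distinct p}"
  have fin: "finite ?W" using finite_walks[OF N(2)] by simp
  have ev: "{\<omega>\<in>space M. \<forall>v\<in>set p. P v \<omega>} \<in> events" if "p \<in> ?W" for p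
    using that walks_subset[of V N z p n] N z by (intro sets.sets_Collect_finite_All meas) auto
  have eq: "{\<omega>\<in>space M. \<exists>p\<in>walks N z n. distinct p \<and> (\<forall>v\<in>set p. P v \<omega>)} =
      (\<Union>p\<in>?W. {\<omega>\<in>space M. \<forall>v\<in>set p. P v \<omega>})" by auto
  show "{\<omega>\<in>space M. \<exists>p\<in>walks N z n. distinct p \<and> (\<forall>v\<in>set p. P v \<omega>)} \<in> events"
    unfolding eq using fin ev by (intro sets.finite_UN) auto
  have "prob (\<Union>p\<in>?W. {\<omega>\<in>space M. \<forall>v\<in>set p. P v \<omega>}) \<le>
      (\<Sum>p\<in>?W. prob {\<omega>\<in>space M. \<forall>v\<in>set p. P v \<omega>})"
    using fin ev by (intro finite_measure_subadditive_finite) auto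
  also have "\<dots> \<le> (\<Sum>p\<in>?W. q ^ Suc n)"
  proof (rule sum_mono)
    fix p assume p: "p \<in> ?W"
    have "prob {\<omega>\<in>space M. \<forall>v\<in>set p. P v \<omega>} \<le> q ^ card (set p)"
    proof (rule prob)
      show "set p \<subseteq> V" using p walks_subset[of V N z p n] N z by simp
      show "set p \<noteq> {}" using p by (auto simp: walks_def)
    qed simp
    also have "card (set p) = Suc n" using p by (simp add: distinct_card walks_def)
    finally show "prob {\<omega>\<in>space M. \<forall>v\<in>set p. P v \<omega>} \<le> q ^ Suc n" .
  qed
  also have "\<dots> = real (card ?W) * q ^ Suc n" by simp
  also have "\<dots> \<le> real (D ^ n) * q ^ Suc n"
  proof (intro mult_right_mono of_nat_mono)
    have "card ?W \<le> card (walks N z n)" by (intro card_mono finite_walks N) auto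
    also have "\<dots> \<le> D ^ n" using card_walks_le[of V N D z n] N z by simp
    finally show "card ?W \<le> D ^ n" .
  qed (use q in simp)
  finally show "prob {\<omega>\<in>space M. \<exists>p\<in>walks N z n. distinct p \<and> (\<forall>v\<in>set p. P v \<omega>)} \<le> real D ^ n * q ^ Suc n"
    unfolding eq by simp
qed

section \<open>Percolation and clusters of atoms\<close>

definition atom_rel :: "'a::euclidean_space measure \<Rightarrow> real \<Rightarrow> ('a \<times> 'a) set" where
  "atom_rel \<phi> t = {(x, y). x \<in> atoms \<phi> \<and> y \<in> atoms \<phi> \<and> dist x y \<le> t}"

text \<open>Any set of atoms is locally finite, hence closed, and the sum of a closed and a compact
  set is closed. This lets a connected set be tested against two infinite unions of balls.\<close>

lemma closed_UN_cball_atoms: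
  fixes \<phi> :: "'a::euclidean_space measure"
  assumes \<phi>: "\<phi> \<in> locally_finite_counting_measures" and F: "F \<subseteq> atoms \<phi>"
  shows "closed (\<Union>x\<in>F. cball x r)"
proof -
  have "closed F"
    unfolding closed_limpt
  proof (intro allI impI)
    fix x assume "x islimpt F"
    then have "infinite (F \<inter> ball x 1)" using islimpt_eq_infinite_ball[of x F] by auto
    moreover have "finite (atoms \<phi> \<inter> ball x 1)" by (rule finite_atoms[OF \<phi>]) simp
    ultimately show "x \<in> F" using F by (meson Int_mono finite_subset order_refl)
  qed
  then have "closed (\<Union>x\<in>F. \<Union>y\<in>cball 0 r. {x + y})"
    by (intro closed_compact_sums) auto
  also have "(\<Union>x\<in>F. \<Union>y\<in>cball 0 r. {x + y}) = (\<Union>x\<in>F. cball x r)"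
  proof -
    have "(\<Union>y\<in>cball 0 r. {x + y}) = cball x r" for x :: 'a
    proof (intro equalityI subsetI)
      fix y assume "y \<in> cball x r"
      then show "y \<in> (\<Union>y\<in>cball 0 r. {x + y})"
        by (intro UN_I[of "y - x"]) (auto simp: dist_norm norm_minus_commute)
    qed (auto simp: dist_norm)
    then show ?thesis by simp
  qed
  finally show ?thesis .
qed

text \<open>The balls around the cluster of one atom and those around all other atoms form two
  closed sets that do not meet. A connected set touching the first lies inside it, and a finite
  cluster would make it bounded.\<close>

lemma percolates_imp_infinite_cluster:
  fixes \<phi> :: "'a::euclidean_space measure"
  assumes \<phi>: "\<phi> \<in> locally_finite_counting_measures" and perc: "percolates (covered_region \<phi> r)"
  shows "\<exists>a\<in>atoms \<phi>. infinite ((atom_rel \<phi> (2 * r))\<^sup>* `` {a})"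
proof -
  obtain S where S: "S \<subseteq> covered_region \<phi> r" "connected S" "\<not> bounded S"
    using perc by (auto simp: percolates_def)
  have "S \<noteq> {}" using S by auto
  then obtain x0 where x0: "x0 \<in> S" by blast
  then have "x0 \<in> (\<Union>x\<in>atoms \<phi>. cball x r)" using subsetD[OF S(1)] by (simp add: covered_region_def atoms_def)
  then obtain a where a: "a \<in> atoms \<phi>" "x0 \<in> S" "x0 \<in> cball a r"
    using x0 by blast
  define T where "T = (atom_rel \<phi> (2 * r))\<^sup>* `` {a}"
  have T: "T \<subseteq> atoms \<phi>"
  proof
    fix x assume "x \<in> T"
    then have "(a, x) \<in> (atom_rel \<phi> (2 * r))\<^sup>*" by (simp add: T_def)
    then show "x \<in> atoms \<phi>" using a(1) by (cases rule: rtranclE) (auto simp: atom_rel_def)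
  qed
  define U1 U2 where "U1 = (\<Union>x\<in>T. cball x r)" and "U2 = (\<Union>x\<in>atoms \<phi> - T. cball x r)"
  have "closed U1" "closed U2" unfolding U1_def U2_def using T
    by (auto intro!: closed_UN_cball_atoms[OF \<phi>])
  moreover have "S \<subseteq> U1 \<union> U2"
    using S(1) by (auto simp: U1_def U2_def covered_region_def atoms_def)
  moreover have "U1 \<inter> U2 \<inter> S = {}"
  proof (rule ccontr)
    assume "U1 \<inter> U2 \<inter> S \<noteq> {}"
    then obtain y where "y \<in> U1" "y \<in> U2" by blast
    then obtain u v where y: "u \<in> T" "v \<in> atoms \<phi> - T" "dist u y \<le> r" "dist v y \<le> r"
      unfolding U1_def U2_def mem_cball[symmetric] by blast
    then have "dist u v \<le> 2 * r" using dist_triangle2[of u v y] by linarith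
    then have "(u, v) \<in> atom_rel \<phi> (2 * r)" using y T by (auto simp: atom_rel_def)
    then have "v \<in> T" using y by (auto simp: T_def intro: rtrancl_into_rtrancl)
    then show False using y by simp
  qed
  ultimately have "U1 \<inter> S = {} \<or> U2 \<inter> S = {}"
    using S(2) by (intro connected_closedD) auto
  moreover have "x0 \<in> U1 \<inter> S" using a by (auto simp: U1_def T_def)
  ultimately have "S \<subseteq> U1" using \<open>S \<subseteq> U1 \<union> U2\<close> by auto
  have "infinite T"
  proof
    assume "finite T"
    then have "bounded U1" unfolding U1_def by (intro bounded_UN) auto
    then show False using \<open>S \<subseteq> U1\<close> S(3) bounded_subset by blast
  qed
  then show ?thesis using a by (auto simp: T_def)
qed

text \<open>The cluster lies in one component of the covered region, and a bounded component would
  contain only finitely many atoms.\<close>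

lemma infinite_cluster_imp_percolates:
  fixes \<phi> :: "'a::euclidean_space measure"
  assumes \<phi>: "\<phi> \<in> locally_finite_counting_measures" and r: "0 \<le> r"
    and a: "a \<in> atoms \<phi>" "infinite ((atom_rel \<phi> (2 * r))\<^sup>* `` {a})"
  shows "percolates (covered_region \<phi> r)"
proof -
  let ?C = "covered_region \<phi> r"
  have atom_in: "x \<in> ?C" "cball x r \<subseteq> ?C" if "x \<in> atoms \<phi>" for x
    using that r by (auto simp: covered_region_def atoms_def)
  have cc: "b \<in> atoms \<phi> \<and> connected_component ?C a b" if "(a, b) \<in> (atom_rel \<phi> (2 * r))\<^sup>*" for b
    using that
  proof (induction rule: rtrancl_induct)
    case base
    show ?case using a atom_in by auto
  next
    case (step b c)
    have bc: "b \<in> atoms \<phi>" "c \<in> atoms \<phi>" "dist b c \<le> 2 * r"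
      using step by (auto simp: atom_rel_def)
    \<comment> \<open>At distance at most \<open>2 * r\<close> closed balls always meet; when they
      are tangent, the midpoint is the only common point.\<close>
    have "midpoint b c \<in> cball b r \<inter> cball c r"
      using bc dist_midpoint[of b c] by (auto simp: dist_commute)
    then have "connected (cball b r \<union> cball c r)" by (intro connected_Un) auto
    then have "connected_component ?C b c"
      using bc atom_in r unfolding connected_component_def
      by (intro exI[of _ "cball b r \<union> cball c r"]) auto
    then show ?case using step bc by (auto intro: connected_component_trans)
  qed
  have "\<not> bounded (connected_component_set ?C a)"
  proof
    assume "bounded (connected_component_set ?C a)"
    then have "finite (atoms \<phi> \<inter> connected_component_set ?C a)" by (rule finite_atoms[OF \<phi>])
    moreover have "(atom_rel \<phi> (2 * r))\<^sup>* `` {a} \<subseteq> atoms \<phi> \<inter> connected_component_set ?C a"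
      using cc by auto
    ultimately show False using a(2) finite_subset by blast
  qed
  then show ?thesis unfolding percolates_def
    by (intro exI[of _ "connected_component_set ?C a"]) (auto simp: connected_component_subset)
qed

lemma covered_region_percolates_iff:
  fixes \<phi> :: "'a::euclidean_space measure"
  assumes "\<phi> \<in> locally_finite_counting_measures" "0 \<le> r"
  shows "percolates (covered_region \<phi> r) \<longleftrightarrow> (\<exists>a\<in>atoms \<phi>. infinite ((atom_rel \<phi> (2 * r))\<^sup>* `` {a}))"
  using percolates_imp_infinite_cluster infinite_cluster_imp_percolates assms by blast

section \<open>Measurability of the percolation event\<close>

text \<open>The jump condition is a parameter because closed conditions describe clusters while open
  ones can be tested on small balls.\<close>

definition atom_chain :: "'a::euclidean_space measure \<Rightarrow> (real \<Rightarrow> bool) \<Rightarrow> nat \<Rightarrow> (nat \<Rightarrow> 'a) \<Rightarrow> bool" where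
  "atom_chain \<phi> P m x \<longleftrightarrow> (\<forall>i\<le>m. x i \<in> atoms \<phi>) \<and> (\<forall>i<m. P (dist (x i) (x (Suc i))))"

lemma rtrancl_atom_chain:
  assumes "(a, b) \<in> (atom_rel \<phi> t)\<^sup>*" "a \<in> atoms \<phi>"
  shows "\<exists>m x. atom_chain \<phi> (\<lambda>d. d \<le> t) m x \<and> x 0 = a \<and> x m = b"
  using assms(1)
proof (induction rule: rtrancl_induct)
  case base
  show ?case using assms(2) by (intro exI[of _ 0] exI[of _ "\<lambda>_. a"]) (auto simp: atom_chain_def)
next
  case (step b c)
  then obtain m x where x: "atom_chain \<phi> (\<lambda>d. d \<le> t) m x" "x 0 = a" "x m = b" by blast
  then show ?case using step(2)
    by (intro exI[of _ "Suc m"] exI[of _ "x(Suc m := c)"])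
      (auto simp: atom_chain_def atom_rel_def less_Suc_eq le_Suc_eq)
qed

lemma atom_chain_rtrancl:
  assumes "atom_chain \<phi> (\<lambda>d. d \<le> t) m x" "i \<le> m"
  shows "(x 0, x i) \<in> (atom_rel \<phi> t)\<^sup>*"
  using assms(2)
proof (induction i)
  case (Suc i)
  then have "(x i, x (Suc i)) \<in> atom_rel \<phi> t" using assms(1) by (auto simp: atom_chain_def atom_rel_def)
  then show ?case using Suc by (auto intro: rtrancl_into_rtrancl)
qed simp

text \<open>Trades the quantifier over atoms for bounds on norms, which survive approximation.
  Chains starting in a fixed ball start at finitely many atoms, so by the pigeonhole principle some
  atom starts chains that reach arbitrarily far.\<close>

lemma infinite_cluster_iff_chains:
  fixes \<phi> :: "'a::euclidean_space measure"
  assumes \<phi>: "\<phi> \<in> locally_finite_counting_measures"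
  shows "(\<exists>a\<in>atoms \<phi>. infinite ((atom_rel \<phi> t)\<^sup>* `` {a})) \<longleftrightarrow>
    (\<exists>R::nat. \<forall>n::nat. \<exists>m x. atom_chain \<phi> (\<lambda>d. d \<le> t) m x \<and> norm (x 0) < R \<and> n < norm (x m))"
    (is "?L \<longleftrightarrow> ?R")
proof
  assume ?L
  then obtain a where a: "a \<in> atoms \<phi>" "infinite ((atom_rel \<phi> t)\<^sup>* `` {a})" by blast
  obtain R :: nat where R: "norm a < R" using reals_Archimedean2 by blast
  show ?R
  proof (rule exI[of _ R], rule allI)
    fix n :: nat
    have "\<not> (atom_rel \<phi> t)\<^sup>* `` {a} \<subseteq> atoms \<phi> \<inter> cball 0 n"
      using finite_atoms[OF \<phi>, of "cball 0 (real n)"] a(2) finite_subset bounded_cball by blast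
    then obtain b where b: "(a, b) \<in> (atom_rel \<phi> t)\<^sup>*" "b \<notin> atoms \<phi> \<inter> cball 0 n" by blast
    obtain m x where x: "atom_chain \<phi> (\<lambda>d. d \<le> t) m x" "x 0 = a" "x m = b"
      using rtrancl_atom_chain[OF b(1) a(1)] by blast
    then have "b \<in> atoms \<phi>" unfolding atom_chain_def by (metis order_refl)
    then show "\<exists>m x. atom_chain \<phi> (\<lambda>d. d \<le> t) m x \<and> norm (x 0) < R \<and> n < norm (x m)"
      using x R b by (intro exI[of _ m] exI[of _ x]) auto
  qed
next
  assume ?R
  then obtain R :: nat where "\<forall>n::nat. \<exists>m x. atom_chain \<phi> (\<lambda>d. d \<le> t) m x \<and> norm (x 0) < R \<and> n < norm (x m)"
    by blast
  then obtain m x where x: "\<And>n::nat. atom_chain \<phi> (\<lambda>d. d \<le> t) (m n) (x n)"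
      "\<And>n. norm (x n 0) < R" "\<And>n. n < norm (x n (m n))"
    by metis
  let ?F = "atoms \<phi> \<inter> ball 0 (real R)"
  have fin: "finite ?F" by (rule finite_atoms[OF \<phi>]) simp
  have "x n 0 \<in> ?F" for n using x(1,2)[of n] by (auto simp: atom_chain_def)
  then have "range (\<lambda>n. x n 0) \<subseteq> ?F" by auto
  then have "finite (range (\<lambda>n. x n 0))" using fin finite_subset by blast
  then obtain n0 where n0: "infinite {n. x n 0 = x n0 0}"
    using pigeonhole_infinite[of "UNIV :: nat set" "\<lambda>n. x n 0"] by auto
  let ?T = "(atom_rel \<phi> t)\<^sup>* `` {x n0 0}"
  have "infinite ?T"
  proof
    assume "finite ?T"
    then have "bounded ?T" by (rule finite_imp_bounded)
    then obtain K where K: "\<And>y. y \<in> ?T \<Longrightarrow> norm y \<le> K" by (auto simp: bounded_iff)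
    obtain k :: nat where k: "K < k" using reals_Archimedean2 by blast
    obtain n where n: "n > k" "x n 0 = x n0 0"
      using n0 by (auto simp: infinite_nat_iff_unbounded)
    have "x n (m n) \<in> ?T" using atom_chain_rtrancl[OF x(1), of "m n" n] n by simp
    then have "norm (x n (m n)) \<le> K" by (rule K)
    then show False using x(3)[of n] n k by linarith
  qed
  moreover have "x n0 0 \<in> atoms \<phi>" using x(1)[of n0] by (auto simp: atom_chain_def)
  ultimately show ?L by blast
qed

text \<open>For a fixed length only finitely many chains are relevant, so the closed condition on the
  jumps can be relaxed to a sequence of open ones.\<close>

lemma chain_iff_approx:
  fixes \<phi> :: "'a::euclidean_space measure"
  assumes \<phi>: "\<phi> \<in> locally_finite_counting_measures"
  shows "(\<exists>x. atom_chain \<phi> (\<lambda>d. d \<le> t) m x \<and> norm (x 0) < R \<and> n < norm (x m)) \<longleftrightarrow>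
    (\<forall>j::nat. \<exists>x. atom_chain \<phi> (\<lambda>d. d < t + 1 / Suc j) m x \<and> norm (x 0) < R \<and> n < norm (x m))"
    (is "?L \<longleftrightarrow> (\<forall>j. \<exists>x. ?P j x)")
proof
  assume ?L
  then obtain x where x: "atom_chain \<phi> (\<lambda>d. d \<le> t) m x" "norm (x 0) < R" "n < norm (x m)" by blast
  have "t < t + 1 / real (Suc j)" for j by simp
  then have "?P j x" for j using x by (auto simp: atom_chain_def intro: le_less_trans)
  then show "\<forall>j. \<exists>x. ?P j x" by blast
next
  assume "\<forall>j. \<exists>x. ?P j x"
  then obtain x where x: "\<And>j. ?P j (x j)" by metis
  \<comment> \<open>Forgetting the values beyond \<open>m\<close> places all chains in a finite
    function space, so one of them occurs for infinitely many \<open>j\<close>.\<close>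
  define y where "y j = restrict (x j) {..m}" for j
  have y: "?P j (y j)" for j using x[of j] by (auto simp: y_def atom_chain_def)
  \<comment> \<open>A jump below \<open>t + 1 / Suc j\<close> is at most
    \<open>\<bar>t\<bar> + 1\<close>, so this radius works for all \<open>j\<close> at once.\<close>
  let ?B = "R + m * (\<bar>t\<bar> + 1)"
  have bnd: "norm (x j i) \<le> R + i * (\<bar>t\<bar> + 1)" if "i \<le> m" for i j
    using that
  proof (induction i)
    case 0
    show ?case using x[of j] by simp
  next
    case (Suc i)
    have "dist (x j i) (x j (Suc i)) < t + 1 / real (Suc j)"
      using x[of j] Suc by (auto simp: atom_chain_def)
    moreover have "1 / real (Suc j) \<le> 1" by simp
    ultimately have "dist (x j i) (x j (Suc i)) \<le> \<bar>t\<bar> + 1" by linarith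
    moreover have "norm (x j (Suc i)) \<le> norm (x j i) + dist (x j i) (x j (Suc i))"
      using norm_triangle_ineq2[of "x j (Suc i)" "x j i"] by (simp add: dist_norm norm_minus_commute)
    ultimately show ?case using Suc by (simp add: algebra_simps)
  qed
  let ?F = "{..m} \<rightarrow>\<^sub>E (atoms \<phi> \<inter> cball 0 ?B)"
  have "norm (x j i) \<le> ?B" if "i \<le> m" for i j
  proof -
    have "real i * (\<bar>t\<bar> + 1) \<le> m * (\<bar>t\<bar> + 1)" using that by (intro mult_right_mono) auto
    then show ?thesis using bnd[OF that, of j] by linarith
  qed
  then have "y j \<in> ?F" for j using y[of j] by (auto simp: y_def atom_chain_def)
  then have "range y \<subseteq> ?F" by auto
  moreover have "finite ?F" by (intro finite_PiE finite_atoms[OF \<phi>]) auto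
  ultimately have "finite (range y)" using finite_subset by blast
  then obtain j0 where j0: "infinite {j. y j = y j0}"
    using pigeonhole_infinite[of "UNIV :: nat set" y] by auto
  have "dist (y j0 i) (y j0 (Suc i)) \<le> t" if "i < m" for i
  proof (rule field_le_epsilon)
    fix e :: real assume "0 < e"
    then obtain k where k: "1 / real (Suc k) < e" using nat_approx_posE by blast
    obtain j where j: "j > k" "y j = y j0" using j0 by (auto simp: infinite_nat_iff_unbounded)
    have "dist (y j i) (y j (Suc i)) < t + 1 / real (Suc j)"
      using y[of j] that by (auto simp: atom_chain_def)
    also have "1 / real (Suc j) \<le> 1 / real (Suc k)" using j by (simp add: frac_le)
    finally show "dist (y j0 i) (y j0 (Suc i)) \<le> t + e" using j k by simp
  qed
  then show ?L using y[of j0] by (intro exI[of _ "y j0"]) (auto simp: atom_chain_def)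
qed

text \<open>Strict inequalities leave room to replace atoms by small balls of positive mass centred
  in a countable dense set. The centres are coded by a list because lists of naturals form a
  countable type.\<close>

lemma open_chain_iff_balls:
  fixes \<phi> :: "'a::euclidean_space measure" and c :: "nat \<Rightarrow> 'a"
  assumes \<phi>: "\<phi> \<in> locally_finite_counting_measures"
    and dense: "\<forall>x e. 0 < e \<longrightarrow> (\<exists>k. dist x (c k) < e)"
  shows "(\<exists>x. atom_chain \<phi> (\<lambda>d. d < t) m x \<and> norm (x 0) < R \<and> n < norm (x m)) \<longleftrightarrow>
    (\<exists>p::nat. \<exists>k::nat list. (\<forall>i<m. dist (c (k ! i)) (c (k ! Suc i)) + 2 / Suc p < t) \<and>
       norm (c (k ! 0)) + 1 / Suc p < R \<and> n + 1 / Suc p < norm (c (k ! m)) \<and>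
       (\<forall>i\<le>m. emeasure \<phi> (ball (c (k ! i)) (1 / Suc p)) \<noteq> 0))"
    (is "?L \<longleftrightarrow> ?R")
proof
  assume ?L
  then obtain x where x: "atom_chain \<phi> (\<lambda>d. d < t) m x" "norm (x 0) < R" "n < norm (x m)" by blast
  \<comment> \<open>The finitely many slacks of the strict inequalities. A quarter of the smallest
    one suffices: two displaced centres cost at most twice the radius, and the margin in the claim
    is twice the radius again.\<close>
  define G where "G = insert (R - norm (x 0)) (insert (norm (x m) - n) 
    ((\<lambda>i. t - dist (x i) (x (Suc i))) ` {..<m}))"
  have "finite G" "G \<noteq> {}" by (auto simp: G_def)
  moreover have "\<forall>g\<in>G. 0 < g" using x by (auto simp: G_def atom_chain_def)
  ultimately have "0 < Min G" by simp
  then have "0 < Min G / 4" by simp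
  then obtain p where p: "1 / real (Suc p) < Min G / 4" using nat_approx_posE by blast
  have gap: "4 * (1 / real (Suc p)) < g" if "g \<in> G" for g
    using p Min_le[OF \<open>finite G\<close> that] by linarith
  let ?e = "1 / real (Suc p)"
  have "0 < ?e" by simp
  then have "\<forall>i. \<exists>k. dist (x i) (c k) < ?e" using dense by blast
  then obtain f where f: "\<And>i. dist (x i) (c (f i)) < ?e" by metis
  let ?k = "map f [0..<Suc m]"
  have k: "?k ! i = f i" if "i \<le> m" for i using that by (simp del: upt_Suc)
  show ?R
  proof (intro exI[of _ p] exI[of _ ?k] conjI allI impI)
    fix i assume i: "i < m"
    have "4 * ?e < t - dist (x i) (x (Suc i))" using i by (intro gap) (auto simp: G_def)
    moreover have "dist (c (f i)) (c (f (Suc i))) \<le> dist (x i) (c (f i)) + dist (x i) (x (Suc i)) + dist (x (Suc i)) (c (f (Suc i)))"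
      using dist_triangle[of "c (f i)" "c (f (Suc i))" "x i"] dist_triangle[of "x i" "c (f (Suc i))" "x (Suc i)"]
      by (simp add: dist_commute)
    ultimately show "dist (c (?k ! i)) (c (?k ! Suc i)) + 2 / Suc p < t"
      using f[of i] f[of "Suc i"] i by (simp add: k del: upt_Suc)
  next
    have "4 * ?e < R - norm (x 0)" by (intro gap) (auto simp: G_def)
    moreover have "norm (c (f 0)) \<le> norm (x 0) + dist (x 0) (c (f 0))"
      using norm_triangle_ineq2[of "c (f 0)" "x 0"] by (simp add: dist_norm norm_minus_commute)
    moreover have "0 < ?e" by simp
    ultimately have "norm (c (f 0)) + ?e < R" using f[of 0] by linarith
    then show "norm (c (?k ! 0)) + 1 / Suc p < R" by (simp add: k del: upt_Suc)
  next
    have "4 * ?e < norm (x m) - n" by (intro gap) (auto simp: G_def)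
    moreover have "norm (x m) \<le> norm (c (f m)) + dist (x m) (c (f m))"
      using norm_triangle_ineq2[of "x m" "c (f m)"] by (simp add: dist_norm)
    moreover have "0 < ?e" by simp
    ultimately have "n + ?e < norm (c (f m))" using f[of m] by linarith
    then show "n + 1 / Suc p < norm (c (?k ! m))" by (simp add: k del: upt_Suc)
  next
    fix i assume i: "i \<le> m"
    have "x i \<in> atoms \<phi> \<inter> ball (c (f i)) ?e"
      using x(1) i f[of i] by (auto simp: atom_chain_def dist_commute)
    then show "emeasure \<phi> (ball (c (?k ! i)) ?e) \<noteq> 0"
      using emeasure_eq_0_iff_atoms[OF \<phi>, of "ball (c (f i)) ?e"] i by (auto simp: k simp del: upt_Suc)
  qed
next
  assume ?R
  then obtain p :: nat and k :: "nat list" where k: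
      "\<And>i. i < m \<Longrightarrow> dist (c (k ! i)) (c (k ! Suc i)) + 2 / Suc p < t"
      "norm (c (k ! 0)) + 1 / Suc p < R" "n + 1 / Suc p < norm (c (k ! m))"
      "\<And>i. i \<le> m \<Longrightarrow> emeasure \<phi> (ball (c (k ! i)) (1 / Suc p)) \<noteq> 0" by blast
  let ?e = "1 / real (Suc p)"
  have "\<forall>i\<in>{..m}. \<exists>x. x \<in> atoms \<phi> \<inter> ball (c (k ! i)) ?e"
    using emeasure_neq_0_atom[OF \<phi> borel_open[OF open_ball] k(4)] by blast
  then obtain x where x: "\<And>i. i \<le> m \<Longrightarrow> x i \<in> atoms \<phi>" "\<And>i. i \<le> m \<Longrightarrow> dist (c (k ! i)) (x i) < ?e"
    by (auto simp: bchoice_iff)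
  have "atom_chain \<phi> (\<lambda>d. d < t) m x"
    unfolding atom_chain_def
  proof (intro conjI allI impI)
    fix i assume i: "i < m"
    have "dist (x i) (x (Suc i)) \<le> dist (c (k ! i)) (x i) + dist (c (k ! i)) (c (k ! Suc i)) + dist (c (k ! Suc i)) (x (Suc i))"
      using dist_triangle[of "x i" "x (Suc i)" "c (k ! i)"] dist_triangle[of "c (k ! i)" "x (Suc i)" "c (k ! Suc i)"]
      by (simp add: dist_commute)
    then show "dist (x i) (x (Suc i)) < t" using k(1)[OF i] x(2)[of i] x(2)[of "Suc i"] i by simp
  qed (use x in auto)
  moreover have "norm (x 0) < R"
    using k(2) x(2)[of 0] norm_triangle_ineq2[of "x 0" "c (k ! 0)"] by (simp add: dist_norm norm_minus_commute)
  moreover have "n < norm (x m)"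
    using k(3) x(2)[of m] norm_triangle_ineq2[of "c (k ! m)" "x m"] by (simp add: dist_norm norm_minus_commute)
  ultimately show ?L by blast
qed

text \<open>After the rewriting every quantifier ranges over a countable type and the only random
  quantities are masses of balls.\<close>

lemma percolation_event:
  fixes \<Phi> :: "'w \<Rightarrow> 'a::euclidean_space measure"
  assumes pp: "point_process M \<Phi>" and r: "0 \<le> r"
  shows "{\<omega>\<in>space M. percolates (covered_region (\<Phi> \<omega>) r)} \<in> sets M"
proof -
  obtain D :: "'a set" where D: "countable D" "D \<noteq> {}" "\<And>S. open S \<Longrightarrow> S \<noteq> {} \<Longrightarrow> \<exists>d\<in>D. d \<in> S"
    by (metis countable_dense_setE open_UNIV UNIV_not_empty empty_iff)
  define c where "c = from_nat_into D"
  have dense: "\<forall>x e. 0 < e \<longrightarrow> (\<exists>k. dist x (c k) < e)"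
  proof (intro allI impI)
    fix x :: 'a and e :: real assume that: "0 < e"
    have "ball x e \<noteq> {}" using that by simp
    then obtain d where "d \<in> D" "d \<in> ball x e" using D(3)[OF open_ball] by blast
    then show "\<exists>k. dist x (c k) < e" using D(1) from_nat_into_surj[OF D(1), of d] by (auto simp: c_def)
  qed
  have [measurable]: "(\<lambda>\<omega>. emeasure (\<Phi> \<omega>) (ball y e)) \<in> borel_measurable M" for y e
    using pp by (rule point_process_measurable) simp
  have eq: "percolates (covered_region (\<Phi> \<omega>) r) \<longleftrightarrow>
    (\<exists>R::nat. \<forall>n::nat. \<exists>m. \<forall>j. 
    (\<exists>p::nat. \<exists>k::nat list. (\<forall>i<m. dist (c (k ! i)) (c (k ! Suc i)) + 2 / Suc p < 2 * r + 1 / Suc j) \<and>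
       norm (c (k ! 0)) + 1 / Suc p < R \<and> n + 1 / Suc p < norm (c (k ! m)) \<and>
       (\<forall>i\<le>m. emeasure (\<Phi> \<omega>) (ball (c (k ! i)) (1 / Suc p)) \<noteq> 0)))"
    if \<omega>: "\<omega> \<in> space M" for \<omega>
  proof -
    have \<phi>: "\<Phi> \<omega> \<in> locally_finite_counting_measures" using pp \<omega> by (rule point_process_lfcm)
    show ?thesis
      unfolding covered_region_percolates_iff[OF \<phi> r] infinite_cluster_iff_chains[OF \<phi>]
        chain_iff_approx[OF \<phi>] open_chain_iff_balls[OF \<phi> dense] ..
  qed
  show ?thesis
    by (subst Collect_cong, rule conj_cong[OF refl], erule eq) measurable
qed

section \<open>A planar separation lemma\<close>

text \<open>The square grid of a quadrant with one diagonal in each square. Subtraction is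
  truncated, so a point on an axis can be its own neighbour; the bound 6 and the change of at most 1
  in each coordinate persist.\<close>

definition tri_neighbours :: "nat \<times> nat \<Rightarrow> (nat \<times> nat) set" where
  "tri_neighbours = (\<lambda>(i, j). set [(i + 1, j), (i - 1, j), (i, j + 1), (i, j - 1), (i + 1, j + 1), (i - 1, j - 1)])"

lemma finite_tri_neighbours [simp]: "finite (tri_neighbours u)"
  by (cases u) (simp add: tri_neighbours_def)

lemma card_tri_neighbours: "card (tri_neighbours u) \<le> 6"
proof (cases u)
  case (Pair i j)
  have "card (tri_neighbours u) \<le> length [(i + 1, j), (i - 1, j), (i, j + 1), (i, j - 1), (i + 1, j + 1), (i - 1, j - 1)]"
    unfolding Pair tri_neighbours_def prod.case by (rule card_length)
  then show ?thesis by simp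
qed

text \<open>A two-dimensional Sperner argument. Among the edges between \<open>A\<close> and its outer boundary \<open>C\<close>,
  select those whose endpoint in \<open>C\<close> is connected in \<open>C\<close> to the first axis. Every triangle of the lattice has
  an even number of selected edges, hence the parity of the number of selected edges in a row does
  not depend on the row, unless a selected edge lies on the second axis. The number is odd in the
  lowest row and zero in rows far away.\<close>

lemma finite_cluster_separating_walk:
  fixes A :: "(nat \<times> nat) set"
  assumes fin: "finite A" and zero: "(0, 0) \<in> A"
  defines "C \<equiv> {c. c \<notin> A \<and> (\<exists>a\<in>A. c \<in> tri_neighbours a)}"
  shows "\<exists>k m. (k, 0) \<in> C \<and> ((k, 0), (0, m)) \<in> (step_rel tri_neighbours C)\<^sup>*"
proof (rule ccontr)
  assume no: "\<not> ?thesis"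
  define X where "X = {c \<in> C. \<exists>k. (k, 0) \<in> C \<and> ((k, 0), c) \<in> (step_rel tri_neighbours C)\<^sup>*}"
  have X0: "(0, m) \<notin> X" for m using no by (auto simp: X_def)
  define f :: "nat \<times> nat \<Rightarrow> nat \<times> nat \<Rightarrow> nat" where
    "f u v = of_bool (u \<in> A \<and> v \<in> X \<or> v \<in> A \<and> u \<in> X)" for u v
  have XA: "x \<in> X \<Longrightarrow> x \<notin> A" for x by (auto simp: X_def C_def)
  \<comment> \<open>The third vertex of a triangle over a selected edge, if outside
    \<open>A\<close>, lies in \<open>C\<close> and inherits the connection to the axis from
    \<open>x\<close>. Hence no triangle has one vertex in \<open>A\<close>, one in \<open>X\<close>
    and one in neither.\<close>
  have ext: "w \<in> X" if w: "a \<in> A" "x \<in> X" "w \<notin> A" "w \<in> tri_neighbours a" "w \<in> tri_neighbours x" for a x w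
  proof -
    have w: "w \<in> C" using that by (auto simp: C_def)
    obtain k where k: "(k, 0) \<in> C" "((k, 0), x) \<in> (step_rel tri_neighbours C)\<^sup>*"
      using \<open>x \<in> X\<close> by (auto simp: X_def)
    moreover have "(x, w) \<in> step_rel tri_neighbours C"
      using w that by (auto simp: step_rel_def X_def)
    ultimately show ?thesis using w by (auto simp: X_def intro: rtrancl_into_rtrancl)
  qed
  have tri: "even (f u v + f v w + f u w)"
    if adj: "v \<in> tri_neighbours u" "u \<in> tri_neighbours v" "w \<in> tri_neighbours u"
      "u \<in> tri_neighbours w" "w \<in> tri_neighbours v" "v \<in> tri_neighbours w" for u v w
  proof -
    have "u \<in> A \<longrightarrow> v \<in> X \<longrightarrow> w \<in> A \<or> w \<in> X" "v \<in> A \<longrightarrow> u \<in> X \<longrightarrow> w \<in> A \<or> w \<in> X"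
      "u \<in> A \<longrightarrow> w \<in> X \<longrightarrow> v \<in> A \<or> v \<in> X" "w \<in> A \<longrightarrow> u \<in> X \<longrightarrow> v \<in> A \<or> v \<in> X"
      "v \<in> A \<longrightarrow> w \<in> X \<longrightarrow> u \<in> A \<or> u \<in> X" "w \<in> A \<longrightarrow> v \<in> X \<longrightarrow> u \<in> A \<or> u \<in> X"
      using ext adj by blast+
    then show ?thesis
      using XA[of u] XA[of v] XA[of w] unfolding f_def
      by (cases "u \<in> A"; cases "v \<in> A"; cases "w \<in> A"; cases "u \<in> X"; cases "v \<in> X"; cases "w \<in> X") simp_all
  qed
  define H where "H i j = f (i, j) (i + 1, j)" for i j
  define V where "V i j = f (i, j) (i, j + 1)" for i j
  \<comment> \<open>The two triangles of a unit square share the diagonal, which cancels modulo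
    2.\<close>
  have sq: "even (H i j + H i (j + 1) + V i j + V (i + 1) j)" for i j
  proof -
    have "even (f (i, j) (i + 1, j) + f (i + 1, j) (i + 1, j + 1) + f (i, j) (i + 1, j + 1))"
      by (rule tri) (auto simp: tri_neighbours_def)
    moreover have "even (f (i, j) (i, j + 1) + f (i, j + 1) (i + 1, j + 1) + f (i, j) (i + 1, j + 1))"
      by (rule tri) (auto simp: tri_neighbours_def)
    ultimately show ?thesis unfolding H_def V_def by presburger
  qed
  have row: "even ((\<Sum>i<n. H i j) + (\<Sum>i<n. H i (j + 1)) + V 0 j + V n j)" for n j
  proof (induction n)
    case (Suc n)
    then show ?case using sq[of n j] by simp presburger
  qed simp
  obtain N where N: "\<And>i j. (i, j) \<in> A \<Longrightarrow> i < N \<and> j < N"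
  proof -
    have "finite (fst ` A \<union> snd ` A)" using fin by simp
    then obtain N where "\<forall>k\<in>fst ` A \<union> snd ` A. k < N" by (metis finite_nat_set_iff_bounded)
    then show thesis by (intro that[of N]) force
  qed
  define R where "R j = (\<Sum>i<N. H i j)" for j
  have step: "even (R j) \<longleftrightarrow> even (R (j + 1))" for j
  proof -
    \<comment> \<open>The assumption for contradiction enters here: no vertex of the second axis
      belongs to \<open>X\<close>.\<close>
    have "V 0 j = 0" using X0 by (simp add: V_def f_def)
    moreover have "V N j = 0" using N[of N] by (auto simp: V_def f_def)
    ultimately show ?thesis using row[where n = N and j = j] by (simp add: R_def)
  qed
  have "R N = 0" using N[of _ N] by (auto simp: R_def H_def f_def)
  then have "even (R N)" by simp
  have "even (R 0) \<longleftrightarrow> even (R n)" for n by (induction n) (use step in auto)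
  from this[of N] \<open>even (R N)\<close> have "even (R 0)" by simp
  \<comment> \<open>A boundary vertex in the lowest row is connected to the first axis by the empty
    walk, so every edge between \<open>A\<close> and its complement is selected there.\<close>
  have low: "H i 0 = of_bool (((i, 0) \<in> A) \<noteq> ((i + 1, 0) \<in> A))" for i
  proof -
    have "(m, 0) \<in> X" if "(n, 0) \<in> A" "(m, 0) \<notin> A" "m = n + 1 \<or> n = m + 1" for m n
    proof -
      have "(m, 0) \<in> tri_neighbours (n, 0)" using that by (auto simp: tri_neighbours_def)
      then have "(m, 0) \<in> C" using that by (auto simp: C_def)
      then show ?thesis by (auto simp: X_def)
    qed
    then show ?thesis using XA[of "(i, 0)"] XA[of "(i + 1, 0)"] by (auto simp: H_def f_def)
  qed
  \<comment> \<open>The selected edges count the changes of membership in \<open>A\<close> along the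
    row, which begins at a member.\<close>
  have "odd (\<Sum>i<n. H i 0) \<longleftrightarrow> (n, 0) \<notin> A" for n
  proof (induction n)
    case (Suc n)
    then show ?case by (auto simp: low)
  qed (simp add: zero)
  moreover have "(N, 0) \<notin> A" using N[of N 0] by auto
  ultimately show False using \<open>even (R 0)\<close> by (simp add: R_def)
qed

text \<open>Guarantees that a walk from \<open>(k, 0)\<close> to the second axis has at least
  \<open>k\<close> steps.\<close>

lemma tri_walk_fst:
  assumes "p \<in> walks tri_neighbours z n"
  shows "fst z \<le> fst (last p) + n"
  using assms
proof (induction n arbitrary: z p)
  case (Suc n)
  then obtain w p' where w: "w \<in> tri_neighbours z" "p' \<in> walks tri_neighbours w n" "p = z # p'"
    by (auto simp: walks_Suc)
  have "fst w \<le> fst (last p') + n" using Suc.IH w by blast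
  moreover have "fst z \<le> fst w + 1" using w(1) by (cases z) (auto simp: tri_neighbours_def)
  moreover have "p' \<noteq> []" using w(2) by (auto simp: walks_def)
  ultimately show ?case using w(3) by simp
qed (simp add: walks_0)

text \<open>The outer boundary of a finite cluster of \<open>S\<close> avoids \<open>S\<close>, so
  the separating walk does too. Trimming it to exactly \<open>k\<close> steps ties the length to the
  starting point and leaves a single index for the union bound. The instance \<open>k = 0\<close>
  forces the corner into \<open>S\<close>.\<close>

lemma infinite_cluster_or_vacant_walk:
  assumes "\<And>k p. p \<in> walks tri_neighbours (k, 0) k \<Longrightarrow> distinct p \<Longrightarrow> set p \<inter> S \<noteq> {}"
  shows "(0, 0) \<in> S \<and> infinite ((step_rel tri_neighbours S)\<^sup>* `` {(0, 0)})"
proof (intro conjI notI)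
  show S0: "(0, 0) \<in> S" using assms[of "[(0, 0)]" 0] by (auto simp: walks_0)
  let ?A = "(step_rel tri_neighbours S)\<^sup>* `` {(0, 0)}"
  assume "finite ?A"
  define C where "C = {c. c \<notin> ?A \<and> (\<exists>a\<in>?A. c \<in> tri_neighbours a)}"
  have AS: "?A \<subseteq> S"
  proof
    fix x assume "x \<in> ?A"
    then have "((0, 0), x) \<in> (step_rel tri_neighbours S)\<^sup>*" by simp
    then show "x \<in> S" using S0 by (cases rule: rtranclE) (auto simp: step_rel_def)
  qed
  have CS: "C \<inter> S = {}"
  proof (rule ccontr)
    assume "C \<inter> S \<noteq> {}"
    then obtain c a where c: "c \<in> S" "c \<notin> ?A" "a \<in> ?A" "c \<in> tri_neighbours a" by (auto simp: C_def)
    then have "(a, c) \<in> step_rel tri_neighbours S" using AS by (auto simp: step_rel_def)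
    then show False using c by (auto intro: rtrancl_into_rtrancl)
  qed
  obtain k m where km: "(k, 0) \<in> C" "((k, 0), (0, m)) \<in> (step_rel tri_neighbours C)\<^sup>*"
    using finite_cluster_separating_walk[OF \<open>finite ?A\<close>] unfolding C_def by auto
  obtain n p where p: "p \<in> walks tri_neighbours (k, 0) n" "distinct p" "set p \<subseteq> C" "last p = (0, m)"
    using reachable_distinct_walk[OF km(2,1)] by blast
  have "k \<le> n" using tri_walk_fst[OF p(1)] p(4) by simp
  have "set (take (Suc k) p) \<inter> S \<noteq> {}"
    using p(2) by (intro assms[of _ k] walks_take[OF p(1) \<open>k \<le> n\<close>]) auto
  moreover have "set (take (Suc k) p) \<subseteq> C" using p(3) by (auto dest: in_set_takeD)
  ultimately show False using CS by blast
qed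

section \<open>Bounds on the critical radius\<close>

definition occupied :: "real \<Rightarrow> 'a::euclidean_space measure \<Rightarrow> ('a \<Rightarrow> int) set" where
  "occupied s \<phi> = {z \<in> cube_indices. emeasure \<phi> (cube s z) \<noteq> 0}"

lemma mean_measure_cube:
  fixes \<Phi> :: "'w \<Rightarrow> 'a::euclidean_space measure"
  assumes "has_intensity M \<Phi> l" "0 \<le> l" "0 < s" "z \<in> cube_indices"
  shows "mean_measure M \<Phi> (cube s z) = ennreal (l * s ^ DIM('a))"
  using assms by (simp add: has_intensity_def cube_borel emeasure_cube ennreal_mult)

lemma weakly_sub_Poisson_prod_le:
  assumes wsp: "weakly_sub_Poisson M \<Phi>" and S: "finite S" "S \<noteq> {}"
    and B: "\<And>i. i \<in> S \<Longrightarrow> B i \<in> sets borel" "\<And>i. i \<in> S \<Longrightarrow> bounded (B i)" "disjoint_family_on B S"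
  shows "(\<integral>\<^sup>+\<omega>. (\<Prod>i\<in>S. emeasure (\<Phi> \<omega>) (B i)) \<partial>M) \<le> (\<Prod>i\<in>S. mean_measure M \<Phi> (B i))"
proof -
  obtain h where h: "bij_betw h {..<card S} S"
    using ex_bij_betw_nat_finite[OF S(1)] by (auto simp: lessThan_atLeast0)
  have hS: "h i \<in> S" if "i < card S" for i using h that by (auto simp: bij_betw_def)
  have "disjoint_family_on (\<lambda>i. B (h i)) {..<card S}"
    using B(3) h unfolding disjoint_family_on_def bij_betw_def inj_on_def by blast
  moreover have "1 \<le> card S" using S by (simp add: Suc_le_eq card_gt_0_iff)
  ultimately have "(\<integral>\<^sup>+\<omega>. (\<Prod>i<card S. emeasure (\<Phi> \<omega>) (B (h i))) \<partial>M) \<le> (\<Prod>i<card S. mean_measure M \<Phi> (B (h i)))"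
    using wsp B hS unfolding weakly_sub_Poisson_def by (auto simp del: One_nat_def)
  then show ?thesis by (simp add: prod.reindex_bij_betw[OF h, of "\<lambda>i. mean_measure M \<Phi> (B i)"]
    prod.reindex_bij_betw[OF h, of "\<lambda>i. emeasure (\<Phi> _) (B i)"])
qed

text \<open>Markov's inequality for a product: counts are integers, so a nonzero count is at least 1
  and the indicator is at most the product of the counts.\<close>

lemma prob_occupied_le:
  fixes \<Phi> :: "'w \<Rightarrow> 'a::euclidean_space measure"
  assumes wsp: "weakly_sub_Poisson M \<Phi>" and int: "has_intensity M \<Phi> l" and l: "0 \<le> l" and s: "0 < s"
    and S: "finite S" "S \<noteq> {}" "S \<subseteq> cube_indices"
  shows "measure M {\<omega>\<in>space M. \<forall>z\<in>S. emeasure (\<Phi> \<omega>) (cube s z) \<noteq> 0} \<le> (l * s ^ DIM('a)) ^ card S"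
proof -
  have pp: "point_process M \<Phi>" using wsp by (simp add: weakly_sub_Poisson_def)
  interpret prob_space M using pp by (rule point_process_prob_space)
  have m: "(\<lambda>\<omega>. emeasure (\<Phi> \<omega>) (cube s z)) \<in> borel_measurable M" if "z \<in> S" for z
    using pp that S s by (intro point_process_measurable cube_borel) auto
  let ?E = "{\<omega>\<in>space M. \<forall>z\<in>S. emeasure (\<Phi> \<omega>) (cube s z) \<noteq> 0}"
  have E: "?E \<in> events"
    using m S by (intro sets.sets_Collect_finite_All) (auto simp: measurable_compose)
  have "emeasure M ?E = (\<integral>\<^sup>+\<omega>. indicator ?E \<omega> \<partial>M)" using E by simp
  also have "\<dots> \<le> (\<integral>\<^sup>+\<omega>. (\<Prod>z\<in>S. emeasure (\<Phi> \<omega>) (cube s z)) \<partial>M)"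
  proof (intro nn_integral_mono)
    fix \<omega> assume \<omega>: "\<omega> \<in> space M"
    have "1 \<le> (\<Prod>z\<in>S. emeasure (\<Phi> \<omega>) (cube s z))" if "\<omega> \<in> ?E"
    proof -
      have "1 \<le> emeasure (\<Phi> \<omega>) (cube s z)" if "z \<in> S" for z
      proof (rule ccontr)
        assume "\<not> ?thesis"
        moreover have "emeasure (\<Phi> \<omega>) (cube s z) \<in> \<nat>"
          using that S(3) s
          by (intro lfcm_Nats[OF point_process_lfcm[OF pp \<omega>]] cube_borel bounded_cube) auto
        ultimately have "emeasure (\<Phi> \<omega>) (cube s z) = 0"
          by (intro ennreal_Nats_less_one) (simp_all add: not_le)
        then show False using \<open>\<omega> \<in> ?E\<close> that by simp
      qed
      then have "(\<Prod>z\<in>S. 1) \<le> (\<Prod>z\<in>S. emeasure (\<Phi> \<omega>) (cube s z))" by (intro prod_mono_ennreal)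
      then show ?thesis by simp
    qed
    then show "indicator ?E \<omega> \<le> (\<Prod>z\<in>S. emeasure (\<Phi> \<omega>) (cube s z))"
      by (auto simp: indicator_def)
  qed
  also have "\<dots> \<le> (\<Prod>z\<in>S. mean_measure M \<Phi> (cube s z))"
    using wsp S s by (intro weakly_sub_Poisson_prod_le disjoint_cubes cube_borel bounded_cube) auto
  also have "\<dots> = (\<Prod>z\<in>S. ennreal (l * s ^ DIM('a)))"
    using S s l int by (intro prod.cong mean_measure_cube) auto
  also have "\<dots> = ennreal ((l * s ^ DIM('a)) ^ card S)"
    using l s by (simp add: ennreal_power)
  finally show ?thesis using l s by (simp add: emeasure_eq_measure)
qed

text \<open>Vacancy of all the cubes is the void event of their union, and the volume of the union
  is additive because the cubes are disjoint.\<close>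

lemma prob_vacant_le:
  fixes \<Phi> :: "'w \<Rightarrow> 'a::euclidean_space measure"
  assumes wsp: "weakly_sub_Poisson M \<Phi>" and int: "has_intensity M \<Phi> l" and l: "0 \<le> l" and s: "0 < s"
    and S: "finite S" "S \<subseteq> cube_indices"
  shows "measure M {\<omega>\<in>space M. \<forall>z\<in>S. emeasure (\<Phi> \<omega>) (cube s z) = 0} \<le> exp (- l * s ^ DIM('a)) ^ card S"
proof -
  have pp: "point_process M \<Phi>" using wsp by (simp add: weakly_sub_Poisson_def)
  let ?B = "\<Union>z\<in>S. cube s z"
  have cb: "cube s z \<in> sets borel" if "z \<in> S" for z using that S s by (intro cube_borel) auto
  then have B: "?B \<in> sets borel" using S by (intro sets.finite_UN) auto
  have "{\<omega>\<in>space M. \<forall>z\<in>S. emeasure (\<Phi> \<omega>) (cube s z) = 0} = {\<omega>\<in>space M. emeasure (\<Phi> \<omega>) ?B = 0}"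
  proof (intro Collect_cong conj_cong refl)
    fix \<omega> assume "\<omega> \<in> space M"
    with pp have "\<Phi> \<omega> \<in> locally_finite_counting_measures" by (rule point_process_lfcm)
    then show "(\<forall>z\<in>S. emeasure (\<Phi> \<omega>) (cube s z) = 0) = (emeasure (\<Phi> \<omega>) ?B = 0)"
      using B cb by (simp add: emeasure_eq_0_iff_atoms) blast
  qed
  then have "measure M {\<omega>\<in>space M. \<forall>z\<in>S. emeasure (\<Phi> \<omega>) (cube s z) = 0} \<le> exp_neg (mean_measure M \<Phi> ?B)"
    using wsp B by (simp add: weakly_sub_Poisson_def)
  also have "mean_measure M \<Phi> ?B = ennreal (card S * (l * s ^ DIM('a)))"
  proof -
    have "emeasure lborel ?B = (\<Sum>z\<in>S. emeasure lborel (cube s z))"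
      using S cb by (intro sum_emeasure[symmetric] disjoint_cubes) auto
    also have "\<dots> = (\<Sum>z\<in>S. ennreal (s ^ DIM('a)))"
      using S s by (intro sum.cong emeasure_cube) auto
    also have "\<dots> = ennreal (card S * s ^ DIM('a))"
      using s by (simp add: ennreal_mult ennreal_of_nat_eq_real_of_nat)
    finally show ?thesis
      using int B l s by (simp add: has_intensity_def ennreal_mult[symmetric] ac_simps)
  qed
  also have "exp_neg \<dots> = exp (- l * s ^ DIM('a)) ^ card S"
    using l s by (simp add: exp_neg_def exp_of_nat_mult[symmetric])
  finally show ?thesis .
qed

section \<open>Lower bound: absence of percolation for small radii\<close>

text \<open>The side equals the largest jump between linked atoms, so a jump ends in the same or a
  neighbouring cube. Finitely many cubes hold only finitely many atoms, so an infinite atom cluster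
  occupies infinitely many cubes.\<close>

lemma percolates_imp_infinite_cube_cluster:
  fixes \<phi> :: "'a::euclidean_space measure"
  assumes \<phi>: "\<phi> \<in> locally_finite_counting_measures" and r: "0 < r"
    and perc: "percolates (covered_region \<phi> r)"
  shows "\<exists>z\<in>occupied (2 * r) \<phi>. infinite ((step_rel cube_neighbours (occupied (2 * r) \<phi>))\<^sup>* `` {z})"
proof -
  let ?O = "occupied (2 * r) \<phi>" and ?i = "cube_index (2 * r)"
  let ?R = "step_rel cube_neighbours ?O"
  obtain a where a: "a \<in> atoms \<phi>" "infinite ((atom_rel \<phi> (2 * r))\<^sup>* `` {a})"
    using percolates_imp_infinite_cluster[OF \<phi> perc] by blast
  have occ: "?i x \<in> ?O" if "x \<in> atoms \<phi>" for x
    using that r emeasure_eq_0_iff_atoms[OF \<phi>, of "cube (2 * r) (?i x)"] cube_borel[of "2 * r" "?i x"]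
    by (auto simp: occupied_def cube_def)
  have step: "b \<in> atoms \<phi> \<and> (?i a, ?i b) \<in> ?R\<^sup>*" if "(a, b) \<in> (atom_rel \<phi> (2 * r))\<^sup>*" for b
    using that
  proof (induction rule: rtrancl_induct)
    case (step b c)
    then have bc: "b \<in> atoms \<phi>" "c \<in> atoms \<phi>" "dist b c \<le> 2 * r" by (auto simp: atom_rel_def)
    show ?case
    proof (cases "?i b = ?i c")
      case False
      then have "(?i b, ?i c) \<in> ?R"
        using cube_index_dist_le[of "2 * r" b c] bc r occ by (auto simp: step_rel_def)
      then show ?thesis using step bc by (auto intro: rtrancl_into_rtrancl)
    qed (use step bc in auto)
  qed (use a in auto)
  have "infinite (?R\<^sup>* `` {?i a})"
  proof
    assume fin: "finite (?R\<^sup>* `` {?i a})"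
    have zi: "z \<in> cube_indices" if "z \<in> ?R\<^sup>* `` {?i a}" for z
    proof -
      have "(?i a, z) \<in> ?R\<^sup>*" using that by simp
      then show ?thesis
      proof (cases rule: rtranclE)
        case base
        then show ?thesis using cube_index_in[of "2 * r" a] by simp
      qed (auto simp: step_rel_def occupied_def)
    qed
    have "finite (\<Union>z\<in>?R\<^sup>* `` {?i a}. atoms \<phi> \<inter> cube (2 * r) z)"
      using fin r by (intro finite_UN_I finite_atoms[OF \<phi>] bounded_cube zi) auto
    moreover have "(atom_rel \<phi> (2 * r))\<^sup>* `` {a} \<subseteq> (\<Union>z\<in>?R\<^sup>* `` {?i a}. atoms \<phi> \<inter> cube (2 * r) z)"
      using step by (fastforce simp: cube_def)
    ultimately show False using a(2) finite_subset by blast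
  qed
  then show ?thesis using occ[OF a(1)] by blast
qed

text \<open>From a fixed cube, occupied walks of all lengths exist with probability 0. There are
  countably many starting cubes, so null sets cover the percolation event.\<close>

lemma percolation_prob_eq_0:
  fixes \<Phi> :: "'w \<Rightarrow> 'a::euclidean_space measure"
  assumes wsp: "weakly_sub_Poisson M \<Phi>" and int: "has_intensity M \<Phi> l" and l: "0 \<le> l" and r: "0 < r"
    and small: "(3 ^ DIM('a) - 1) * (l * (2 * r) ^ DIM('a)) < 1"
  shows "measure M {\<omega>\<in>space M. percolates (covered_region (\<Phi> \<omega>) r)} = 0"
proof -
  have pp: "point_process M \<Phi>" using wsp by (simp add: weakly_sub_Poisson_def)
  interpret prob_space M using pp by (rule point_process_prob_space)
  define s where "s = 2 * r"
  define q where "q = l * s ^ DIM('a)"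
  define N :: nat where "N = 3 ^ DIM('a) - 1"
  have s: "0 < s" and q: "0 \<le> q" using r l by (auto simp: s_def q_def)
  have N: "real N = 3 ^ DIM('a) - 1" by (simp add: N_def of_nat_diff)
  have Nq: "real N * q < 1" using small N by (simp add: q_def s_def)
  let ?P = "\<lambda>z \<omega>. emeasure (\<Phi> \<omega>) (cube s z) \<noteq> 0"
  have m: "{\<omega>\<in>space M. ?P z \<omega>} \<in> events" if "z \<in> cube_indices" for z
  proof -
    have [measurable]: "(\<lambda>\<omega>. emeasure (\<Phi> \<omega>) (cube s z)) \<in> borel_measurable M"
      using pp that s by (intro point_process_measurable cube_borel) auto
    show ?thesis by measurable
  qed
  define W where "W z n = {\<omega>\<in>space M. \<exists>p\<in>walks cube_neighbours z n. distinct p \<and> (\<forall>v\<in>set p. ?P v \<omega>)}" for z n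
  have nb: "cube_neighbours z \<subseteq> cube_indices" "card (cube_neighbours z) \<le> N" if "z \<in> cube_indices" for z :: "'a \<Rightarrow> int"
    using that cube_neighbours_subset[of z] by (simp_all add: N_def card_cube_neighbours)
  have occ: "prob {\<omega>\<in>space M. \<forall>z\<in>S. ?P z \<omega>} \<le> q ^ card S" if "finite S" "S \<noteq> {}" "S \<subseteq> cube_indices" for S
    unfolding q_def using that by (rule prob_occupied_le[OF wsp int l s])
  have W: "W z n \<in> events" "prob (W z n) \<le> real N ^ n * q ^ Suc n" if z: "z \<in> cube_indices" for z n
    unfolding W_def
    by (rule prob_distinct_walk_le[where V = cube_indices and D = N and q = q],
        (fact nb finite_cube_neighbours z m occ q)+)+
  have null: "(\<Inter>n. W z n) \<in> null_sets M" if z: "z \<in> cube_indices" for z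
  proof -
    have ev: "(\<Inter>n. W z n) \<in> events" using W(1)[OF z] by blast
    have "prob (\<Inter>n. W z n) \<le> q * (real N * q) ^ n" for n
    proof -
      have "prob (\<Inter>n. W z n) \<le> prob (W z n)" using W(1)[OF z] by (intro finite_measure_mono) auto
      also have "\<dots> \<le> q * (real N * q) ^ n" using W(2)[OF z, of n] by (simp add: power_mult_distrib ac_simps)
      finally show ?thesis .
    qed
    moreover have "(\<lambda>n. q * (real N * q) ^ n) \<longlonglongrightarrow> q * 0"
      using Nq q by (intro tendsto_mult tendsto_const LIMSEQ_power_zero) auto
    ultimately have "prob (\<Inter>n. W z n) \<le> q * 0"
      by (intro LIMSEQ_le_const) auto
    then show ?thesis using ev by (auto simp: emeasure_eq_measure null_sets_def intro: antisym)
  qed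
  have "(\<Union>z\<in>cube_indices. \<Inter>n. W z n) \<in> null_sets M"
    using null by (intro null_sets_UN') auto
  moreover have "{\<omega>\<in>space M. percolates (covered_region (\<Phi> \<omega>) r)} \<subseteq> (\<Union>z\<in>cube_indices. \<Inter>n. W z n)"
  proof
    fix \<omega> assume "\<omega> \<in> {\<omega>\<in>space M. percolates (covered_region (\<Phi> \<omega>) r)}"
    then have \<omega>: "\<omega> \<in> space M" "percolates (covered_region (\<Phi> \<omega>) r)" by auto
    obtain z where z: "z \<in> occupied s (\<Phi> \<omega>)" "infinite ((step_rel cube_neighbours (occupied s (\<Phi> \<omega>)))\<^sup>* `` {z})"
      using percolates_imp_infinite_cube_cluster[OF point_process_lfcm[OF pp \<omega>(1)] r \<omega>(2)]
      unfolding s_def by blast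
    have "\<omega> \<in> W z n" for n
      using infinite_cluster_walks[OF z(2,1), of n] \<omega>(1) by (fastforce simp: W_def occupied_def)
    then show "\<omega> \<in> (\<Union>z\<in>cube_indices. \<Inter>n. W z n)"
      using z(1) by (auto simp: occupied_def intro!: bexI[of _ z])
  qed
  ultimately have "{\<omega>\<in>space M. percolates (covered_region (\<Phi> \<omega>) r)} \<in> null_sets M"
    by (rule null_sets_subset[OF _ percolation_event[OF pp less_imp_le[OF r]]])
  then show ?thesis by (simp add: null_sets_def measure_def)
qed

section \<open>Upper bound: percolation within a planar layer\<close>

text \<open>Source of the factor \<open>sqrt d\<close>: each coordinate differs by at most
  \<open>2 * s\<close>, which makes the Euclidean distance at most twice the radius
  \<open>s * sqrt d\<close>.\<close>

lemma cube_dist_le: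
  fixes x y :: "'a::euclidean_space"
  assumes s: "0 < s" and z: "z \<in> cube_indices" "w \<in> cube_indices"
    and x: "x \<in> cube s z" and y: "y \<in> cube s w" and zw: "\<And>b. b \<in> Basis \<Longrightarrow> \<bar>z b - w b\<bar> \<le> 1"
  shows "dist x y \<le> 2 * (s * sqrt DIM('a))"
proof -
  have "\<bar>(x - y) \<bullet> b\<bar> \<le> 2 * s" if b: "b \<in> Basis" for b
  proof -
    have "s * z b \<le> x \<bullet> b" "x \<bullet> b < s * (z b + 1)" using x b unfolding cube_eq[OF s z(1)] by auto
    moreover have "s * w b \<le> y \<bullet> b" "y \<bullet> b < s * (w b + 1)" using y b unfolding cube_eq[OF s z(2)] by auto
    moreover have "s * z b \<le> s * (w b + 1)" "s * w b \<le> s * (z b + 1)"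
      using zw[OF b] s by (auto intro!: mult_left_mono)
    ultimately show ?thesis by (simp add: inner_diff_left algebra_simps)
  qed
  then have "((x - y) \<bullet> b)\<^sup>2 \<le> (2 * s)\<^sup>2" if "b \<in> Basis" for b
    using that s by (metis abs_le_square_iff abs_of_pos mult_pos_pos zero_less_numeral)
  then have "(\<Sum>b\<in>Basis. ((x - y) \<bullet> b)\<^sup>2) \<le> (\<Sum>b\<in>(Basis :: 'a set). (2 * s)\<^sup>2)" by (intro sum_mono)
  also have "(\<Sum>b\<in>Basis. ((x - y) \<bullet> b)\<^sup>2) = (dist x y)\<^sup>2"
    unfolding dist_norm power2_norm_eq_inner power2_eq_square[of "inner _ _"] by (rule euclidean_inner[symmetric])
  also have "(\<Sum>b\<in>(Basis :: 'a set). (2 * s)\<^sup>2) = (2 * (s * sqrt DIM('a)))\<^sup>2"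
    by (simp add: power_mult_distrib)
  finally show ?thesis by (rule power2_le_imp_le) (use s in simp)
qed

text \<open>One atom is chosen in each occupied cube. As \<open>g\<close> is injective and cubes are
  disjoint, an infinite cluster of cubes yields infinitely many distinct linked atoms.\<close>

lemma vacant_walk_or_percolates:
  fixes \<phi> :: "'a::euclidean_space measure" and g :: "nat \<times> nat \<Rightarrow> 'a \<Rightarrow> int"
  assumes \<phi>: "\<phi> \<in> locally_finite_counting_measures" and s: "0 < s"
    and g: "inj g" "\<And>u. g u \<in> cube_indices"
      "\<And>u v b. v \<in> tri_neighbours u \<Longrightarrow> b \<in> Basis \<Longrightarrow> \<bar>g u b - g v b\<bar> \<le> 1"
    and no: "\<And>k p. p \<in> walks tri_neighbours (k, 0) k \<Longrightarrow> distinct p \<Longrightarrow> \<exists>u\<in>set p. emeasure \<phi> (cube s (g u)) \<noteq> 0"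
  shows "percolates (covered_region \<phi> (s * sqrt DIM('a)))"
proof -
  define S where "S = {u. emeasure \<phi> (cube s (g u)) \<noteq> 0}"
  let ?T = "(step_rel tri_neighbours S)\<^sup>* `` {(0, 0)}"
  have S: "(0, 0) \<in> S" "infinite ?T"
    using infinite_cluster_or_vacant_walk[of S] no by (auto simp: S_def)
  have "\<forall>u\<in>S. \<exists>x. x \<in> atoms \<phi> \<inter> cube s (g u)"
    using emeasure_neq_0_atom[OF \<phi> cube_borel[OF s g(2)]] by (auto simp: S_def)
  then obtain x where x: "\<And>u. u \<in> S \<Longrightarrow> x u \<in> atoms \<phi>" "\<And>u. u \<in> S \<Longrightarrow> x u \<in> cube s (g u)"
    by (auto simp: bchoice_iff)
  have reach: "u \<in> S \<and> (x (0, 0), x u) \<in> (atom_rel \<phi> (2 * (s * sqrt DIM('a))))\<^sup>*"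
    if "((0, 0), u) \<in> (step_rel tri_neighbours S)\<^sup>*" for u
    using that
  proof (induction rule: rtrancl_induct)
    case (step u v)
    then have uv: "u \<in> S" "v \<in> S" "v \<in> tri_neighbours u" by (auto simp: step_rel_def)
    have "dist (x u) (x v) \<le> 2 * (s * sqrt DIM('a))"
      by (rule cube_dist_le[OF s g(2) g(2) x(2) x(2)]) (use uv g(3) in auto)
    then have "(x u, x v) \<in> atom_rel \<phi> (2 * (s * sqrt DIM('a)))"
      using x uv by (auto simp: atom_rel_def)
    then show ?case using step uv by (auto intro: rtrancl_into_rtrancl)
  qed (use S in auto)
  have "inj_on x ?T"
  proof (rule inj_onI)
    fix u v assume "u \<in> ?T" "v \<in> ?T" "x u = x v"
    then have "g u = g v" using x(2)[of u] x(2)[of v] reach by (auto simp: cube_def)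
    then show "u = v" using g(1) by (auto dest: injD)
  qed
  then have "infinite (x ` ?T)" using S(2) by (simp add: finite_image_iff)
  moreover have "x ` ?T \<subseteq> (atom_rel \<phi> (2 * (s * sqrt DIM('a))))\<^sup>* `` {x (0, 0)}" using reach by auto
  ultimately have "infinite ((atom_rel \<phi> (2 * (s * sqrt DIM('a))))\<^sup>* `` {x (0, 0)})"
    using finite_subset by blast
  then show ?thesis using x(1)[OF S(1)] s by (intro infinite_cluster_imp_percolates[OF \<phi>]) auto
qed

text \<open>Two distinct basis vectors carry the lattice coordinates; all other coordinates are
  fixed at 0.\<close>

lemma planar_cube_embedding:
  assumes "2 \<le> DIM('a::euclidean_space)"
  obtains g :: "nat \<times> nat \<Rightarrow> 'a::euclidean_space \<Rightarrow> int" where "inj g" "\<And>u. g u \<in> cube_indices"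
    "\<And>u v b. v \<in> tri_neighbours u \<Longrightarrow> b \<in> Basis \<Longrightarrow> \<bar>g u b - g v b\<bar> \<le> 1"
proof -
  obtain b1 b2 :: 'a where b: "b1 \<in> Basis" "b2 \<in> Basis" "b1 \<noteq> b2"
    using assms by (metis card_le_Suc0_iff_eq finite_Basis not_less_eq_eq numeral_2_eq_2)
  define g :: "nat \<times> nat \<Rightarrow> 'a \<Rightarrow> int" where
    "g = (\<lambda>(i, j). \<lambda>b\<in>Basis. if b = b1 then int i else if b = b2 then int j else 0)"
  show thesis
  proof (rule that[of g])
    show "inj g"
    proof (rule injI)
      fix u v assume "g u = g v"
      then have "g u b1 = g v b1" "g u b2 = g v b2" by auto
      then show "u = v" using b by (cases u; cases v) (auto simp: g_def)
    qed
    show "g u \<in> cube_indices" for u by (cases u) (simp add: g_def)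
    show "\<bar>g u b - g v b\<bar> \<le> 1" if "v \<in> tri_neighbours u" "b \<in> Basis" for u v b
      using that by (cases u; cases v) (auto simp: g_def tri_neighbours_def)
  qed
qed

lemma percolation_prob_pos:
  fixes \<Phi> :: "'w \<Rightarrow> 'a::euclidean_space measure"
  assumes wsp: "weakly_sub_Poisson M \<Phi>" and int: "has_intensity M \<Phi> l" and l: "0 \<le> l" and s: "0 < s"
    and d: "2 \<le> DIM('a)" and large: "exp (- l * s ^ DIM('a)) < 1 / 7"
  shows "0 < measure M {\<omega>\<in>space M. percolates (covered_region (\<Phi> \<omega>) (s * sqrt DIM('a)))}"
proof -
  have pp: "point_process M \<Phi>" using wsp by (simp add: weakly_sub_Poisson_def)
  interpret prob_space M using pp by (rule point_process_prob_space)
  define q where "q = exp (- l * s ^ DIM('a))"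
  have q: "0 < q" "q < 1 / 7" using large by (auto simp: q_def)
  obtain g :: "nat \<times> nat \<Rightarrow> 'a \<Rightarrow> int" where g: "inj g" "\<And>u. g u \<in> cube_indices"
    "\<And>u v b. v \<in> tri_neighbours u \<Longrightarrow> b \<in> Basis \<Longrightarrow> \<bar>g u b - g v b\<bar> \<le> 1"
    using planar_cube_embedding[OF d] by blast
  let ?P = "\<lambda>u \<omega>. emeasure (\<Phi> \<omega>) (cube s (g u)) = 0"
  define W where "W k = {\<omega>\<in>space M. \<exists>p\<in>walks tri_neighbours (k, 0) k. distinct p \<and> (\<forall>u\<in>set p. ?P u \<omega>)}" for k
  have m: "{\<omega>\<in>space M. ?P u \<omega>} \<in> events" for u
  proof -
    have [measurable]: "(\<lambda>\<omega>. emeasure (\<Phi> \<omega>) (cube s (g u))) \<in> borel_measurable M"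
      using pp g s by (intro point_process_measurable cube_borel) auto
    show ?thesis by measurable
  qed
  have vac: "prob {\<omega>\<in>space M. \<forall>u\<in>S. ?P u \<omega>} \<le> q ^ card S" if "finite S" for S
    using prob_vacant_le[OF wsp int l s, of "g ` S"] that g(2) card_image[OF inj_on_subset[OF g(1)], of S]
    by (simp add: q_def image_subset_iff del: split_paired_All)
  have W: "W k \<in> events" "prob (W k) \<le> 6 ^ k * q ^ Suc k" for k
    unfolding W_def
    using prob_distinct_walk_le[of UNIV tri_neighbours 6 "(k, 0)" ?P q k] m vac q card_tri_neighbours
    by auto
  have geo: "(\<lambda>k. 6 ^ k * q ^ Suc k) sums (q / (1 - 6 * q))"
    using sums_mult[OF geometric_sums[of "6 * q"], of q] q by (simp add: power_mult_distrib ac_simps)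
  have "prob (\<Union>k. W k) \<le> (\<Sum>k. prob (W k))"
    using W geo by (intro finite_measure_subadditive_countably summable_comparison_test[OF _ sums_summable[OF geo]]) auto
  also have "\<dots> \<le> (\<Sum>k. 6 ^ k * q ^ Suc k)"
    using W geo by (intro suminf_le summable_comparison_test[OF _ sums_summable[OF geo]] sums_summable[OF geo]) auto
  also have "\<dots> = q / (1 - 6 * q)" using geo by (rule sums_unique[symmetric])
  also have "\<dots> < 1" using q by simp
  finally have "0 < 1 - prob (\<Union>k. W k)" by simp
  also have "\<dots> = prob (space M - (\<Union>k. W k))" using W by (intro prob_compl[symmetric]) auto
  also have "\<dots> \<le> prob {\<omega>\<in>space M. percolates (covered_region (\<Phi> \<omega>) (s * sqrt DIM('a)))}"
  proof (rule finite_measure_mono)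
    show "{\<omega>\<in>space M. percolates (covered_region (\<Phi> \<omega>) (s * sqrt DIM('a)))} \<in> events"
      using s by (intro percolation_event[OF pp]) auto
    show "space M - (\<Union>k. W k) \<subseteq> {\<omega>\<in>space M. percolates (covered_region (\<Phi> \<omega>) (s * sqrt DIM('a)))}"
    proof
      fix \<omega> assume \<omega>: "\<omega> \<in> space M - (\<Union>k. W k)"
      have "percolates (covered_region (\<Phi> \<omega>) (s * sqrt DIM('a)))"
      proof (rule vacant_walk_or_percolates[OF _ s g])
        show "\<Phi> \<omega> \<in> locally_finite_counting_measures" using \<omega> by (intro point_process_lfcm[OF pp]) auto
        show "\<exists>u\<in>set p. emeasure (\<Phi> \<omega>) (cube s (g u)) \<noteq> 0"
          if "p \<in> walks tri_neighbours (k, 0) k" "distinct p" for k p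
          using \<omega> that by (auto simp: W_def)
      qed auto
      then show "\<omega> \<in> {\<omega>\<in>space M. percolates (covered_region (\<Phi> \<omega>) (s * sqrt DIM('a)))}" using \<omega> by auto
    qed
  qed
  finally show ?thesis .
qed

section \<open>From percolation probabilities to the critical radius\<close>

lemma powr_inverse_power: "0 < x \<Longrightarrow> 0 < n \<Longrightarrow> (x powr (1 / real n)) ^ n = x"
  by (simp add: powr_realpow[symmetric] powr_powr)

lemma power_powr_inverse: "0 < x \<Longrightarrow> 0 < n \<Longrightarrow> (x ^ n) powr (1 / real n) = x"
  by (simp add: powr_realpow[symmetric] powr_powr)

lemma critical_radius_ge:
  fixes \<Phi> :: "'w \<Rightarrow> 'a::euclidean_space measure"
  assumes wsp: "weakly_sub_Poisson M \<Phi>" and int: "has_intensity M \<Phi> l" and l: "0 < l"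
  shows "ereal ((1/2) * (1 / (l * (3 ^ DIM('a) - 1)) powr (1 / real DIM('a)))) \<le> critical_radius M \<Phi>"
  unfolding critical_radius_def
proof (rule Inf_greatest)
  fix x assume "x \<in> ereal ` {r. 0 < r \<and> 0 < \<P>(\<omega> in M. percolates (covered_region (\<Phi> \<omega>) r))}"
  then obtain r where r: "x = ereal r" "0 < r" "0 < \<P>(\<omega> in M. percolates (covered_region (\<Phi> \<omega>) r))"
    by auto
  let ?d = "real DIM('a)" and ?c = "l * (3 ^ DIM('a) - 1)"
  have "(3::real) ^ 1 \<le> 3 ^ DIM('a)" by (intro power_increasing) (auto simp: Suc_leI)
  then have c: "0 < ?c" using l by simp
  have "1 \<le> (3 ^ DIM('a) - 1) * (l * (2 * r) ^ DIM('a))"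
  proof (rule ccontr)
    assume "\<not> ?thesis"
    then have small: "(3 ^ DIM('a) - 1) * (l * (2 * r) ^ DIM('a)) < 1" by simp
    show False using percolation_prob_eq_0[OF wsp int less_imp_le[OF l] r(2) small] r(3) by simp
  qed
  then have "1 / ?c \<le> (2 * r) ^ DIM('a)" using c by (simp add: field_simps)
  then have "(1 / ?c) powr (1 / ?d) \<le> ((2 * r) ^ DIM('a)) powr (1 / ?d)"
    using c by (intro powr_mono2) auto
  also have "\<dots> = 2 * r" using r(2) by (intro power_powr_inverse) auto
  finally show "ereal ((1/2) * (1 / ?c powr (1 / ?d))) \<le> x"
    using r(1) c by (simp add: powr_divide)
qed

text \<open>Only numbers strictly above the bound are tested, because the planar argument needs a
  vacancy probability strictly below 1/7, and for d = 2 the bound itself gives exactly 1/7.\<close>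

lemma critical_radius_le:
  fixes \<Phi> :: "'w \<Rightarrow> 'a::euclidean_space measure"
  assumes wsp: "weakly_sub_Poisson M \<Phi>" and int: "has_intensity M \<Phi> l" and l: "0 < l" and d: "2 \<le> DIM('a)"
  shows "critical_radius M \<Phi> \<le> ereal (sqrt DIM('a) * (ln (3 ^ DIM('a) - 2) / l) powr (1 / real DIM('a)))"
proof (rule dense_ge)
  let ?d = "real DIM('a)" and ?L = "ln (3 ^ DIM('a) - 2) / l"
  fix x :: ereal
  assume x: "ereal (sqrt ?d * ?L powr (1 / ?d)) < x"
  \<comment> \<open>In dimension 2 the number 3^2 - 2 = 7 is exactly the threshold of the planar
    argument.\<close>
  have "(3::real) ^ 2 \<le> 3 ^ DIM('a)" using d by (intro power_increasing) auto
  then have seven: "(7::real) \<le> 3 ^ DIM('a) - 2" by simp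
  then have L: "0 < ?L" using l by simp
  show "critical_radius M \<Phi> \<le> x"
  proof (cases x)
    case (real r)
    define s where "s = r / sqrt ?d"
    have r: "sqrt ?d * ?L powr (1 / ?d) < r" using x real by simp
    then have s: "?L powr (1 / ?d) < s" by (simp add: s_def field_simps)
    have s0: "0 < s" using s powr_ge_zero[of ?L "1 / ?d"] by linarith
    have rs: "r = s * sqrt ?d" by (simp add: s_def)
    have "?L = (?L powr (1 / ?d)) ^ DIM('a)"
      by (rule powr_inverse_power[OF L DIM_positive, symmetric])
    also have "\<dots> < s ^ DIM('a)" using s by (intro power_strict_mono) auto
    finally have "ln (3 ^ DIM('a) - 2) < l * s ^ DIM('a)" using l by (simp add: field_simps)
    moreover have "ln 7 \<le> ln (3 ^ DIM('a) - 2 :: real)" using seven by (subst ln_le_cancel_iff) auto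
    ultimately have "exp (- l * s ^ DIM('a)) < exp (- ln 7)" by simp
    then have "exp (- l * s ^ DIM('a)) < 1 / 7" by (simp add: exp_minus field_simps)
    then have "0 < measure M {\<omega>\<in>space M. percolates (covered_region (\<Phi> \<omega>) (s * sqrt ?d))}"
      using wsp int l s0 d by (intro percolation_prob_pos) auto
    moreover have "0 < r" using s0 rs by simp
    ultimately show ?thesis
      unfolding critical_radius_def using real rs by (intro Inf_lower) auto
  qed (use x in auto)
qed

section \<open>Hadamard's inequality for Gram matrices\<close>

text \<open>One step of Gaussian elimination as a factorisation: \<open>P\<close> is lower
  triangular with unit diagonal, and \<open>Q\<close> has its first column cleared below the
  pivot.\<close>

lemma det_schur_complement:
  fixes A :: "nat \<Rightarrow> nat \<Rightarrow> 'c::field"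
  assumes a: "A 0 0 \<noteq> 0"
  shows "Determinant.det (Matrix.mat (Suc n) (Suc n) (\<lambda>(i, j). A i j)) =
    A 0 0 * Determinant.det (Matrix.mat n n (\<lambda>(i, j). A (Suc i) (Suc j) - A (Suc i) 0 * A 0 (Suc j) / A 0 0))"
proof -
  let ?B = "\<lambda>i j. A i j - A i 0 * A 0 j / A 0 0"
  define P where "P = Matrix.mat (Suc n) (Suc n) (\<lambda>(i, j). if i = j then 1 else if j = 0 then A i 0 / A 0 0 else 0)"
  define Q where "Q = Matrix.mat (Suc n) (Suc n) (\<lambda>(i, j). if i = 0 then A 0 j else ?B i j)"
  have P: "P \<in> carrier_mat (Suc n) (Suc n)" and Q: "Q \<in> carrier_mat (Suc n) (Suc n)"
    by (auto simp: P_def Q_def)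
  have "Matrix.mat (Suc n) (Suc n) (\<lambda>(i, j). A i j) = P * Q"
  proof (rule eq_matI)
    fix i j assume "i < dim_row (P * Q)" "j < dim_col (P * Q)"
    then have ij: "i < Suc n" "j < Suc n" by (auto simp: P_def Q_def)
    have "(P * Q) $$ (i, j) = (\<Sum>k = 0..<Suc n. P $$ (i, k) * Q $$ (k, j))"
      using ij P Q by (simp add: scalar_prod_def)
    also have "\<dots> = P $$ (i, 0) * Q $$ (0, j) + (\<Sum>k = 0..<n. P $$ (i, Suc k) * Q $$ (Suc k, j))"
      by (simp add: sum.atLeast0_lessThan_Suc_shift del: sum.op_ivl_Suc)
    also have "\<dots> = A i j"
    proof (cases i)
      case 0
      have "(\<Sum>k = 0..<n. P $$ (i, Suc k) * Q $$ (Suc k, j)) = 0"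
        using 0 by (intro sum.neutral) (auto simp: P_def)
      then show ?thesis using 0 ij by (simp add: P_def Q_def)
    next
      case (Suc l)
      have "(\<Sum>k = 0..<n. P $$ (i, Suc k) * Q $$ (Suc k, j)) = (\<Sum>k = 0..<n. if k = l then ?B i j else 0)"
        using Suc ij by (intro sum.cong) (auto simp: P_def Q_def)
      then show ?thesis using Suc ij a by (simp add: P_def Q_def)
    qed
    finally show "Matrix.mat (Suc n) (Suc n) (\<lambda>(i, j). A i j) $$ (i, j) = (P * Q) $$ (i, j)"
      using ij by simp
  qed (auto simp: P_def Q_def)
  then have "Determinant.det (Matrix.mat (Suc n) (Suc n) (\<lambda>(i, j). A i j)) = Determinant.det P * Determinant.det Q"
    using det_mult[OF P Q] by simp
  also have "Determinant.det P = 1"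
  proof -
    have "Determinant.det P = prod_list (diag_mat P)"
      by (rule det_lower_triangular[OF _ P]) (auto simp: P_def)
    also have "diag_mat P = replicate (Suc n) 1"
      by (rule nth_equalityI) (auto simp: diag_mat_def P_def simp del: upt_Suc replicate_Suc)
    finally show ?thesis by simp
  qed
  also have "Determinant.det Q = A 0 0 * Determinant.det (mat_delete Q 0 0)"
  proof -
    have "Determinant.det Q = (\<Sum>i<Suc n. Q $$ (i, 0) * cofactor Q i 0)"
      by (rule laplace_expansion_column[OF Q]) simp
    also have "\<dots> = (\<Sum>i<Suc n. if i = 0 then A 0 0 * cofactor Q 0 0 else 0)"
      using a by (intro sum.cong) (auto simp: Q_def)
    also have "\<dots> = A 0 0 * cofactor Q 0 0" by (subst sum.delta) auto
    finally show ?thesis by (simp add: cofactor_def)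
  qed
  also have "mat_delete Q 0 0 = Matrix.mat n n (\<lambda>(i, j). ?B (Suc i) (Suc j))"
    by (rule eq_matI) (auto simp: mat_delete_def Q_def)
  finally show ?thesis by simp
qed

definition gram :: "'m set \<Rightarrow> (nat \<Rightarrow> 'm \<Rightarrow> complex) \<Rightarrow> nat \<Rightarrow> nat \<Rightarrow> complex" where
  "gram I v i j = (\<Sum>m\<in>I. v i m * cnj (v j m))"

lemma gram_diag: "gram I v i i = complex_of_real (\<Sum>m\<in>I. (cmod (v i m))\<^sup>2)"
  unfolding gram_def of_real_sum complex_norm_square ..

lemma gram_cnj: "cnj (gram I v i j) = gram I v j i"
  by (simp add: gram_def mult.commute)

text \<open>The Schur complement of a Gram matrix is the Gram matrix of the projections to the orthogonal
  complement of the first vector, and projecting decreases norms.\<close>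

lemma gram_det_bounds:
  assumes fin: "finite I"
  shows "\<exists>t\<ge>0. Determinant.det (Matrix.mat n n (\<lambda>(i, j). gram I v i j)) = complex_of_real t \<and>
    t \<le> (\<Prod>i<n. \<Sum>m\<in>I. (cmod (v i m))\<^sup>2)"
proof (induction n arbitrary: v)
  case 0
  show ?case by (intro exI[of _ 1]) (simp add: det_def)
next
  case (Suc n)
  let ?G = "gram I v"
  let ?M = "Matrix.mat (Suc n) (Suc n) (\<lambda>(i, j). ?G i j)"
  let ?s = "\<lambda>v i. \<Sum>m\<in>I. (cmod (v i m))\<^sup>2"
  have s0: "0 \<le> ?s v i" for v :: "nat \<Rightarrow> 'a \<Rightarrow> complex" and i by (intro sum_nonneg) auto
  show ?case
  proof (cases "?s v 0 = 0")
    \<comment> \<open>There is no pivot for a Schur complement, but the first vector vanishes and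
      makes a zero column.\<close>
    case True
    then have "\<forall>m\<in>I. v 0 m = 0" using fin by (simp add: sum_nonneg_eq_0_iff)
    then have "?G i 0 = 0" for i by (simp add: gram_def)
    then have "Determinant.det ?M = 0"
      using laplace_expansion_column[of ?M "Suc n" 0] by simp
    then show ?thesis using s0 by (intro exI[of _ 0]) (auto intro!: prod_nonneg mult_nonneg_nonneg)
  next
    case False
    define a where "a = ?s v 0"
    have a: "0 < a" using False s0[of v 0] by (simp add: a_def)
    have G00: "?G 0 0 = complex_of_real a" by (simp add: gram_diag a_def)
    define w where "w i m = v (Suc i) m - ?G (Suc i) 0 / a * v 0 m" for i m
    have wg: "gram I w i j = ?G (Suc i) (Suc j) - ?G (Suc i) 0 * ?G 0 (Suc j) / ?G 0 0" for i j
    proof -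
      let ?p = "?G (Suc i) 0 / a" and ?q = "?G 0 (Suc j) / a"
      have "w i m * cnj (w j m) = v (Suc i) m * cnj (v (Suc j) m) - ?q * (v (Suc i) m * cnj (v 0 m))
          - ?p * (v 0 m * cnj (v (Suc j) m)) + ?p * ?q * (v 0 m * cnj (v 0 m))" for m
        by (simp add: w_def gram_cnj algebra_simps)
      then have "gram I w i j = ?G (Suc i) (Suc j) - ?q * ?G (Suc i) 0 - ?p * ?G 0 (Suc j) + ?p * ?q * ?G 0 0"
        by (simp add: gram_def sum.distrib sum_subtractf sum_distrib_left)
      also have "\<dots> = ?G (Suc i) (Suc j) - ?G (Suc i) 0 * ?G 0 (Suc j) / ?G 0 0"
        using a by (simp add: G00 field_simps)
      finally show ?thesis .
    qed
    obtain t where t: "0 \<le> t" "Determinant.det (Matrix.mat n n (\<lambda>(i, j). gram I w i j)) = complex_of_real t"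
      "t \<le> (\<Prod>i<n. ?s w i)"
      using Suc.IH[of w] by blast
    have "?s w i \<le> ?s v (Suc i)" for i
    proof -
      have "complex_of_real (?s w i) = ?G (Suc i) (Suc i) - ?G (Suc i) 0 * cnj (?G (Suc i) 0) / complex_of_real a"
        using wg[of i i] by (simp only: gram_diag[symmetric] gram_cnj G00)
      also have "\<dots> = complex_of_real (?s v (Suc i) - (cmod (?G (Suc i) 0))\<^sup>2 / a)"
        by (simp only: gram_diag complex_norm_square[symmetric] of_real_diff of_real_divide)
      finally have "?s w i = ?s v (Suc i) - (cmod (?G (Suc i) 0))\<^sup>2 / a"
        by (simp only: of_real_eq_iff)
      then show ?thesis using a by simp
    qed
    then have "(\<Prod>i<n. ?s w i) \<le> (\<Prod>i<n. ?s v (Suc i))" using s0 by (intro prod_mono) auto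
    then have "a * t \<le> a * (\<Prod>i<n. ?s v (Suc i))" using t a by (intro mult_left_mono) auto
    also have "\<dots> = (\<Prod>i<Suc n. ?s v i)" by (simp add: prod.lessThan_Suc_shift a_def del: prod.lessThan_Suc)
    finally have "a * t \<le> (\<Prod>i<Suc n. ?s v i)" .
    moreover have "Determinant.det ?M = complex_of_real (a * t)"
      using det_schur_complement[of ?G n] a t(2) by (simp add: G00 wg[unfolded G00])
    ultimately show ?thesis using a t(1) by (intro exI[of _ "a * t"]) auto
  qed
qed

section \<open>Elementary symmetric polynomials\<close>

definition injections :: "nat \<Rightarrow> 'b set \<Rightarrow> (nat \<Rightarrow> 'b) set" where
  "injections k I = {g \<in> {..<k} \<rightarrow>\<^sub>E I. inj_on g {..<k}}"

definition elem_sym :: "('b \<Rightarrow> real) \<Rightarrow> 'b set \<Rightarrow> nat \<Rightarrow> real" where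
  "elem_sym t I k = (\<Sum>X | X \<subseteq> I \<and> card X = k. \<Prod>x\<in>X. t x)"

lemma finite_injections: "finite I \<Longrightarrow> finite (injections k I)"
  by (simp add: injections_def finite_PiE)

text \<open>Grouping tuples by their image, each set of size \<open>k\<close> is hit by
  \<open>fact k\<close> injections.\<close>

lemma sum_injections:
  assumes fin: "finite I"
  shows "(\<Sum>g\<in>injections k I. \<Prod>i<k. t (g i)) = fact k * elem_sym t I k"
proof -
  let ?S = "{X. X \<subseteq> I \<and> card X = k}"
  have "(\<Sum>X\<in>?S. \<Sum>g\<in>{g\<in>injections k I. g ` {..<k} = X}. \<Prod>i<k. t (g i)) = (\<Sum>g\<in>injections k I. \<Prod>i<k. t (g i))"
  proof (rule sum.group)
    show "finite (injections k I)" using fin by (rule finite_injections)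
    show "finite ?S" using fin by simp
    show "(\<lambda>g. g ` {..<k}) ` injections k I \<subseteq> ?S"
      by (auto simp: injections_def card_image PiE_iff)
  qed
  moreover have "(\<Sum>g\<in>{g\<in>injections k I. g ` {..<k} = X}. \<Prod>i<k. t (g i)) = fact k * (\<Prod>x\<in>X. t x)"
    if X: "X \<in> ?S" for X
  proof -
    have finX: "finite X" "card X = k" "X \<subseteq> I" using X fin finite_subset by auto
    have eq: "{g\<in>injections k I. g ` {..<k} = X} = {g \<in> {..<k} \<rightarrow>\<^sub>E X. inj_on g {..<k}}"
    proof (intro equalityI subsetI)
      fix g assume g: "g \<in> {g \<in> {..<k} \<rightarrow>\<^sub>E X. inj_on g {..<k}}"
      then have "g ` {..<k} \<subseteq> X" by auto
      moreover have "card (g ` {..<k}) = k" using g by (simp add: card_image)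
      ultimately have "g ` {..<k} = X" using finX by (intro card_subset_eq) auto
      then show "g \<in> {g\<in>injections k I. g ` {..<k} = X}" using g finX by (auto simp: injections_def PiE_iff)
    qed (auto simp: injections_def PiE_iff)
    have "(\<Prod>i<k. t (g i)) = (\<Prod>x\<in>X. t x)" if "g \<in> {g\<in>injections k I. g ` {..<k} = X}" for g
    proof -
      have "inj_on g {..<k}" "X = g ` {..<k}" using that by (auto simp: injections_def)
      then show ?thesis by (simp add: prod.reindex)
    qed
    then have "(\<Sum>g\<in>{g\<in>injections k I. g ` {..<k} = X}. \<Prod>i<k. t (g i)) =
        (\<Sum>g\<in>{g\<in>injections k I. g ` {..<k} = X}. \<Prod>x\<in>X. t x)"
      by (intro sum.cong refl)
    also have "\<dots> = real (card {g\<in>injections k I. g ` {..<k} = X}) * (\<Prod>x\<in>X. t x)" by simp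
    also have "card {g\<in>injections k I. g ` {..<k} = X} = prod ((-) k) {0..<k}"
      unfolding eq using finX card_inj_on_subset_funcset[of "{..<k}" X "{..<k}"] by simp
    also have "\<dots> = fact k" by (simp add: fact_prod_rev)
    finally show ?thesis by simp
  qed
  ultimately show ?thesis by (simp add: elem_sym_def sum_distrib_left)
qed

lemma card_injections:
  assumes "finite I"
  shows "real (card (injections k I)) = fact k * real (card I choose k)"
  using sum_injections[OF assms, where k = k and t = "\<lambda>_. 1"] n_subsets[OF assms, of k]
  by (simp add: elem_sym_def)

lemma elem_sym_nonneg: "(\<And>x. 0 \<le> t x) \<Longrightarrow> 0 \<le> elem_sym t I k"
  by (simp add: elem_sym_def sum_nonneg prod_nonneg)

text \<open>Dropping injectivity in the sum over tuples leaves the expanded power of the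
  sum.\<close>

lemma elem_sym_le:
  assumes fin: "finite I" and t: "\<And>x. 0 \<le> t x"
  shows "fact k * elem_sym t I k \<le> (\<Sum>x\<in>I. t x) ^ k"
proof -
  have "(\<Sum>g\<in>injections k I. \<Prod>i<k. t (g i)) \<le> (\<Sum>g\<in>{..<k} \<rightarrow>\<^sub>E I. \<Prod>i<k. t (g i))"
    using fin t by (intro sum_mono2 finite_PiE prod_nonneg) (auto simp: injections_def)
  also have "\<dots> = (\<Prod>i<k. \<Sum>x\<in>I. t x)" using fin by (intro prod_sum_PiE[symmetric]) auto
  finally show ?thesis using sum_injections[OF fin, where k = k and t = t] by simp
qed

lemma prod_one_minus_eq_sum_Pow:
  fixes t :: "'b \<Rightarrow> real"
  assumes "finite I"
  shows "(\<Prod>x\<in>I. 1 - t x) = (\<Sum>X\<in>Pow I. (-1) ^ card X * (\<Prod>x\<in>X. t x))"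
  using assms
proof (induction I rule: finite_induct)
  case (insert a I)
  let ?f = "\<lambda>X. (-1) ^ card X * (\<Prod>x\<in>X. t x)"
  have "(\<Sum>X\<in>Pow (insert a I). ?f X) = (\<Sum>X\<in>Pow I. ?f X) + (\<Sum>X\<in>insert a ` Pow I. ?f X)"
    using insert by (subst Pow_insert, subst sum.union_disjoint) auto
  also have "(\<Sum>X\<in>insert a ` Pow I. ?f X) = (\<Sum>X\<in>Pow I. ?f (insert a X))"
    using insert by (subst sum.reindex) (auto simp: inj_on_def)
  also have "\<dots> = (\<Sum>X\<in>Pow I. - t a * ?f X)"
  proof (intro sum.cong refl)
    fix X assume X: "X \<in> Pow I"
    then have "finite X" "a \<notin> X" using insert finite_subset by auto
    then show "?f (insert a X) = - t a * ?f X" by simp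
  qed
  finally show ?case using insert by (simp add: sum_distrib_left[symmetric] sum_negf algebra_simps)
qed simp

lemma elem_sym_eq_0: "finite I \<Longrightarrow> card I < k \<Longrightarrow> elem_sym t I k = 0"
proof -
  assume I: "finite I" "card I < k"
  have "card X \<noteq> k" if "X \<subseteq> I" for X using card_mono[OF I(1) that] I(2) by simp
  then show ?thesis by (auto simp: elem_sym_def intro!: sum.neutral)
qed

text \<open>Kept as an infinite series, though its terms vanish beyond \<open>card I\<close>, so
  that different index sets can be compared termwise in Tannery's theorem.\<close>

lemma suminf_elem_sym:
  assumes fin: "finite I"
  shows "(\<Sum>k. (-1) ^ k * elem_sym t I k) = (\<Prod>x\<in>I. 1 - t x)"
proof -
  have "(\<Sum>k. (-1) ^ k * elem_sym t I k) = (\<Sum>k\<le>card I. (-1) ^ k * elem_sym t I k)"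
    using fin by (intro suminf_finite) (auto simp: elem_sym_eq_0)
  also have "\<dots> = (\<Sum>k\<le>card I. \<Sum>X\<in>{X\<in>Pow I. card X = k}. (-1) ^ card X * (\<Prod>x\<in>X. t x))"
    by (auto simp: elem_sym_def sum_distrib_left intro!: sum.cong)
  also have "\<dots> = (\<Sum>X\<in>Pow I. (-1) ^ card X * (\<Prod>x\<in>X. t x))"
    using fin by (intro sum.group) (auto intro: card_mono)
  also have "\<dots> = (\<Prod>x\<in>I. 1 - t x)" using prod_one_minus_eq_sum_Pow[OF fin] by simp
  finally show ?thesis .
qed

section \<open>The void probability from factorial moments\<close>

text \<open>The binomial theorem for (1 - 1)^n. It writes the void indicator as a series of
  binomials, whose expectations are factorial moments divided by \<open>fact k\<close>.\<close>

lemma alternating_binomial_sum: "(\<Sum>k. (-1) ^ k * real (n choose k)) = of_bool (n = 0)"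
proof -
  have "(\<Sum>k. (-1) ^ k * real (n choose k)) = (\<Sum>k\<le>n. (-1) ^ k * real (n choose k))"
    by (intro suminf_finite) auto
  also have "\<dots> = (-1 + 1 :: real) ^ n"
    unfolding binomial_ring by (intro sum.cong) (auto simp: mult.commute)
  finally show ?thesis by (simp add: power_0_left)
qed

text \<open>With T the sum of \<open>t\<close>, the binomial moments are at most T^k / k!. This
  summable majorant justifies both the exchange of expectation and alternating series and the
  passage from finitely many \<open>t j\<close> to all of them.\<close>

lemma (in prob_space) void_prob_le:
  fixes X :: "'a \<Rightarrow> nat" and t :: "nat \<Rightarrow> real"
  assumes X: "X \<in> M \<rightarrow>\<^sub>M count_space UNIV"
    and t: "\<And>j. 0 \<le> t j" "\<And>j. t j \<le> 1" "summable t"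
    and mom: "\<And>k. (\<lambda>N. ennreal (elem_sym t {..<N} k)) \<longlonglongrightarrow> (\<integral>\<^sup>+\<omega>. ennreal (X \<omega> choose k) \<partial>M)"
  shows "prob {\<omega>\<in>space M. X \<omega> = 0} \<le> exp (- suminf t)"
proof -
  define T where "T = suminf t"
  have T: "0 \<le> T" using t by (simp add: T_def suminf_nonneg)
  have bnd: "elem_sym t {..<N} k \<le> T ^ k / fact k" for N k
  proof -
    have "fact k * elem_sym t {..<N} k \<le> (\<Sum>j<N. t j) ^ k" using t by (intro elem_sym_le) auto
    also have "\<dots> \<le> T ^ k"
      using t unfolding T_def by (intro power_mono sum_le_suminf sum_nonneg) auto
    finally show ?thesis by (simp add: field_simps)
  qed
  have Tsum: "summable (\<lambda>k. T ^ k / fact k)"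
    using summable_exp[of T] by (simp add: field_simps)
  have meas [measurable]: "(\<lambda>\<omega>. real (X \<omega> choose k)) \<in> borel_measurable M" for k
    using X by measurable
  have nnb: "(\<integral>\<^sup>+\<omega>. ennreal (X \<omega> choose k) \<partial>M) \<le> ennreal (T ^ k / fact k)" for k
    using mom[of k] by (rule LIMSEQ_le_const2) (auto intro!: ennreal_leI bnd)
  have int: "integrable M (\<lambda>\<omega>. real (X \<omega> choose k))" for k
    using nnb[of k] by (intro integrableI_nonneg) (auto simp: order_le_less_trans)
  define a where "a k = expectation (\<lambda>\<omega>. real (X \<omega> choose k))" for k
  have a: "0 \<le> a k" "a k \<le> T ^ k / fact k" "(\<integral>\<^sup>+\<omega>. ennreal (X \<omega> choose k) \<partial>M) = ennreal (a k)" for k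
  proof -
    show "0 \<le> a k" by (simp add: a_def)
    show eq: "(\<integral>\<^sup>+\<omega>. ennreal (X \<omega> choose k) \<partial>M) = ennreal (a k)"
      unfolding a_def using int by (intro nn_integral_eq_integral) auto
    show "a k \<le> T ^ k / fact k" using nnb[of k] T unfolding eq by (subst (asm) ennreal_le_iff) auto
  qed
  have lim: "(\<lambda>N. elem_sym t {..<N} k) \<longlonglongrightarrow> a k" for k
    using mom[of k] a t unfolding a(3) by (subst (asm) tendsto_ennreal_iff) (auto intro!: always_eventually elem_sym_nonneg)
  have "prob {\<omega>\<in>space M. X \<omega> = 0} = expectation (\<lambda>\<omega>. \<Sum>k. (-1) ^ k * real (X \<omega> choose k))"
  proof -
    have "(\<lambda>\<omega>. \<Sum>k. (-1) ^ k * real (X \<omega> choose k)) = (\<lambda>\<omega>. of_bool (X \<omega> = 0))"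
      by (simp add: alternating_binomial_sum)
    moreover have "expectation (\<lambda>\<omega>. of_bool (X \<omega> = 0)) = expectation (indicat_real {\<omega>\<in>space M. X \<omega> = 0})"
      by (intro Bochner_Integration.integral_cong) (auto simp: indicator_def)
    moreover have "{\<omega>\<in>space M. X \<omega> = 0} \<in> events" using X by measurable
    then have "prob {\<omega>\<in>space M. X \<omega> = 0} = expectation (indicat_real {\<omega>\<in>space M. X \<omega> = 0})" by simp
    ultimately show ?thesis by (simp only:)
  qed
  also have "\<dots> = (\<Sum>k. expectation (\<lambda>\<omega>. (-1) ^ k * real (X \<omega> choose k)))"
  proof (rule integral_suminf)
    show "integrable M (\<lambda>\<omega>. (-1) ^ k * real (X \<omega> choose k))" for k using int by simp
    have "summable (\<lambda>k. real (n choose k))" for n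
      by (rule summable_finite[of "{..n}"]) auto
    then show "AE \<omega> in M. summable (\<lambda>k. norm ((-1) ^ k * real (X \<omega> choose k)))"
      by (simp add: abs_mult power_abs)
    show "summable (\<lambda>k. expectation (\<lambda>\<omega>. norm ((-1) ^ k * real (X \<omega> choose k))))"
      using a Tsum by (intro summable_comparison_test[OF _ Tsum]) (auto simp: abs_mult power_abs a_def)
  qed
  also have "\<dots> = (\<Sum>k. (-1) ^ k * a k)" by (simp add: a_def)
  also have "\<dots> \<le> exp (- T)"
  proof (rule LIMSEQ_le)
    show "(\<lambda>N. \<Sum>k. (-1) ^ k * elem_sym t {..<N} k) \<longlonglongrightarrow> (\<Sum>k. (-1) ^ k * a k)"
      by (intro tannerys_theorem[THEN conjunct2, THEN conjunct2, OF _ _ Tsum])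
        (auto intro!: tendsto_intros lim always_eventually bnd elem_sym_nonneg t
          simp: abs_mult power_abs abs_of_nonneg[OF elem_sym_nonneg[OF t(1)]])
    show "(\<lambda>N. exp (- (\<Sum>j<N. t j))) \<longlonglongrightarrow> exp (- T)"
      unfolding T_def by (intro tendsto_intros summable_LIMSEQ t)
    have "(\<Sum>k. (-1) ^ k * elem_sym t {..<N} k) \<le> exp (- (\<Sum>j<N. t j))" for N
    proof -
      have "(\<Sum>k. (-1) ^ k * elem_sym t {..<N} k) = (\<Prod>j<N. 1 - t j)" by (rule suminf_elem_sym) simp
      \<comment> \<open>Factorwise comparison needs nonnegative factors, which is where the bound 1
        on the eigenvalues enters.\<close>
      also have "\<dots> \<le> (\<Prod>j<N. exp (- t j))"
        using t exp_ge_add_one_self[of "- t _"] by (intro prod_mono) (auto simp: algebra_simps)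
      also have "\<dots> = exp (- (\<Sum>j<N. t j))" by (simp add: exp_sum sum_negf[symmetric])
      finally show ?thesis .
    qed
    then show "\<exists>N. \<forall>n\<ge>N. (\<Sum>k. (-1) ^ k * elem_sym t {..<n} k) \<le> exp (- (\<Sum>j<n. t j))" by blast
  qed
  finally show ?thesis by (simp add: T_def)
qed

section \<open>Determinants of kernels\<close>

lemma borel_measurable_cnj [measurable (raw)]:
  "f \<in> borel_measurable M \<Longrightarrow> (\<lambda>x. cnj (f x)) \<in> borel_measurable M"
  by (rule measurable_compose[OF _ borel_measurable_continuous_onI]) (auto intro: continuous_intros)

lemma borel_measurable_det_mat:
  fixes A :: "'b \<Rightarrow> nat \<Rightarrow> nat \<Rightarrow> complex"
  assumes "\<And>i j. i < k \<Longrightarrow> j < k \<Longrightarrow> (\<lambda>x. A x i j) \<in> borel_measurable M"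
  shows "(\<lambda>x. Determinant.det (Matrix.mat k k (\<lambda>(i, j). A x i j))) \<in> borel_measurable M"
proof -
  have "(\<lambda>x. \<Sum>p | p permutes {0..<k}. of_int (sign p) * (\<Prod>i = 0..<k. A x i (p i))) \<in> borel_measurable M"
    by (intro borel_measurable_sum borel_measurable_times borel_measurable_const borel_measurable_prod assms)
      (auto simp: permutes_in_image)
  also have "(\<lambda>x. \<Sum>p | p permutes {0..<k}. of_int (sign p) * (\<Prod>i = 0..<k. A x i (p i))) =
      (\<lambda>x. Determinant.det (Matrix.mat k k (\<lambda>(i, j). A x i j)))"
    by (auto simp: det_def permutes_in_image intro!: ext sum.cong prod.cong)
  finally show ?thesis .
qed

lemma tendsto_det_mat:
  fixes A :: "'b \<Rightarrow> nat \<Rightarrow> nat \<Rightarrow> complex"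
  assumes "\<And>i j. i < k \<Longrightarrow> j < k \<Longrightarrow> ((\<lambda>x. A x i j) \<longlongrightarrow> B i j) F"
  shows "((\<lambda>x. Determinant.det (Matrix.mat k k (\<lambda>(i, j). A x i j))) \<longlongrightarrow>
    Determinant.det (Matrix.mat k k (\<lambda>(i, j). B i j))) F"
proof -
  have eq: "Determinant.det (Matrix.mat k k (\<lambda>(i, j). C i j)) =
      (\<Sum>p | p permutes {0..<k}. of_int (sign p) * (\<Prod>i = 0..<k. C i (p i)))" for C :: "nat \<Rightarrow> nat \<Rightarrow> complex"
    by (auto simp: det_def permutes_in_image intro!: sum.cong prod.cong)
  show ?thesis unfolding eq
    by (intro tendsto_sum tendsto_mult tendsto_const tendsto_prod assms) (auto simp: permutes_in_image)
qed

text \<open>The identity matrix for injective \<open>g\<close>, two equal rows otherwise. This is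
  how antisymmetry removes repeated indices when determinants are integrated.\<close>

lemma det_coincidence_matrix:
  "Determinant.det (Matrix.mat k k (\<lambda>(i, j). if g i = g j then 1 else 0 :: complex)) =
    of_bool (inj_on g {..<k})"
proof (cases "inj_on g {..<k}")
  case True
  then have "Matrix.mat k k (\<lambda>(i, j). if g i = g j then 1 else 0 :: complex) = 1\<^sub>m k"
    by (intro eq_matI) (auto simp: inj_on_def)
  then show ?thesis using True by simp
next
  case False
  then obtain i j where ij: "i < k" "j < k" "i \<noteq> j" "g i = g j" by (auto simp: inj_on_def)
  have "Determinant.det (Matrix.mat k k (\<lambda>(i, j). if g i = g j then 1 else 0 :: complex)) = 0"
    using ij by (intro Determinant.det_identical_rows[of _ k i j]) auto
  then show ?thesis using False by simp
qed

section \<open>Kernels expanded in orthogonal functions\<close>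

text \<open>Models eigenfunctions multiplied by the square roots of their eigenvalues. Absorbing the
  eigenvalue turns truncated kernels into Gram matrices, and \<open>t j\<close> becomes the squared
  norm of \<open>h j\<close>; zero functions are allowed.\<close>

locale orthogonal_system = sigma_finite_measure \<mu> for \<mu> :: "'a measure" +
  fixes h :: "nat \<Rightarrow> 'a \<Rightarrow> complex" and t :: "nat \<Rightarrow> real"
  assumes h_measurable [measurable]: "h j \<in> borel_measurable \<mu>"
    and h_square_integrable: "integrable \<mu> (\<lambda>x. (cmod (h j x))\<^sup>2)"
    and h_orthogonal: "(\<integral>x. h i x * cnj (h j x) \<partial>\<mu>) = (if i = j then complex_of_real (t j) else 0)"
    and t_nonneg: "0 \<le> t j" and t_summable: "summable t"
begin

text \<open>The kernel on the diagonal, valued in \<open>ennreal\<close> because the series may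
  diverge on a null set.\<close>

definition diag_density :: "'a \<Rightarrow> ennreal" where
  "diag_density x = (\<Sum>j. ennreal ((cmod (h j x))\<^sup>2))"

definition kernel :: "'a \<Rightarrow> 'a \<Rightarrow> complex" where
  "kernel x y = (\<Sum>j. h j x * cnj (h j y))"

definition trunc_det :: "nat \<Rightarrow> nat \<Rightarrow> (nat \<Rightarrow> 'a) \<Rightarrow> complex" where
  "trunc_det N k x = Determinant.det (Matrix.mat k k (\<lambda>(i, j). gram {..<N} (\<lambda>i m. h m (x i)) i j))"

definition kernel_det :: "nat \<Rightarrow> (nat \<Rightarrow> 'a) \<Rightarrow> complex" where
  "kernel_det k x = Determinant.det (Matrix.mat k k (\<lambda>(i, j). kernel (x i) (x j)))"

abbreviation power_measure :: "nat \<Rightarrow> (nat \<Rightarrow> 'a) measure" where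
  "power_measure k \<equiv> PiM {..<k} (\<lambda>_. \<mu>)"

sublocale product: product_sigma_finite "\<lambda>_ :: nat. \<mu>"
  by unfold_locales

lemma integrable_h_prod: "integrable \<mu> (\<lambda>x. h i x * cnj (h j x))"
proof (rule Bochner_Integration.integrable_bound)
  show "integrable \<mu> (\<lambda>x. (cmod (h i x))\<^sup>2 + (cmod (h j x))\<^sup>2)"
    by (intro Bochner_Integration.integrable_add h_square_integrable)
  have "a * b \<le> a\<^sup>2 + b\<^sup>2" if "0 \<le> a" "0 \<le> b" for a b :: real
    using sum_squares_bound[of a b] that mult_nonneg_nonneg[OF that] by linarith
  then show "AE x in \<mu>. cmod (h i x * cnj (h j x)) \<le> norm ((cmod (h i x))\<^sup>2 + (cmod (h j x))\<^sup>2)"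
    by (simp add: norm_mult)
qed measurable

lemma nn_integral_h: "(\<integral>\<^sup>+x. ennreal ((cmod (h j x))\<^sup>2) \<partial>\<mu>) = ennreal (t j)"
proof -
  have "complex_of_real (t j) = (\<integral>x. complex_of_real ((cmod (h j x))\<^sup>2) \<partial>\<mu>)"
    using h_orthogonal[of j j] by (simp only: complex_norm_square if_True refl)
  also have "\<dots> = complex_of_real (\<integral>x. (cmod (h j x))\<^sup>2 \<partial>\<mu>)" by (rule integral_complex_of_real)
  finally have "t j = (\<integral>x. (cmod (h j x))\<^sup>2 \<partial>\<mu>)" by (simp only: of_real_eq_iff)
  then show ?thesis using h_square_integrable[of j] by (simp add: nn_integral_eq_integral)
qed

lemma diag_density_measurable [measurable]: "diag_density \<in> borel_measurable \<mu>"
  unfolding diag_density_def[abs_def] by measurable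

lemma nn_integral_diag_density: "(\<integral>\<^sup>+x. diag_density x \<partial>\<mu>) = ennreal (suminf t)"
  unfolding diag_density_def using t_nonneg t_summable
  by (subst nn_integral_suminf) (auto simp: nn_integral_h intro: suminf_ennreal2)

lemma AE_density_finite: "AE x in \<mu>. diag_density x < \<infinity>"
  using nn_integral_PInf_AE[of diag_density \<mu>] by (auto simp: nn_integral_diag_density less_top)

text \<open>A null set in one coordinate gives a cylinder whose measure is a product with a factor
  0.\<close>

lemma AE_power_measure_component:
  assumes P: "AE x in \<mu>. P x"
  shows "AE x in power_measure k. \<forall>i<k. P (x i)"
proof -
  have "AE x in power_measure k. P (x i)" if i: "i < k" for i
  proof -
    from P obtain N where N: "{x \<in> space \<mu>. \<not> P x} \<subseteq> N" "emeasure \<mu> N = 0" "N \<in> sets \<mu>"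
      by (rule AE_E)
    let ?N = "\<Pi>\<^sub>E l\<in>{..<k}. if l = i then N else space \<mu>"
    have "emeasure (power_measure k) ?N = (\<Prod>l<k. emeasure \<mu> (if l = i then N else space \<mu>))"
      using N by (intro product.emeasure_PiM) auto
    also have "\<dots> = 0" using i N by (intro prod_zero) auto
    finally have "?N \<in> null_sets (power_measure k)" using N by (intro null_setsI) (auto intro!: sets_PiM_I_finite)
    moreover have "{x \<in> space (power_measure k). \<not> P (x i)} \<subseteq> ?N"
    proof
      fix x assume "x \<in> {x \<in> space (power_measure k). \<not> P (x i)}"
      then have x: "x \<in> {..<k} \<rightarrow>\<^sub>E space \<mu>" "\<not> P (x i)" by (simp_all add: space_PiM)
      then have "x i \<in> N" using N(1) i by (auto simp: PiE_iff)
      then show "x \<in> ?N" using x(1) by (simp add: PiE_iff)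
    qed
    ultimately show ?thesis by (rule AE_I')
  qed
  then show ?thesis by (auto simp: AE_all_countable)
qed

lemma component_measurable [measurable]: "i < k \<Longrightarrow> (\<lambda>x. x i) \<in> power_measure k \<rightarrow>\<^sub>M \<mu>"
  by (rule measurable_component_singleton) simp

lemma trunc_det_measurable [measurable]: "trunc_det N k \<in> borel_measurable (power_measure k)"
  unfolding trunc_det_def
proof (rule borel_measurable_det_mat)
  fix i j assume "i < k" "j < k"
  then show "(\<lambda>x. gram {..<N} (\<lambda>i m. h m (x i)) i j) \<in> borel_measurable (power_measure k)"
    unfolding gram_def
    by (intro borel_measurable_sum borel_measurable_times borel_measurable_cnj component_measurable
        measurable_compose[OF component_measurable h_measurable])
qed

lemma kernel_det_measurable [measurable]: "kernel_det k \<in> borel_measurable (power_measure k)"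
  unfolding kernel_det_def
proof (rule borel_measurable_det_mat)
  fix i j assume "i < k" "j < k"
  then show "(\<lambda>x. kernel (x i) (x j)) \<in> borel_measurable (power_measure k)"
    unfolding kernel_def
    by (intro borel_measurable_suminf borel_measurable_times borel_measurable_cnj component_measurable
        measurable_compose[OF component_measurable h_measurable])
qed

text \<open>The Leibniz formula multiplied out. The conjugated factors are reindexed by the inverse
  permutation so that each factor depends on a single variable and the integral splits into a
  product.\<close>

lemma trunc_det_expand:
  "trunc_det N k x = (\<Sum>p | p permutes {..<k}. of_int (sign p) *
    (\<Sum>g\<in>{..<k} \<rightarrow>\<^sub>E {..<N}. \<Prod>i<k. h (g i) (x i) * cnj (h (g (inv_into UNIV p i)) (x i))))"
proof -
  let ?K = "\<lambda>i j. gram {..<N} (\<lambda>i m. h m (x i)) i j"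
  have "trunc_det N k x = (\<Sum>p | p permutes {..<k}. of_int (sign p) * (\<Prod>i<k. ?K i (p i)))"
    by (auto simp: trunc_det_def det_def permutes_in_image lessThan_atLeast0[symmetric] intro!: sum.cong prod.cong)
  also have "\<dots> = (\<Sum>p | p permutes {..<k}. of_int (sign p) *
    (\<Sum>g\<in>{..<k} \<rightarrow>\<^sub>E {..<N}. \<Prod>i<k. h (g i) (x i) * cnj (h (g (inv_into UNIV p i)) (x i))))"
  proof (intro sum.cong refl arg_cong2[where f = "(*)"])
    fix p assume "p \<in> {p. p permutes {..<k}}"
    then have p: "p permutes {..<k}" by simp
    have "(\<Prod>i<k. ?K i (p i)) = (\<Sum>g\<in>{..<k} \<rightarrow>\<^sub>E {..<N}. \<Prod>i<k. h (g i) (x i) * cnj (h (g i) (x (p i))))"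
      unfolding gram_def by (rule prod_sum_PiE) auto
    also have "\<dots> = (\<Sum>g\<in>{..<k} \<rightarrow>\<^sub>E {..<N}. \<Prod>i<k. h (g i) (x i) * cnj (h (g (inv_into UNIV p i)) (x i)))"
    proof (intro sum.cong refl)
      fix g
      have "(\<Prod>i<k. cnj (h (g (inv_into UNIV p i)) (x i))) = (\<Prod>i<k. cnj (h (g (inv_into UNIV p (p i))) (x (p i))))"
        by (rule prod.permute[OF p, unfolded o_def])
      then show "(\<Prod>i<k. h (g i) (x i) * cnj (h (g i) (x (p i)))) =
          (\<Prod>i<k. h (g i) (x i) * cnj (h (g (inv_into UNIV p i)) (x i)))"
        by (simp add: prod.distrib permutes_inverses(2)[OF p])
    qed
    finally show "(\<Prod>i<k. ?K i (p i)) =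
      (\<Sum>g\<in>{..<k} \<rightarrow>\<^sub>E {..<N}. \<Prod>i<k. h (g i) (x i) * cnj (h (g (inv_into UNIV p i)) (x i)))" .
  qed
  finally show ?thesis .
qed

lemma integrable_trunc_det_term:
  "integrable (power_measure k) (\<lambda>x. \<Prod>i<k. h (g i) (x i) * cnj (h (g' i) (x i)))"
  using product.product_integrable_prod[of "{..<k}" "\<lambda>i y. h (g i) y * cnj (h (g' i) y)"] integrable_h_prod
  by auto

lemma integrable_trunc_det: "integrable (power_measure k) (trunc_det N k)"
  unfolding trunc_det_expand[abs_def]
  by (intro Bochner_Integration.integrable_sum integrable_mult_right integrable_trunc_det_term)

text \<open>By orthogonality a term survives only if \<open>g\<close> is invariant under the
  permutation. Summing the signs of such permutations gives the determinant of a coincidence matrix,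
  which discards the \<open>g\<close> that are not injective.\<close>

lemma integral_trunc_det:
  "(\<integral>x. trunc_det N k x \<partial>power_measure k) = complex_of_real (fact k * elem_sym t {..<N} k)"
proof -
  let ?G = "{..<k} \<rightarrow>\<^sub>E {..<N}" and ?P = "{p. p permutes {..<k}}"
  have moment: "(\<integral>x. (\<Prod>i<k. h (g i) (x i) * cnj (h (g' i) (x i))) \<partial>power_measure k) =
      (\<Prod>i<k. complex_of_real (t (g i))) * (\<Prod>i<k. if g i = g' i then 1 else 0)" for g g'
  proof -
    have "(\<integral>x. (\<Prod>i<k. h (g i) (x i) * cnj (h (g' i) (x i))) \<partial>power_measure k) =
        (\<Prod>i<k. \<integral>y. h (g i) y * cnj (h (g' i) y) \<partial>\<mu>)"
      using product.product_integral_prod[of "{..<k}" "\<lambda>i y. h (g i) y * cnj (h (g' i) y)"] integrable_h_prod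
      by auto
    also have "\<dots> = (\<Prod>i<k. complex_of_real (t (g i)) * (if g i = g' i then 1 else 0))"
      by (intro prod.cong refl) (simp add: h_orthogonal)
    finally show ?thesis by (simp only: prod.distrib)
  qed
  have "(\<integral>x. trunc_det N k x \<partial>power_measure k) =
      (\<Sum>p\<in>?P. of_int (sign p) * (\<Sum>g\<in>?G. (\<Prod>i<k. complex_of_real (t (g i))) * (\<Prod>i<k. if g i = g (inv_into UNIV p i) then 1 else 0)))"
    unfolding trunc_det_expand
    by (subst Bochner_Integration.integral_sum | subst integral_mult_right_zero | intro integrable_mult_right
        Bochner_Integration.integrable_sum integrable_trunc_det_term sum.cong refl arg_cong2[where f = "(*)"] moment)+
  \<comment> \<open>Inversion permutes the permutations and preserves signs; it restores the shape
    of a Leibniz formula.\<close>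
  also have "\<dots> = (\<Sum>p\<in>?P. of_int (sign p) * (\<Sum>g\<in>?G. (\<Prod>i<k. complex_of_real (t (g i))) * (\<Prod>i<k. if g i = g (p i) then 1 else 0)))"
  proof (subst sum_permutations_inverse, intro sum.cong refl)
    fix p assume "p \<in> ?P"
    then have p: "p permutes {..<k}" by simp
    then have "permutation p" unfolding permutation_permutes by blast
    then show "of_int (sign (inv_into UNIV p)) * (\<Sum>g\<in>?G. (\<Prod>i<k. complex_of_real (t (g i))) * (\<Prod>i<k. if g i = g (inv_into UNIV (inv_into UNIV p) i) then 1 else 0)) =
      of_int (sign p) * (\<Sum>g\<in>?G. (\<Prod>i<k. complex_of_real (t (g i))) * (\<Prod>i<k. if g i = g (p i) then 1 else 0))"
      by (simp only: permutes_inv_inv[OF p] sign_inverse)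
  qed
  also have "\<dots> = (\<Sum>g\<in>?G. (\<Prod>i<k. complex_of_real (t (g i))) *
      (\<Sum>p\<in>?P. of_int (sign p) * (\<Prod>i<k. if g i = g (p i) then 1 else 0)))"
    by (simp add: sum_distrib_left sum.swap[of _ ?P] ac_simps)
  also have "\<dots> = (\<Sum>g\<in>?G. (\<Prod>i<k. complex_of_real (t (g i))) * of_bool (inj_on g {..<k}))"
  proof (intro sum.cong refl arg_cong2[where f = "(*)"])
    fix g
    have "(\<Sum>p\<in>?P. of_int (sign p) * (\<Prod>i<k. if g i = g (p i) then 1 else 0 :: complex)) =
        Determinant.det (Matrix.mat k k (\<lambda>(i, j). if g i = g j then 1 else 0 :: complex))"
      by (auto simp: det_def permutes_in_image lessThan_atLeast0[symmetric] intro!: sum.cong prod.cong)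
    then show "(\<Sum>p\<in>?P. of_int (sign p) * (\<Prod>i<k. if g i = g (p i) then 1 else 0)) = (of_bool (inj_on g {..<k}) :: complex)"
      by (simp add: det_coincidence_matrix)
  qed
  also have "\<dots> = (\<Sum>g\<in>injections k {..<N}. \<Prod>i<k. complex_of_real (t (g i)))"
    unfolding injections_def by (intro sum.mono_neutral_cong_right finite_PiE) auto
  also have "\<dots> = complex_of_real (\<Sum>g\<in>injections k {..<N}. \<Prod>i<k. t (g i))" by simp
  finally show ?thesis by (simp only: sum_injections[OF finite_lessThan])
qed

lemma trunc_det_bounds:
  obtains s where "0 \<le> s" "trunc_det N k x = complex_of_real s" "s \<le> (\<Prod>i<k. \<Sum>m<N. (cmod (h m (x i)))\<^sup>2)"
  using gram_det_bounds[of "{..<N}" k "\<lambda>i m. h m (x i)"] unfolding trunc_det_def by auto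

lemma Re_trunc_det_nonneg: "0 \<le> Re (trunc_det N k x)"
  using trunc_det_bounds[of N k x] by (metis Re_complex_of_real)

text \<open>Hadamard's bound with partial sums enlarged to the full series, hence a majorant
  independent of \<open>N\<close>.\<close>

lemma trunc_det_le_density: "ennreal (Re (trunc_det N k x)) \<le> (\<Prod>i<k. diag_density (x i))"
proof -
  obtain s where s: "0 \<le> s" "trunc_det N k x = complex_of_real s" "s \<le> (\<Prod>i<k. \<Sum>m<N. (cmod (h m (x i)))\<^sup>2)"
    by (rule trunc_det_bounds)
  have "ennreal (Re (trunc_det N k x)) \<le> ennreal (\<Prod>i<k. \<Sum>m<N. (cmod (h m (x i)))\<^sup>2)"
    using s by (intro ennreal_leI) simp
  also have "\<dots> = (\<Prod>i<k. ennreal (\<Sum>m<N. (cmod (h m (x i)))\<^sup>2))"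
    by (intro prod_ennreal[symmetric] sum_nonneg) auto
  also have "\<dots> \<le> (\<Prod>i<k. diag_density (x i))"
  proof (rule prod_mono_ennreal)
    fix i
    have "ennreal (\<Sum>m<N. (cmod (h m (x i)))\<^sup>2) = (\<Sum>m<N. ennreal ((cmod (h m (x i)))\<^sup>2))"
      by (rule sum_ennreal[symmetric]) simp
    also have "\<dots> \<le> diag_density (x i)"
      unfolding diag_density_def by (rule sum_le_suminf) auto
    finally show "ennreal (\<Sum>m<N. (cmod (h m (x i)))\<^sup>2) \<le> diag_density (x i)" .
  qed
  finally show ?thesis .
qed

lemma nn_integral_trunc_det:
  "(\<integral>\<^sup>+x. ennreal (Re (trunc_det N k x)) \<partial>power_measure k) = ennreal (fact k * elem_sym t {..<N} k)"
proof -
  have "(\<integral>\<^sup>+x. ennreal (Re (trunc_det N k x)) \<partial>power_measure k) =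
      ennreal (\<integral>x. Re (trunc_det N k x) \<partial>power_measure k)"
    by (intro nn_integral_eq_integral integrable_Re integrable_trunc_det) (simp add: Re_trunc_det_nonneg)
  also have "(\<integral>x. Re (trunc_det N k x) \<partial>power_measure k) = Re (\<integral>x. trunc_det N k x \<partial>power_measure k)"
    by (rule integral_Re[OF integrable_trunc_det])
  finally show ?thesis by (simp add: integral_trunc_det)
qed

lemma diag_density_finite_summable:
  assumes "diag_density x < \<infinity>"
  shows "summable (\<lambda>m. (cmod (h m x))\<^sup>2)"
  using assms unfolding diag_density_def by (intro summable_suminf_not_top) (auto simp: less_top)

lemma summable_kernel:
  assumes "diag_density x < \<infinity>" "diag_density y < \<infinity>"
  shows "summable (\<lambda>m. norm (h m x * cnj (h m y)))"
proof (rule summable_comparison_test)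
  show "summable (\<lambda>m. (cmod (h m x))\<^sup>2 + (cmod (h m y))\<^sup>2)"
    using assms by (intro summable_add diag_density_finite_summable)
  have "a * b \<le> a\<^sup>2 + b\<^sup>2" if "0 \<le> a" "0 \<le> b" for a b :: real
    using sum_squares_bound[of a b] that mult_nonneg_nonneg[OF that] by linarith
  then show "\<exists>N. \<forall>n\<ge>N. norm (norm (h n x * cnj (h n y))) \<le> (cmod (h n x))\<^sup>2 + (cmod (h n y))\<^sup>2"
    by (simp add: norm_mult)
qed

lemma AE_trunc_det_tendsto:
  "AE x in power_measure k. (\<lambda>N. ennreal (Re (trunc_det N k x))) \<longlonglongrightarrow> ennreal (Re (kernel_det k x))"
  using AE_power_measure_component[OF AE_density_finite, of k]
proof eventually_elim
  case (elim x)
  have "(\<lambda>N. trunc_det N k x) \<longlonglongrightarrow> kernel_det k x"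
    unfolding trunc_det_def kernel_det_def
  proof (rule tendsto_det_mat)
    fix i j assume "i < k" "j < k"
    then have "summable (\<lambda>m. h m (x i) * cnj (h m (x j)))"
      using elim by (intro summable_norm_cancel[OF summable_kernel]) auto
    then show "(\<lambda>N. gram {..<N} (\<lambda>i m. h m (x i)) i j) \<longlonglongrightarrow> kernel (x i) (x j)"
      unfolding gram_def kernel_def by (rule summable_LIMSEQ)
  qed
  then show ?case by (intro tendsto_ennrealI tendsto_Re)
qed

lemma nn_integral_prod_density:
  assumes "\<And>i. i < k \<Longrightarrow> B i \<in> sets \<mu>"
  shows "(\<integral>\<^sup>+x\<in>(\<Pi>\<^sub>E i\<in>{..<k}. B i). (\<Prod>i<k. diag_density (x i)) \<partial>power_measure k) = (\<Prod>i<k. \<integral>\<^sup>+y\<in>B i. diag_density y \<partial>\<mu>)"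
proof -
  have "(\<integral>\<^sup>+x\<in>(\<Pi>\<^sub>E i\<in>{..<k}. B i). (\<Prod>i<k. diag_density (x i)) \<partial>power_measure k) =
      (\<integral>\<^sup>+x. (\<Prod>i<k. diag_density (x i) * indicator (B i) (x i)) \<partial>power_measure k)"
  proof (rule nn_integral_cong)
    fix x assume x: "x \<in> space (power_measure k)"
    have "indicator (\<Pi>\<^sub>E i\<in>{..<k}. B i) x = (\<Prod>i<k. indicator (B i) (x i) :: ennreal)"
    proof (cases "x \<in> (\<Pi>\<^sub>E i\<in>{..<k}. B i)")
      case True
      then have "indicator (B i) (x i) = (1 :: ennreal)" if "i \<in> {..<k}" for i
        using that by (auto simp: PiE_iff)
      then show ?thesis using True by simp
    next
      case False
      then obtain i where "i < k" "x i \<notin> B i" using x by (auto simp: space_PiM PiE_iff)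
      then have "(\<Prod>i<k. indicator (B i) (x i) :: ennreal) = 0"
        by (intro prod_zero) (auto intro!: bexI[of _ i])
      then show ?thesis using False by simp
    qed
    then show "(\<Prod>i<k. diag_density (x i)) * indicator (\<Pi>\<^sub>E i\<in>{..<k}. B i) x =
        (\<Prod>i<k. diag_density (x i) * indicator (B i) (x i))"
      by (simp add: prod.distrib)
  qed
  also have "\<dots> = (\<Prod>i<k. \<integral>\<^sup>+y\<in>B i. diag_density y \<partial>\<mu>)"
    using assms by (intro product.product_nn_integral_prod) auto
  finally show ?thesis .
qed

lemma nn_integral_trunc_det_tendsto:
  assumes [measurable]: "A \<in> sets (power_measure k)"
  shows "(\<lambda>N. \<integral>\<^sup>+x\<in>A. ennreal (Re (trunc_det N k x)) \<partial>power_measure k)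
    \<longlonglongrightarrow> (\<integral>\<^sup>+x\<in>A. ennreal (Re (kernel_det k x)) \<partial>power_measure k)"
proof (rule nn_integral_dominated_convergence[where w = "\<lambda>x. \<Prod>i<k. diag_density (x i)"])
  show "(\<lambda>x. \<Prod>i<k. diag_density (x i)) \<in> borel_measurable (power_measure k)" by measurable
  show "AE x in power_measure k. ennreal (Re (trunc_det N k x)) * indicator A x \<le> (\<Prod>i<k. diag_density (x i))" for N
    using trunc_det_le_density[of N k] by (auto simp: indicator_def)
  have "(\<integral>\<^sup>+x. (\<Prod>i<k. diag_density (x i)) \<partial>power_measure k) = (\<Prod>i<k. \<integral>\<^sup>+y. diag_density y \<partial>\<mu>)"
    by (intro product.product_nn_integral_prod) auto
  \<comment> \<open>The integral of the majorant is the \<open>k\<close>-th power of the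
    trace.\<close>
  also have "\<dots> < \<infinity>"
    by (simp add: nn_integral_diag_density ennreal_power suminf_nonneg t_nonneg t_summable)
  finally show "(\<integral>\<^sup>+x. (\<Prod>i<k. diag_density (x i)) \<partial>power_measure k) < \<infinity>" .
  show "AE x in power_measure k. (\<lambda>N. ennreal (Re (trunc_det N k x)) * indicator A x)
      \<longlonglongrightarrow> ennreal (Re (kernel_det k x)) * indicator A x"
    using AE_trunc_det_tendsto[of k] by eventually_elim (auto simp: indicator_def)
qed measurable

lemma nn_integral_kernel_det_le:
  assumes "\<And>i. i < k \<Longrightarrow> B i \<in> sets \<mu>"
  shows "(\<integral>\<^sup>+x\<in>(\<Pi>\<^sub>E i\<in>{..<k}. B i). ennreal (Re (kernel_det k x)) \<partial>power_measure k) \<le> (\<Prod>i<k. \<integral>\<^sup>+y\<in>B i. diag_density y \<partial>\<mu>)"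
proof -
  have "AE x in power_measure k. ennreal (Re (kernel_det k x)) \<le> (\<Prod>i<k. diag_density (x i))"
    using AE_trunc_det_tendsto[of k]
    by eventually_elim (rule LIMSEQ_le_const2, assumption, simp add: trunc_det_le_density)
  then have "(\<integral>\<^sup>+x\<in>(\<Pi>\<^sub>E i\<in>{..<k}. B i). ennreal (Re (kernel_det k x)) \<partial>power_measure k) \<le>
      (\<integral>\<^sup>+x\<in>(\<Pi>\<^sub>E i\<in>{..<k}. B i). (\<Prod>i<k. diag_density (x i)) \<partial>power_measure k)"
    by (intro nn_integral_mono_AE) (auto simp: indicator_def)
  then show ?thesis by (simp only: nn_integral_prod_density[OF assms])
qed

text \<open>For one point Hadamard's bound is an equality, which later identifies the integrated
  diagonal with the mean measure.\<close>

lemma nn_integral_kernel_det_1: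
  assumes "B \<in> sets \<mu>"
  shows "(\<integral>\<^sup>+x\<in>(\<Pi>\<^sub>E i\<in>{..<1}. B). ennreal (Re (kernel_det 1 x)) \<partial>power_measure 1) = (\<integral>\<^sup>+y\<in>B. diag_density y \<partial>\<mu>)"
proof -
  have "AE x in power_measure 1. ennreal (Re (kernel_det 1 x)) = (\<Prod>i<1. diag_density (x i))"
    using AE_power_measure_component[OF AE_density_finite, of 1]
  proof eventually_elim
    case (elim x)
    then have fin: "diag_density (x 0) < \<infinity>" by simp
    have "kernel_det 1 x = kernel (x 0) (x 0)"
      unfolding kernel_det_def by (subst det_single) auto
    also have "\<dots> = complex_of_real (\<Sum>m. (cmod (h m (x 0)))\<^sup>2)"
      unfolding kernel_def complex_norm_square[symmetric]
      by (rule suminf_of_real[symmetric, OF diag_density_finite_summable[OF fin]])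
    finally have "ennreal (Re (kernel_det 1 x)) = ennreal (\<Sum>m. (cmod (h m (x 0)))\<^sup>2)" by simp
    also have "\<dots> = diag_density (x 0)"
      unfolding diag_density_def using diag_density_finite_summable[OF fin] by (intro suminf_ennreal2[symmetric]) auto
    finally show ?case by simp
  qed
  then have "(\<integral>\<^sup>+x\<in>(\<Pi>\<^sub>E i\<in>{..<1}. B). ennreal (Re (kernel_det 1 x)) \<partial>power_measure 1) =
      (\<integral>\<^sup>+x\<in>(\<Pi>\<^sub>E i\<in>{..<1}. B). (\<Prod>i<1. diag_density (x i)) \<partial>power_measure 1)"
    by (intro nn_integral_cong_AE) auto
  also have "\<dots> = (\<integral>\<^sup>+y\<in>B. diag_density y \<partial>\<mu>)"
    using nn_integral_prod_density[of 1 "\<lambda>_. B"] assms by simp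
  finally show ?thesis .
qed

end

section \<open>Determinantal processes\<close>

lemma radon_sets: "radon_measure \<mu> \<Longrightarrow> sets \<mu> = sets borel"
  by (simp add: radon_measure_def)

lemma radon_space: "radon_measure \<mu> \<Longrightarrow> space \<mu> = UNIV"
  using sets_eq_imp_space_eq[OF radon_sets] by simp

lemma radon_sigma_finite:
  assumes "radon_measure \<mu>"
  shows "sigma_finite_measure \<mu>"
proof
  have "(\<Union>n::nat. cball 0 (real n)) = (UNIV :: 'a set)"
    using real_arch_simple by (auto simp: set_eq_iff)
  moreover have "range (\<lambda>n::nat. cball 0 (real n)) \<subseteq> sets \<mu>"
    by (auto simp: radon_sets[OF assms])
  moreover have "emeasure \<mu> (cball 0 (real n)) \<noteq> \<infinity>" for n :: nat
    using assms by (simp add: radon_measure_def less_top[symmetric])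
  ultimately show "\<exists>A. countable A \<and> A \<subseteq> sets \<mu> \<and> \<Union> A = space \<mu> \<and> (\<forall>a\<in>A. emeasure \<mu> a \<noteq> \<infinity>)"
    unfolding radon_space[OF assms]
    by (intro exI[of _ "range (\<lambda>n::nat. cball 0 (real n))"]) blast
qed

text \<open>The eigenvalue equation holds only almost everywhere, and substituting it under the
  integral by \<open>integral_cong_AE\<close> requires measurable integrands.\<close>

lemma integral_operator_measurable:
  assumes \<mu>: "radon_measure \<mu>" and D: "compact D"
    and K: "(\<lambda>(x, y). K x y) \<in> borel_measurable (\<mu> \<Otimes>\<^sub>M \<mu>)"
    and f [measurable]: "f \<in> borel_measurable (restrict_space \<mu> D)"
  shows "integral_operator (restrict_space \<mu> D) K f \<in> borel_measurable (restrict_space \<mu> D)"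
proof -
  let ?\<nu> = "restrict_space \<mu> D"
  have Ds: "D \<in> sets \<mu>" using D \<mu> by (simp add: radon_sets borel_compact)
  interpret finite_measure ?\<nu>
    using \<mu> D Ds by (intro finite_measureI)
      (auto simp: radon_measure_def space_restrict_space emeasure_restrict_space radon_space)
  have fst: "(\<lambda>z. fst z) \<in> ?\<nu> \<Otimes>\<^sub>M ?\<nu> \<rightarrow>\<^sub>M \<mu>" and snd: "(\<lambda>z. snd z) \<in> ?\<nu> \<Otimes>\<^sub>M ?\<nu> \<rightarrow>\<^sub>M \<mu>"
    using measurable_compose[OF measurable_fst measurable_restrict_space1[OF measurable_ident]]
      measurable_compose[OF measurable_snd measurable_restrict_space1[OF measurable_ident]]
    by (auto simp: id_def)
  have [measurable]: "(\<lambda>z. K (fst z) (snd z)) \<in> borel_measurable (?\<nu> \<Otimes>\<^sub>M ?\<nu>)"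
    using measurable_compose[OF measurable_Pair[OF fst snd] K] by simp
  have "(\<lambda>z. K (fst z) (snd z) * f (snd z)) \<in> borel_measurable (?\<nu> \<Otimes>\<^sub>M ?\<nu>)"
    by measurable
  then have "(\<lambda>(x, y). K x y * f y) \<in> borel_measurable (?\<nu> \<Otimes>\<^sub>M ?\<nu>)"
    by (simp add: case_prod_unfold)
  then show ?thesis
    unfolding integral_operator_def by (rule borel_measurable_lebesgue_integral)
qed

text \<open>Zero off \<open>J\<close> as well as off \<open>D\<close>: sums then run over all
  naturals, and the added functions have squared norm 0, in accordance with
  \<open>extended_eigenvalue\<close>.\<close>

definition scaled_eigenfunction ::
    "'a set \<Rightarrow> nat set \<Rightarrow> (nat \<Rightarrow> real) \<Rightarrow> (nat \<Rightarrow> 'a \<Rightarrow> complex) \<Rightarrow> nat \<Rightarrow> 'a \<Rightarrow> complex" where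
  "scaled_eigenfunction D J lam f j x =
     (if j \<in> J \<and> x \<in> D then complex_of_real (sqrt (lam j)) * f j x else 0)"

definition extended_eigenvalue :: "nat set \<Rightarrow> (nat \<Rightarrow> real) \<Rightarrow> nat \<Rightarrow> real" where
  "extended_eigenvalue J lam j = (if j \<in> J then lam j else 0)"

text \<open>Evaluating the trace in the eigenbasis itself gives the sum of the eigenvalues.\<close>

lemma summable_eigenvalues:
  assumes \<mu>: "radon_measure \<mu>" and D: "compact D" and K: "locally_square_integrable \<mu> K"
    and tr: "positive_trace_class_operator (restrict_space \<mu> D) (integral_operator (restrict_space \<mu> D) K)"
    and es: "eigensystem (restrict_space \<mu> D) (integral_operator (restrict_space \<mu> D) K) J lam f"
    and lam: "\<forall>j\<in>J. 0 \<le> lam j \<and> lam j \<le> 1"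
  shows "summable (extended_eigenvalue J lam)"
proof -
  let ?\<nu> = "restrict_space \<mu> D"
  let ?T = "integral_operator ?\<nu> K"
  have onb: "orthonormal_basis ?\<nu> J f" using es by (simp add: eigensystem_def)
  have "L2_inner ?\<nu> (?T (f j)) (f j) = complex_of_real (lam j)" if j: "j \<in> J" for j
  proof -
    have f [measurable]: "f j \<in> borel_measurable ?\<nu>"
      using onb j by (auto simp: orthonormal_basis_def L2_def)
    have [measurable]: "?T (f j) \<in> borel_measurable ?\<nu>"
      using \<mu> D K f by (intro integral_operator_measurable) (auto simp: locally_square_integrable_def)
    have "AE x in ?\<nu>. ?T (f j) x = complex_of_real (lam j) * f j x"
      using es j by (simp add: eigensystem_def)
    then have "L2_inner ?\<nu> (?T (f j)) (f j) = (\<integral>x. complex_of_real (lam j) * (f j x * cnj (f j x)) \<partial>?\<nu>)"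
      unfolding L2_inner_def by (intro integral_cong_AE) auto
    also have "\<dots> = complex_of_real (lam j) * L2_inner ?\<nu> (f j) (f j)"
      unfolding L2_inner_def by simp
    also have "L2_inner ?\<nu> (f j) (f j) = 1" using onb j by (simp add: orthonormal_basis_def)
    finally show ?thesis by simp
  qed
  moreover have "(\<lambda>j. Re (L2_inner ?\<nu> (?T (f j)) (f j))) summable_on J"
    using tr onb by (simp add: positive_trace_class_operator_def)
  ultimately have "lam summable_on J" by (simp cong: summable_on_cong)
  moreover have "lam summable_on J \<longleftrightarrow> extended_eigenvalue J lam summable_on UNIV"
    by (rule summable_on_cong_neutral) (auto simp: extended_eigenvalue_def)
  ultimately have "extended_eigenvalue J lam summable_on UNIV" by simp
  then show ?thesis
    using lam by (subst (asm) summable_on_UNIV_nonneg_real_iff) (auto simp: extended_eigenvalue_def)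
qed

lemma orthogonal_system_eigenfunctions:
  assumes \<mu>: "radon_measure \<mu>" and D: "compact D"
    and onb: "orthonormal_basis (restrict_space \<mu> D) J f"
    and lam: "\<forall>j\<in>J. 0 \<le> lam j \<and> lam j \<le> 1"
    and summable: "summable (extended_eigenvalue J lam)"
  shows "orthogonal_system \<mu> (scaled_eigenfunction D J lam f) (extended_eigenvalue J lam)"
proof -
  let ?h = "scaled_eigenfunction D J lam f" and ?t = "extended_eigenvalue J lam" and ?\<nu> = "restrict_space \<mu> D"
  interpret sigma_finite_measure \<mu> using \<mu> by (rule radon_sigma_finite)
  have Ds: "D \<inter> space \<mu> \<in> sets \<mu>" using D \<mu> by (simp add: radon_sets radon_space borel_compact)
  have f: "f j \<in> borel_measurable ?\<nu>" "integrable ?\<nu> (\<lambda>x. (cmod (f j x))\<^sup>2)" if "j \<in> J" for j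
    using onb that by (auto simp: orthonormal_basis_def L2_def)
  show ?thesis
  proof (unfold_locales)
    fix i j
    show "?h j \<in> borel_measurable \<mu>"
    proof (cases "j \<in> J")
      case True
      then have "(\<lambda>x. complex_of_real (sqrt (lam j)) * f j x) \<in> borel_measurable ?\<nu>"
        using f(1) by (intro borel_measurable_times) auto
      then have "(\<lambda>x. if x \<in> D then complex_of_real (sqrt (lam j)) * f j x else 0) \<in> borel_measurable \<mu>"
        using Ds by (subst (asm) measurable_restrict_space_iff[where c = 0]) auto
      then show ?thesis using True by (simp add: scaled_eigenfunction_def[abs_def])
    qed (simp add: scaled_eigenfunction_def[abs_def])
    show "integrable \<mu> (\<lambda>x. (cmod (?h j x))\<^sup>2)"
    proof (cases "j \<in> J")
      case True
      then have "integrable \<mu> (\<lambda>x. lam j * (indicator D x *\<^sub>R (cmod (f j x))\<^sup>2))"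
        using f(2) Ds by (simp add: integrable_restrict_space)
      also have "(\<lambda>x. lam j * (indicator D x *\<^sub>R (cmod (f j x))\<^sup>2)) = (\<lambda>x. (cmod (?h j x))\<^sup>2)"
        using True lam by (auto simp: scaled_eigenfunction_def indicator_def norm_mult power_mult_distrib)
      finally show ?thesis .
    qed (simp add: scaled_eigenfunction_def)
    show "(\<integral>x. ?h i x * cnj (?h j x) \<partial>\<mu>) = (if i = j then complex_of_real (?t j) else 0)"
    proof (cases "i \<in> J \<and> j \<in> J")
      case True
      have "(\<lambda>x. ?h i x * cnj (?h j x)) =
          (\<lambda>x. complex_of_real (sqrt (lam i) * sqrt (lam j)) * (indicator D x *\<^sub>R (f i x * cnj (f j x))))"
        using True by (auto simp: scaled_eigenfunction_def indicator_def)
      then have "(\<integral>x. ?h i x * cnj (?h j x) \<partial>\<mu>) =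
          complex_of_real (sqrt (lam i) * sqrt (lam j)) * L2_inner ?\<nu> (f i) (f j)"
        unfolding L2_inner_def integral_restrict_space[OF Ds] by (simp only: integral_mult_right_zero)
      also have "L2_inner ?\<nu> (f i) (f j) = (if i = j then 1 else 0)"
        using onb True by (simp add: orthonormal_basis_def)
      finally show ?thesis using True lam
        by (auto simp: extended_eigenvalue_def of_real_mult[symmetric] simp del: of_real_mult)
    qed (auto simp: scaled_eigenfunction_def extended_eigenvalue_def)
    show "0 \<le> ?t j" using lam by (auto simp: extended_eigenvalue_def)
    show "summable ?t" by (rule summable)
  qed
qed

section \<open>Factorial powers of counting measures\<close>

text \<open>Coordinates from disjoint sets never coincide, so nothing is subtracted, and the sum
  over tuples of atoms factorises.\<close>

lemma factorial_power_disjoint: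
  fixes \<phi> :: "'a::euclidean_space measure"
  assumes \<phi>: "\<phi> \<in> locally_finite_counting_measures"
    and B: "\<And>i. i < k \<Longrightarrow> B i \<in> sets borel" "\<And>i. i < k \<Longrightarrow> bounded (B i)" "disjoint_family_on B {..<k}"
  shows "factorial_power \<phi> k (\<Pi>\<^sub>E i\<in>{..<k}. B i) = (\<Prod>i<k. emeasure \<phi> (B i))"
proof -
  let ?P = "\<Pi>\<^sub>E i\<in>{..<k}. B i" and ?Q = "\<Pi>\<^sub>E i\<in>{..<k}. atoms \<phi> \<inter> B i"
  have "factorial_power \<phi> k ?P = (\<integral>\<^sup>+x. (\<Prod>i<k. emeasure \<phi> {x i}) \<partial>count_space ?P)"
    unfolding factorial_power_def
  proof (intro nn_integral_cong prod.cong refl)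
    fix x i assume x: "x \<in> space (count_space ?P)" and i: "i \<in> {..<k}"
    have "x l \<noteq> x i" if "l < i" for l
    proof -
      have "B l \<inter> B i = {}" using B(3) that i by (auto simp: disjoint_family_on_def)
      moreover have "x l \<in> B l" "x i \<in> B i" using x that i by (auto simp: PiE_iff)
      ultimately show ?thesis by auto
    qed
    then have "{l. l < i \<and> x l = x i} = {}" by auto
    then have 0: "card {l. l < i \<and> x l = x i} = 0" by (simp only: card.empty)
    show "emeasure \<phi> {x i} - of_nat (card {l. l < i \<and> x l = x i}) = emeasure \<phi> {x i}"
      unfolding 0 by simp
  qed
  also have "\<dots> = (\<Sum>x\<in>?Q. \<Prod>i<k. emeasure \<phi> {x i})"
  proof (rule nn_integral_count_space')
    show "finite ?Q" using B by (intro finite_PiE finite_atoms[OF \<phi>]) auto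
    show "?Q \<subseteq> ?P" by (auto simp: PiE_iff)
    fix x assume "x \<in> ?P" "x \<notin> ?Q"
    then obtain i where "i < k" "emeasure \<phi> {x i} = 0" by (auto simp: PiE_iff atoms_def)
    then show "(\<Prod>i<k. emeasure \<phi> {x i}) = 0" by (intro prod_zero) auto
  qed
  also have "\<dots> = (\<Prod>i<k. \<Sum>y\<in>atoms \<phi> \<inter> B i. emeasure \<phi> {y})"
    using B by (intro prod_sum_PiE[symmetric] finite_atoms[OF \<phi>]) auto
  also have "\<dots> = (\<Prod>i<k. emeasure \<phi> (B i))"
    using B by (intro prod.cong refl emeasure_eq_sum_atoms[OF \<phi>, symmetric]) auto
  finally show ?thesis .
qed

text \<open>A repeated atom produces a factor 1 minus at least 1, truncated to 0, while an injective
  tuple of atoms has weight 1. What remains counts injections.\<close>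

lemma factorial_power_simple:
  fixes \<phi> :: "'a::euclidean_space measure"
  assumes \<phi>: "\<phi> \<in> locally_finite_counting_measures" and D: "compact D"
    and simple: "\<forall>x\<in>D. emeasure \<phi> {x} \<le> 1"
  shows "factorial_power \<phi> k ({..<k} \<rightarrow>\<^sub>E D) = of_nat (card (injections k (atoms \<phi> \<inter> D)))"
proof -
  let ?Q = "injections k (atoms \<phi> \<inter> D)"
  have one: "emeasure \<phi> {y} = 1" if "y \<in> atoms \<phi> \<inter> D" for y
    using that simple atom_ge_1[OF \<phi>, of y] by (auto intro: antisym)
  have fin: "finite ?Q" using D by (intro finite_injections finite_atoms[OF \<phi>] compact_imp_bounded)
  have "factorial_power \<phi> k ({..<k} \<rightarrow>\<^sub>E D) =
      (\<Sum>x\<in>?Q. \<Prod>i<k. emeasure \<phi> {x i} - of_nat (card {l. l < i \<and> x l = x i}))"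
    unfolding factorial_power_def
  proof (rule nn_integral_count_space'[OF fin])
    show "?Q \<subseteq> ({..<k} \<rightarrow>\<^sub>E D)"
      using PiE_mono[of "{..<k}" "\<lambda>_. atoms \<phi> \<inter> D" "\<lambda>_. D"] by (auto simp: injections_def)
    fix x assume x: "x \<in> {..<k} \<rightarrow>\<^sub>E D" "x \<notin> ?Q"
    have "\<exists>i<k. emeasure \<phi> {x i} - of_nat (card {l. l < i \<and> x l = x i}) = 0"
    proof (cases "\<exists>i<k. x i \<notin> atoms \<phi>")
      case True
      then show ?thesis by (auto simp: atoms_def)
    next
      case False
      then have "\<not> inj_on x {..<k}" using x by (auto simp: injections_def PiE_iff)
      then obtain l i where li: "l < i" "i < k" "x l = x i"
        unfolding inj_on_def by (metis lessThan_iff nat_neq_iff)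
      have e: "emeasure \<phi> {x i} = 1" using False li x by (intro one) (auto simp: PiE_iff)
      have "l \<in> {l. l < i \<and> x l = x i}" using li by simp
      then have "0 < card {l. l < i \<and> x l = x i}" by (subst card_gt_0_iff) auto
      then have "(1::ennreal) \<le> of_nat (card {l. l < i \<and> x l = x i})"
        by (metis Suc_leI of_nat_1 of_nat_le_iff One_nat_def)
      then have "emeasure \<phi> {x i} - of_nat (card {l. l < i \<and> x l = x i}) = 0"
        unfolding e by (intro diff_eq_0_ennreal) auto
      then show ?thesis using li(2) by blast
    qed
    then show "(\<Prod>i<k. emeasure \<phi> {x i} - of_nat (card {l. l < i \<and> x l = x i})) = 0"
      by (intro prod_zero) auto
  qed
  also have "\<dots> = (\<Sum>x\<in>?Q. 1)"
  proof (intro sum.cong refl prod.neutral ballI)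
    fix x i assume x: "x \<in> ?Q" and i: "i \<in> {..<k}"
    then have "x l \<noteq> x i" if "l < i" for l
      using that by (force simp: injections_def inj_on_def)
    then have "{l. l < i \<and> x l = x i} = {}" by auto
    then have 0: "card {l. l < i \<and> x l = x i} = 0" by (simp only: card.empty)
    have "emeasure \<phi> {x i} = 1" using x i by (intro one) (auto simp: injections_def PiE_iff)
    then show "emeasure \<phi> {x i} - of_nat (card {l. l < i \<and> x l = x i}) = 1" unfolding 0 by simp
  qed
  finally show ?thesis by simp
qed

lemma emeasure_simple:
  fixes \<phi> :: "'a::euclidean_space measure"
  assumes \<phi>: "\<phi> \<in> locally_finite_counting_measures" and D: "compact D"
    and simple: "\<forall>x\<in>D. emeasure \<phi> {x} \<le> 1"
  shows "emeasure \<phi> D = of_nat (card (atoms \<phi> \<inter> D))"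
proof -
  have "emeasure \<phi> {y} = 1" if "y \<in> atoms \<phi> \<inter> D" for y
    using that simple atom_ge_1[OF \<phi>, of y] by (auto intro: antisym)
  then show ?thesis
    using emeasure_eq_sum_atoms[OF \<phi>, of D] D by (simp add: borel_compact compact_imp_bounded)
qed

section \<open>Moments and void probabilities on compact sets\<close>

text \<open>On a compact set \<open>D\<close>, a determinantal process is represented by the scaled eigenfunctions, which
  live on the whole space but vanish outside \<open>D\<close>.\<close>

lemma determinantal_process_compact:
  fixes \<Phi> :: "'w \<Rightarrow> 'a::euclidean_space measure"
  assumes dpp: "determinantal_process M \<Phi> \<mu> K" and D: "compact D"
  obtains h t where "orthogonal_system \<mu> h t" "\<And>j. t j \<le> 1" "\<And>j x. x \<notin> D \<Longrightarrow> h j x = 0"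
    "\<And>k A. 1 \<le> k \<Longrightarrow> A \<in> sets (PiM {..<k} (\<lambda>_. borel)) \<Longrightarrow> A \<subseteq> {..<k} \<rightarrow>\<^sub>E D \<Longrightarrow>
      factorial_moment_measure M \<Phi> k A =
      (\<integral>\<^sup>+x\<in>A. ennreal (Re (orthogonal_system.kernel_det h k x)) \<partial>PiM {..<k} (\<lambda>_. \<mu>))"
    "AE \<omega> in M. \<forall>x\<in>D. emeasure (\<Phi> \<omega>) {x} \<le> 1"
proof -
  let ?\<nu> = "restrict_space \<mu> D"
  let ?T = "integral_operator ?\<nu> K"
  have \<mu>: "radon_measure \<mu>" and K: "locally_square_integrable \<mu> K"
    using dpp by (auto simp: determinantal_process_def)
  obtain J lam f where tr: "positive_trace_class_operator ?\<nu> ?T" and es: "eigensystem ?\<nu> ?T J lam f"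
    and lam: "\<forall>j\<in>J. 0 \<le> lam j \<and> lam j \<le> 1" and AE1: "AE \<omega> in M. \<forall>x\<in>D. emeasure (\<Phi> \<omega>) {x} \<le> 1"
    and ji: "joint_intensities_on M \<Phi> \<mu> D
              (\<lambda>k x. ennreal (Re (Determinant.det
                 (Matrix.mat k k (\<lambda>(i, j). spectral_kernel J lam f (x i) (x j))))))"
    using dpp D unfolding determinantal_process_def Let_def by blast
  define h where "h = scaled_eigenfunction D J lam f"
  define t where "t = extended_eigenvalue J lam"
  interpret orthogonal_system \<mu> h t
    unfolding h_def t_def using \<mu> D lam summable_eigenvalues[OF \<mu> D K tr es lam] es
    by (intro orthogonal_system_eigenfunctions) (auto simp: eigensystem_def)
  \<comment> \<open>\<open>infsum\<close> is matched with \<open>suminf\<close> by absolute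
    convergence, which holds where both diagonal densities are finite; the other points form a null
    set.\<close>
  have ker: "spectral_kernel J lam f x y = kernel x y"
    if x: "x \<in> D" "diag_density x < \<infinity>" and y: "y \<in> D" "diag_density y < \<infinity>" for x y
  proof -
    have s: "summable (\<lambda>m. norm (h m x * cnj (h m y)))" using x y by (intro summable_kernel)
    have "((\<lambda>m. h m x * cnj (h m y)) has_sum kernel x y) UNIV"
      unfolding kernel_def by (rule norm_summable_imp_has_sum[OF s summable_sums[OF summable_norm_cancel[OF s]]])
    then have "kernel x y = (\<Sum>\<^sub>\<infinity>m\<in>UNIV. h m x * cnj (h m y))" by (rule infsumI[symmetric])
    also have "\<dots> = spectral_kernel J lam f x y"
      unfolding spectral_kernel_def
    proof (rule infsum_cong_neutral)
      fix m assume "m \<in> UNIV \<inter> J"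
      then have "m \<in> J" by simp
      then have sq: "complex_of_real (sqrt (lam m)) * complex_of_real (sqrt (lam m)) = complex_of_real (lam m)"
        using lam by (simp add: of_real_mult[symmetric] del: of_real_mult)
      have "h m x * cnj (h m y) =
          complex_of_real (sqrt (lam m)) * complex_of_real (sqrt (lam m)) * (f m x * cnj (f m y))"
        using x(1) y(1) \<open>m \<in> J\<close> by (simp add: h_def scaled_eigenfunction_def)
      then show "h m x * cnj (h m y) = complex_of_real (lam m) * f m x * cnj (f m y)"
        unfolding sq by (simp only: mult.assoc)
    qed (auto simp: h_def scaled_eigenfunction_def)
    finally show ?thesis by simp
  qed
  show thesis
  proof (rule that[of h t])
    show "orthogonal_system \<mu> h t" by unfold_locales
    show "t j \<le> 1" for j using lam by (auto simp: t_def extended_eigenvalue_def)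
    show "h j x = 0" if "x \<notin> D" for j x using that by (simp add: h_def scaled_eigenfunction_def)
    show "AE \<omega> in M. \<forall>x\<in>D. emeasure (\<Phi> \<omega>) {x} \<le> 1" by (rule AE1)
    fix k :: nat and A :: "(nat \<Rightarrow> 'a) set"
    assume k: "1 \<le> k" and A: "A \<in> sets (PiM {..<k} (\<lambda>_. borel))" "A \<subseteq> {..<k} \<rightarrow>\<^sub>E D"
    have "factorial_moment_measure M \<Phi> k A = (\<integral>\<^sup>+x\<in>A. ennreal (Re (Determinant.det
          (Matrix.mat k k (\<lambda>(i, j). spectral_kernel J lam f (x i) (x j))))) \<partial>power_measure k)"
      using ji k A unfolding joint_intensities_on_def by blast
    also have "\<dots> = (\<integral>\<^sup>+x\<in>A. ennreal (Re (kernel_det k x)) \<partial>power_measure k)"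
    proof (rule nn_integral_cong_AE)
      show "AE x in power_measure k. ennreal (Re (Determinant.det
          (Matrix.mat k k (\<lambda>(i, j). spectral_kernel J lam f (x i) (x j))))) * indicator A x =
          ennreal (Re (kernel_det k x)) * indicator A x"
        using AE_power_measure_component[OF AE_density_finite, of k]
      proof eventually_elim
        case (elim x)
        show ?case
        proof (cases "x \<in> A")
          case True
          then have "x i \<in> D" if "i < k" for i using A(2) that by (auto simp: PiE_iff)
          then have "Matrix.mat k k (\<lambda>(i, j). spectral_kernel J lam f (x i) (x j)) =
              Matrix.mat k k (\<lambda>(i, j). kernel (x i) (x j))"
            using elim by (intro eq_matI) (auto intro!: ker)
          then show ?thesis by (simp add: kernel_det_def)
        qed simp
      qed
    qed
    finally show "factorial_moment_measure M \<Phi> k A = (\<integral>\<^sup>+x\<in>A. ennreal (Re (kernel_det k x)) \<partial>power_measure k)" .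
  qed
qed

lemma factorial_moment_measure_disjoint:
  fixes \<Phi> :: "'w \<Rightarrow> 'a::euclidean_space measure"
  assumes pp: "point_process M \<Phi>"
    and B: "\<And>i. i < k \<Longrightarrow> B i \<in> sets borel" "\<And>i. i < k \<Longrightarrow> bounded (B i)" "disjoint_family_on B {..<k}"
  shows "factorial_moment_measure M \<Phi> k (\<Pi>\<^sub>E i\<in>{..<k}. B i) = (\<integral>\<^sup>+\<omega>. (\<Prod>i<k. emeasure (\<Phi> \<omega>) (B i)) \<partial>M)"
  unfolding factorial_moment_measure_def
  using B point_process_lfcm[OF pp] by (intro nn_integral_cong factorial_power_disjoint) auto

lemma mean_measure_eq_density:
  fixes \<Phi> :: "'w \<Rightarrow> 'a::euclidean_space measure"
  assumes pp: "point_process M \<Phi>" and os: "orthogonal_system \<mu> h t" and \<mu>: "radon_measure \<mu>" and D: "compact D"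
    and fm: "\<And>k A. 1 \<le> k \<Longrightarrow> A \<in> sets (PiM {..<k} (\<lambda>_. borel)) \<Longrightarrow> A \<subseteq> {..<k} \<rightarrow>\<^sub>E D \<Longrightarrow>
      factorial_moment_measure M \<Phi> k A =
      (\<integral>\<^sup>+x\<in>A. ennreal (Re (orthogonal_system.kernel_det h k x)) \<partial>PiM {..<k} (\<lambda>_. \<mu>))"
    and B: "B \<in> sets borel" "B \<subseteq> D"
  shows "mean_measure M \<Phi> B = (\<integral>\<^sup>+y\<in>B. orthogonal_system.diag_density h y \<partial>\<mu>)"
proof -
  interpret orthogonal_system \<mu> h t by (rule os)
  have "bounded B" using B D bounded_subset compact_imp_bounded by blast
  then have "mean_measure M \<Phi> B = factorial_moment_measure M \<Phi> 1 (\<Pi>\<^sub>E i\<in>{..<1}. B)"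
    using factorial_moment_measure_disjoint[OF pp, of 1 "\<lambda>_. B"] B
    by (simp add: mean_measure_def disjoint_family_on_def)
  also have "\<dots> = (\<integral>\<^sup>+x\<in>(\<Pi>\<^sub>E i\<in>{..<1}. B). ennreal (Re (kernel_det 1 x)) \<partial>power_measure 1)"
    using B by (intro fm sets_PiM_I_finite) (auto simp: PiE_iff)
  also have "\<dots> = (\<integral>\<^sup>+y\<in>B. diag_density y \<partial>\<mu>)"
    using B \<mu> by (intro nn_integral_kernel_det_1) (simp add: radon_sets)
  finally show ?thesis .
qed

lemma determinantal_process_prod_le:
  fixes \<Phi> :: "'w \<Rightarrow> 'a::euclidean_space measure" and B :: "nat \<Rightarrow> 'a set"
  assumes dpp: "determinantal_process M \<Phi> \<mu> K" and k: "1 \<le> k"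
    and B: "\<And>i. i < k \<Longrightarrow> B i \<in> sets borel" "\<And>i. i < k \<Longrightarrow> bounded (B i)" "disjoint_family_on B {..<k}"
  shows "(\<integral>\<^sup>+\<omega>. (\<Prod>i<k. emeasure (\<Phi> \<omega>) (B i)) \<partial>M) \<le> (\<Prod>i<k. mean_measure M \<Phi> (B i))"
proof -
  have pp: "point_process M \<Phi>" and \<mu>: "radon_measure \<mu>" using dpp by (auto simp: determinantal_process_def)
  have "bounded (\<Union>i<k. B i)" using B by (intro bounded_UN) auto
  \<comment> \<open>Each compact set has its own eigensystem, so all \<open>B i\<close> and their
    mean measures are treated in one common ball.\<close>
  then obtain R where R: "(\<Union>i<k. B i) \<subseteq> cball 0 R" by (auto simp: bounded_iff subset_iff)
  obtain h t where os: "orthogonal_system \<mu> h t"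
    and fm: "\<And>k A. 1 \<le> k \<Longrightarrow> A \<in> sets (PiM {..<k} (\<lambda>_. borel)) \<Longrightarrow> A \<subseteq> {..<k} \<rightarrow>\<^sub>E cball 0 R \<Longrightarrow>
      factorial_moment_measure M \<Phi> k A =
      (\<integral>\<^sup>+x\<in>A. ennreal (Re (orthogonal_system.kernel_det h k x)) \<partial>PiM {..<k} (\<lambda>_. \<mu>))"
    by (rule determinantal_process_compact[OF dpp compact_cball]) blast
  interpret orthogonal_system \<mu> h t by (rule os)
  have "(\<integral>\<^sup>+\<omega>. (\<Prod>i<k. emeasure (\<Phi> \<omega>) (B i)) \<partial>M) = factorial_moment_measure M \<Phi> k (\<Pi>\<^sub>E i\<in>{..<k}. B i)"
    using B by (intro factorial_moment_measure_disjoint[OF pp, symmetric])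
  also have "\<dots> = (\<integral>\<^sup>+x\<in>(\<Pi>\<^sub>E i\<in>{..<k}. B i). ennreal (Re (kernel_det k x)) \<partial>power_measure k)"
    using B R k by (intro fm sets_PiM_I_finite PiE_mono) auto
  also have "\<dots> \<le> (\<Prod>i<k. \<integral>\<^sup>+y\<in>B i. diag_density y \<partial>\<mu>)"
    using B \<mu> by (intro nn_integral_kernel_det_le) (simp add: radon_sets)
  also have "\<dots> = (\<Prod>i<k. mean_measure M \<Phi> (B i))"
  proof (intro prod.cong refl)
    fix i assume "i \<in> {..<k}"
    then show "(\<integral>\<^sup>+y\<in>B i. diag_density y \<partial>\<mu>) = mean_measure M \<Phi> (B i)"
      using B(1) R by (intro mean_measure_eq_density[OF pp os \<mu> compact_cball fm, symmetric]) auto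
  qed
  finally show ?thesis .
qed

lemma determinantal_process_void_compact:
  fixes \<Phi> :: "'w \<Rightarrow> 'a::euclidean_space measure"
  assumes dpp: "determinantal_process M \<Phi> \<mu> K" and D: "compact D"
  shows "measure M {\<omega>\<in>space M. emeasure (\<Phi> \<omega>) D = 0} \<le> exp_neg (mean_measure M \<Phi> D)"
proof -
  have pp: "point_process M \<Phi>" and \<mu>: "radon_measure \<mu>" using dpp by (auto simp: determinantal_process_def)
  interpret prob_space M using pp by (rule point_process_prob_space)
  have Db: "D \<in> sets borel" "bounded D" using D by (auto simp: borel_compact compact_imp_bounded)
  obtain h t where os: "orthogonal_system \<mu> h t" and t1: "\<And>j. t j \<le> 1"
    and h0: "\<And>j x. x \<notin> D \<Longrightarrow> h j x = 0"
    and fm: "\<And>k A. 1 \<le> k \<Longrightarrow> A \<in> sets (PiM {..<k} (\<lambda>_. borel)) \<Longrightarrow> A \<subseteq> {..<k} \<rightarrow>\<^sub>E D \<Longrightarrow>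
      factorial_moment_measure M \<Phi> k A =
      (\<integral>\<^sup>+x\<in>A. ennreal (Re (orthogonal_system.kernel_det h k x)) \<partial>PiM {..<k} (\<lambda>_. \<mu>))"
    and simple: "AE \<omega> in M. \<forall>x\<in>D. emeasure (\<Phi> \<omega>) {x} \<le> 1"
    using determinantal_process_compact[OF dpp D] by blast
  interpret os: orthogonal_system \<mu> h t by (rule os)
  have "mean_measure M \<Phi> D = (\<integral>\<^sup>+y\<in>D. os.diag_density y \<partial>\<mu>)"
    using Db by (intro mean_measure_eq_density[OF pp os \<mu> D fm]) auto
  \<comment> \<open>The functions \<open>h j\<close> vanish outside \<open>D\<close>, so integrating
    over \<open>D\<close> already gives the full trace.\<close>
  also have "\<dots> = (\<integral>\<^sup>+y. os.diag_density y \<partial>\<mu>)"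
    by (intro nn_integral_cong) (auto simp: os.diag_density_def h0 indicator_def)
  also have "\<dots> = ennreal (suminf t)" by (rule os.nn_integral_diag_density)
  finally have mean: "mean_measure M \<Phi> D = ennreal (suminf t)" .
  define X where "X \<omega> = nat \<lfloor>enn2real (emeasure (\<Phi> \<omega>) D)\<rfloor>" for \<omega>
  have [measurable]: "(\<lambda>\<omega>. emeasure (\<Phi> \<omega>) D) \<in> borel_measurable M"
    using pp Db(1) by (rule point_process_measurable)
  have X: "emeasure (\<Phi> \<omega>) D = of_nat (X \<omega>)" if \<omega>: "\<omega> \<in> space M" for \<omega>
  proof -
    obtain n where "emeasure (\<Phi> \<omega>) D = of_nat n"
      using lfcm_Nats[OF point_process_lfcm[OF pp \<omega>] Db] by (rule ennreal_Nats_cases)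
    then show ?thesis by (simp add: X_def)
  qed
  have Xm: "X \<in> M \<rightarrow>\<^sub>M count_space UNIV" unfolding X_def by measurable
  have mom: "(\<lambda>N. ennreal (elem_sym t {..<N} k)) \<longlonglongrightarrow> (\<integral>\<^sup>+\<omega>. ennreal (X \<omega> choose k) \<partial>M)" for k
  proof (cases "k = 0")
    \<comment> \<open>Joint intensities are prescribed from \<open>k = 1\<close> on; the zeroth
      moment is the total probability.\<close>
    case True
    have "{X. X \<subseteq> {..<N} \<and> card X = 0} = {{}}" for N :: nat
      using finite_subset[of _ "{..<N}"] by auto
    then have "elem_sym t {..<N} 0 = 1" for N by (simp add: elem_sym_def)
    then show ?thesis using True emeasure_space_1 by simp
  next
    case False
    have DP: "({..<k} \<rightarrow>\<^sub>E D) \<in> sets (PiM {..<k} (\<lambda>_. borel))"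
      using Db by (intro sets_PiM_I_finite) auto
    have DP': "({..<k} \<rightarrow>\<^sub>E D) \<in> sets (os.power_measure k)"
      using Db \<mu> by (intro sets_PiM_I_finite) (auto simp: radon_sets)
    have "(\<lambda>N. \<integral>\<^sup>+x\<in>({..<k} \<rightarrow>\<^sub>E D). ennreal (Re (os.trunc_det N k x)) \<partial>os.power_measure k)
        \<longlonglongrightarrow> factorial_moment_measure M \<Phi> k ({..<k} \<rightarrow>\<^sub>E D)"
      using False os.nn_integral_trunc_det_tendsto[OF DP'] fm[OF _ DP] by simp
    moreover have "(\<integral>\<^sup>+x\<in>({..<k} \<rightarrow>\<^sub>E D). ennreal (Re (os.trunc_det N k x)) \<partial>os.power_measure k) =
        ennreal (fact k) * ennreal (elem_sym t {..<N} k)" for N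
    proof -
      have "(\<integral>\<^sup>+x\<in>({..<k} \<rightarrow>\<^sub>E D). ennreal (Re (os.trunc_det N k x)) \<partial>os.power_measure k) =
          (\<integral>\<^sup>+x. ennreal (Re (os.trunc_det N k x)) \<partial>os.power_measure k)"
      proof (rule nn_integral_cong)
        fix x assume x: "x \<in> space (os.power_measure k)"
        show "ennreal (Re (os.trunc_det N k x)) * indicator ({..<k} \<rightarrow>\<^sub>E D) x = ennreal (Re (os.trunc_det N k x))"
        proof (cases "x \<in> {..<k} \<rightarrow>\<^sub>E D")
          case False
          then obtain i where "i < k" "x i \<notin> D" using x by (auto simp: space_PiM PiE_iff)
          \<comment> \<open>A coordinate outside \<open>D\<close> gives a zero vector in the Gram
            matrix, so Hadamard's bound forces the determinant to vanish.\<close>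
          then have 0: "(\<Prod>i<k. \<Sum>m<N. (cmod (h m (x i)))\<^sup>2) = 0"
            using h0 by (intro prod_zero) (auto intro!: bexI[of _ i])
          obtain s where s: "0 \<le> s" "os.trunc_det N k x = complex_of_real s"
              "s \<le> (\<Prod>i<k. \<Sum>m<N. (cmod (h m (x i)))\<^sup>2)"
            by (rule os.trunc_det_bounds)
          then have "s = 0" unfolding 0 by simp
          then show ?thesis using s(2) by simp
        qed simp
      qed
      then show ?thesis
        using os.nn_integral_trunc_det[where N = N and k = k]
        by (simp add: ennreal_mult' os.t_nonneg elem_sym_nonneg)
    qed
    moreover have "factorial_moment_measure M \<Phi> k ({..<k} \<rightarrow>\<^sub>E D) =
        ennreal (fact k) * (\<integral>\<^sup>+\<omega>. ennreal (X \<omega> choose k) \<partial>M)"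
    proof -
      have "factorial_moment_measure M \<Phi> k ({..<k} \<rightarrow>\<^sub>E D) = (\<integral>\<^sup>+\<omega>. ennreal (fact k) * ennreal (X \<omega> choose k) \<partial>M)"
        unfolding factorial_moment_measure_def
      proof (rule nn_integral_cong_AE)
        show "AE \<omega> in M. factorial_power (\<Phi> \<omega>) k ({..<k} \<rightarrow>\<^sub>E D) = ennreal (fact k) * ennreal (X \<omega> choose k)"
          using simple AE_space
        proof eventually_elim
          case (elim \<omega>)
          have \<phi>: "\<Phi> \<omega> \<in> locally_finite_counting_measures" using pp elim(2) by (rule point_process_lfcm)
          have "(of_nat (X \<omega>) :: ennreal) = of_nat (card (atoms (\<Phi> \<omega>) \<inter> D))"
            unfolding X[OF elim(2), symmetric] by (rule emeasure_simple[OF \<phi> D elim(1)])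
          then have Xc: "X \<omega> = card (atoms (\<Phi> \<omega>) \<inter> D)" by (simp only: of_nat_eq_iff)
          show ?case
            unfolding factorial_power_simple[OF \<phi> D elim(1)] Xc ennreal_of_nat_eq_real_of_nat
              card_injections[OF finite_atoms[OF \<phi> Db(2)]]
            by (rule ennreal_mult') simp
        qed
      qed
      also have "\<dots> = ennreal (fact k) * (\<integral>\<^sup>+\<omega>. ennreal (X \<omega> choose k) \<partial>M)"
        using Xm by (intro nn_integral_cmult) measurable
      finally show ?thesis .
    qed
    ultimately have "(\<lambda>N. ennreal (fact k) * ennreal (elem_sym t {..<N} k)) \<longlonglongrightarrow>
        ennreal (fact k) * (\<integral>\<^sup>+\<omega>. ennreal (X \<omega> choose k) \<partial>M)" by simp
    then have "(\<lambda>N. ennreal (1 / fact k) * (ennreal (fact k) * ennreal (elem_sym t {..<N} k))) \<longlonglongrightarrow>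
        ennreal (1 / fact k) * (ennreal (fact k) * (\<integral>\<^sup>+\<omega>. ennreal (X \<omega> choose k) \<partial>M))"
      by (rule ennreal_tendsto_cmult[rotated]) simp
    moreover have "ennreal (1 / fact k) * ennreal (fact k) = 1"
      by (simp add: ennreal_mult[symmetric])
    ultimately show ?thesis by (simp add: mult.assoc[symmetric])
  qed
  have "prob {\<omega>\<in>space M. X \<omega> = 0} \<le> exp (- suminf t)"
    by (rule void_prob_le[OF Xm os.t_nonneg t1 os.t_summable mom])
  moreover have "{\<omega>\<in>space M. emeasure (\<Phi> \<omega>) D = 0} = {\<omega>\<in>space M. X \<omega> = 0}"
    using X by auto
  moreover have "exp_neg (mean_measure M \<Phi> D) = exp (- suminf t)"
    by (simp add: mean exp_neg_def suminf_nonneg os.t_nonneg os.t_summable)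
  ultimately show ?thesis by simp
qed

section \<open>Inner regularity of the mean measure\<close>

text \<open>The mean measure is only a set function. Packaged as a measure after cutting with
  \<open>C\<close>, it is finite for bounded \<open>C\<close>, as \<open>inner_regular\<close>
  demands.\<close>

lemma mean_measure_restricted:
  fixes \<Phi> :: "'w \<Rightarrow> 'a::euclidean_space measure"
  assumes pp: "point_process M \<Phi>" and C: "C \<in> sets borel" and A: "A \<in> sets borel"
  shows "emeasure (measure_of UNIV (sets borel) (\<lambda>A. mean_measure M \<Phi> (A \<inter> C))) A = mean_measure M \<Phi> (A \<inter> C)"
proof (rule emeasure_measure_of)
  have sets: "sets (\<Phi> \<omega>) = sets borel" if "\<omega> \<in> space M" for \<omega>
    using point_process_lfcm[OF pp that] by (rule lfcm_sets)
  let ?m = "measure_of UNIV (sets borel) (\<lambda>A. mean_measure M \<Phi> (A \<inter> C))"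
  have sm: "sets ?m = sets borel" by (simp add: sets.sigma_sets_eq[of borel, simplified])
  show "positive (sets ?m) (\<lambda>A. mean_measure M \<Phi> (A \<inter> C))" by (simp add: positive_def mean_measure_def)
  show "countably_additive (sets ?m) (\<lambda>A. mean_measure M \<Phi> (A \<inter> C))"
    unfolding countably_additive_def sm
  proof (intro allI impI)
    fix F :: "nat \<Rightarrow> 'a set" assume F: "range F \<subseteq> sets borel" "disjoint_family F" "(\<Union>i. F i) \<in> sets borel"
    have "(\<Sum>i. mean_measure M \<Phi> (F i \<inter> C)) = (\<integral>\<^sup>+\<omega>. (\<Sum>i. emeasure (\<Phi> \<omega>) (F i \<inter> C)) \<partial>M)"
      unfolding mean_measure_def using F C
      by (intro nn_integral_suminf[symmetric] point_process_measurable[OF pp]) auto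
    also have "\<dots> = (\<integral>\<^sup>+\<omega>. emeasure (\<Phi> \<omega>) (\<Union>i. F i \<inter> C) \<partial>M)"
      using F C by (intro nn_integral_cong suminf_emeasure) (auto simp: sets disjoint_family_on_def)
    finally show "(\<Sum>i. mean_measure M \<Phi> (F i \<inter> C)) = mean_measure M \<Phi> ((\<Union>i. F i) \<inter> C)"
      by (simp add: mean_measure_def)
  qed
qed (use A in auto)

text \<open>Inner regularity treats the bounded pieces of \<open>B\<close>, and monotone convergence
  exhausts \<open>B\<close> by them, so an infinite mean is covered too.\<close>

lemma mean_measure_inner_regular:
  fixes \<Phi> :: "'w \<Rightarrow> 'a::euclidean_space measure"
  assumes pp: "point_process M \<Phi>" and B: "B \<in> sets borel" and le: "\<And>D. compact D \<Longrightarrow> D \<subseteq> B \<Longrightarrow> mean_measure M \<Phi> D \<le> c"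
  shows "mean_measure M \<Phi> B \<le> c"
proof -
  have sets: "sets (\<Phi> \<omega>) = sets borel" if "\<omega> \<in> space M" for \<omega>
    using point_process_lfcm[OF pp that] by (rule lfcm_sets)
  have bounded_le: "mean_measure M \<Phi> (B \<inter> cball 0 (real n)) \<le> c" for n
  proof -
    let ?C = "cball (0::'a) (real n)"
    let ?m = "measure_of UNIV (sets borel) (\<lambda>A. mean_measure M \<Phi> (A \<inter> ?C))"
    have m: "emeasure ?m A = mean_measure M \<Phi> (A \<inter> ?C)" if "A \<in> sets borel" for A
      using pp that by (intro mean_measure_restricted) auto
    have sm: "sets ?m = sets borel" by (simp add: sets.sigma_sets_eq[of borel, simplified])
    have "mean_measure M \<Phi> ?C < \<infinity>" using pp by (simp add: point_process_def)
    then have "emeasure ?m (space ?m) \<noteq> \<infinity>" using m[of UNIV] by simp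
    then have "emeasure ?m (B \<inter> ?C) = (SUP K\<in>{K. K \<subseteq> B \<inter> ?C \<and> compact K}. emeasure ?m K)"
      using sm B by (intro inner_regular) auto
    also have "\<dots> \<le> c"
    proof (intro SUP_least)
      fix K assume K: "K \<in> {K. K \<subseteq> B \<inter> ?C \<and> compact K}"
      then have "emeasure ?m K = mean_measure M \<Phi> K" by (subst m) (auto simp: borel_compact Int_absorb2)
      then show "emeasure ?m K \<le> c" using K le by auto
    qed
    finally show ?thesis using B by (simp add: m Int_assoc)
  qed
  have "emeasure (\<Phi> \<omega>) B = (SUP n. emeasure (\<Phi> \<omega>) (B \<inter> cball 0 (real n)))" if "\<omega> \<in> space M" for \<omega>
  proof -
    have "(\<Union>n. B \<inter> cball 0 (real n)) = B" using real_arch_simple by auto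
    moreover have "(SUP n. emeasure (\<Phi> \<omega>) (B \<inter> cball 0 (real n))) = emeasure (\<Phi> \<omega>) (\<Union>n. B \<inter> cball 0 (real n))"
    proof (rule SUP_emeasure_incseq)
      show "range (\<lambda>n. B \<inter> cball 0 (real n)) \<subseteq> sets (\<Phi> \<omega>)" unfolding sets[OF that] using B by auto
      show "incseq (\<lambda>n. B \<inter> cball 0 (real n))" unfolding incseq_def by force
    qed
    ultimately show ?thesis by (simp only:)
  qed
  then have "mean_measure M \<Phi> B = (\<integral>\<^sup>+\<omega>. (SUP n. emeasure (\<Phi> \<omega>) (B \<inter> cball 0 (real n))) \<partial>M)"
    unfolding mean_measure_def by (intro nn_integral_cong) auto
  also have "\<dots> = (SUP n. mean_measure M \<Phi> (B \<inter> cball 0 (real n)))"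
    unfolding mean_measure_def
  proof (rule nn_integral_monotone_convergence_SUP_AE)
    show "AE \<omega> in M. emeasure (\<Phi> \<omega>) (B \<inter> cball 0 (real i)) \<le> emeasure (\<Phi> \<omega>) (B \<inter> cball 0 (real (Suc i)))" for i
      using AE_space by eventually_elim (rule emeasure_mono, use B sets in auto)
    show "(\<lambda>\<omega>. emeasure (\<Phi> \<omega>) (B \<inter> cball 0 (real i))) \<in> borel_measurable M" for i
      using B by (intro point_process_measurable[OF pp]) auto
  qed
  also have "\<dots> \<le> c" using bounded_le by (rule SUP_least)
  finally show ?thesis .
qed

text \<open>Reads the void inequality as an upper bound on the mean, the form that passes to suprema
  over compact subsets.\<close>

lemma le_exp_neg_iff:
  assumes "0 < p" "p \<le> 1"
  shows "p \<le> exp_neg m \<longleftrightarrow> m \<le> ennreal (- ln p)"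
proof (cases m)
  case (real r)
  have "p \<le> exp (- r) \<longleftrightarrow> r \<le> - ln p"
    using assms(1) ln_le_cancel_iff[of p "exp (- r)"] by auto
  then show ?thesis using real assms by (simp add: exp_neg_def)
qed (use assms in \<open>simp add: exp_neg_def top_unique\<close>)

text \<open>A void \<open>B\<close> makes every compact subset void, so the probability for
  \<open>B\<close> bounds the means of all compact subsets at once. Probability 0 is treated apart
  because of the logarithm.\<close>

lemma determinantal_process_void:
  fixes \<Phi> :: "'w \<Rightarrow> 'a::euclidean_space measure"
  assumes dpp: "determinantal_process M \<Phi> \<mu> K" and B: "B \<in> sets borel"
  shows "measure M {\<omega>\<in>space M. emeasure (\<Phi> \<omega>) B = 0} \<le> exp_neg (mean_measure M \<Phi> B)"
proof -
  have pp: "point_process M \<Phi>" using dpp by (simp add: determinantal_process_def)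
  interpret prob_space M using pp by (rule point_process_prob_space)
  define p where "p = prob {\<omega>\<in>space M. emeasure (\<Phi> \<omega>) B = 0}"
  show ?thesis
  proof (cases "p = 0")
    case True
    then show ?thesis by (simp add: p_def exp_neg_def)
  next
    case False
    then have p: "0 < p" "p \<le> 1" by (simp_all add: p_def zero_less_measure_iff)
    have "mean_measure M \<Phi> D \<le> ennreal (- ln p)" if D: "compact D" "D \<subseteq> B" for D
    proof -
      have [measurable]: "(\<lambda>\<omega>. emeasure (\<Phi> \<omega>) D) \<in> borel_measurable M"
        using D by (intro point_process_measurable[OF pp] borel_compact)
      have "emeasure (\<Phi> \<omega>) D = 0" if "\<omega> \<in> space M" "emeasure (\<Phi> \<omega>) B = 0" for \<omega>
      proof -
        have "emeasure (\<Phi> \<omega>) D \<le> emeasure (\<Phi> \<omega>) B"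
          using D B lfcm_sets[OF point_process_lfcm[OF pp that(1)]] by (intro emeasure_mono) auto
        then show ?thesis using that(2) by simp
      qed
      then have "p \<le> prob {\<omega>\<in>space M. emeasure (\<Phi> \<omega>) D = 0}"
        unfolding p_def by (intro finite_measure_mono) auto
      also have "\<dots> \<le> exp_neg (mean_measure M \<Phi> D)" by (rule determinantal_process_void_compact[OF dpp D(1)])
      finally show ?thesis using p by (simp add: le_exp_neg_iff)
    qed
    then have "mean_measure M \<Phi> B \<le> ennreal (- ln p)" by (rule mean_measure_inner_regular[OF pp B])
    then show ?thesis using p by (simp add: le_exp_neg_iff p_def[symmetric])
  qed
qed

lemma determinantal_process_weakly_sub_Poisson:
  assumes "determinantal_process M \<Phi> \<mu> K"
  shows "weakly_sub_Poisson M \<Phi>"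
  unfolding weakly_sub_Poisson_def
  using determinantal_process_void[OF assms] determinantal_process_prod_le[OF assms] assms
  by (auto simp: determinantal_process_def)

theorem corollary5p7:
  fixes M :: "'w measure" and \<Phi> :: "'w \<Rightarrow> 'a::euclidean_space measure"
  shows "(\<forall>l::real. 0 < l \<and> weakly_sub_Poisson M \<Phi> \<and> stationary M \<Phi> \<and> has_intensity M \<Phi> l \<longrightarrow>
            (let d = DIM('a);
                 lower = (1/2) * (1 / (l * (3 ^ d - 1)) powr (1 / real d));
                 upper = sqrt (real d) * (ln (3 ^ d - 2) / l) powr (1 / real d)
             in 0 < lower \<and> ereal lower \<le> critical_radius M \<Phi> \<and>
                (2 \<le> d \<longrightarrow> critical_radius M \<Phi> \<le> ereal upper \<and> ereal upper < \<infinity>)))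
       \<and> (\<forall>\<mu> K. determinantal_process M \<Phi> \<mu> K \<longrightarrow> weakly_sub_Poisson M \<Phi>)"
proof -
  have "(3::real) ^ 1 \<le> 3 ^ DIM('a)" by (intro power_increasing) (auto simp: Suc_leI)
  then have "0 < (1/2) * (1 / (l * (3 ^ DIM('a) - 1)) powr (1 / real DIM('a)))" if "0 < l" for l :: real
    using that by simp
  then show ?thesis
    using critical_radius_ge[where 'a = 'a] critical_radius_le[where 'a = 'a]
      determinantal_process_weakly_sub_Poisson
    unfolding Let_def by auto
qed

end
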